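(* Let $S\subseteq\mathbb{N}^d$ be a simplicial, fully embedded affine semigroup with extremal rays $\mathbf{a}_1,\dots,\mathbf{a}_d$, let $\mathbb{K}$ be a field, and let $R=\mathbb{K}[S]$. Let $$\omega_S=\{-\mathbf{f} : \mathbf{f}\in \mathrm{QF}(S)\}+S .$$ If $R$ is Cohen-Macaulay, then $\mathbb{K}[\omega_S]$ is a canonical module of $R$.
   Context: Setting: $\mathbb{N}$ contains $0$. $S\subseteq\mathbb{N}^d$ ($d\ge 1$) is an affine semigroup (finitely generated additive submonoid) minimally generated by $\mathbf{a}_1,\dots,\mathbf{a}_{d+r}$, simplicial and fully embedded in $\mathbb{N}^d$ with extremal rays $\mathbf{a}_1,\dots,\mathbf{a}_d$: the vectors $\mathbf{a}_1,\dots,\mathbf{a}_d$ are linearly independent and $S\subseteq\sum_{i=1}^d\mathbb{Q}_{\ge0}\mathbf{a}_i$. Moreover each $\mathbf{a}_i$ ($1\le i\le d$) is the smallest generator on its extremal ray: if another generator $\mathbf{a}_j=q\mathbf{a}_i$ with $0\neq q\in\mathbb{Q}$, then $q>1$. $\mathbb{K}[S]=\mathbb{K}[\mathbf{x}^{\mathbf{a}}:\mathbf{a}\in S]$ is the semigroup ring, graded by $\deg \mathbf{x}^{\mathbf{a}}=\mathbf{a}$, with monomial maximal ideal $\mathfrak{m}$ spanned by $\mathbf{x}^{\mathbf{a}}$, $\mathbf{a}\in S\setminus\{\mathbf 0\}$. $\mathrm{group}(S)=\{\mathbf{a}-\mathbf{b}:\mathbf{a},\mathbf{b}\in S\}$.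 For $H\subseteq\mathrm{group}(S)$ with $S+H\subseteq H$, $\mathbb{K}[H]$ is the $\mathbb{K}$-linear span of the monomials $\mathbf{x}^{\mathbf{a}}$, $\mathbf{a}\in H$ (a fractional ideal of $\mathbb{K}[S]$, hence a graded module). Let $E=\{\mathbf{a}_1,\dots,\mathbf{a}_d\}$ and $\mathrm{Ap}(S,E)=\{\mathbf{a}\in S : \mathbf{a}-\mathbf{a}_i\notin S \text{ for all } i=1,\dots,d\}$ (a finite set). The order $\preceq_S$ is: $\mathbf{b}\preceq_S\mathbf{a}$ iff $\mathbf{a}-\mathbf{b}\in S$. The set of quasi-Frobenius elements is $\mathrm{QF}(S)=\{\mathbf{m}-\sum_{i=1}^d\mathbf{a}_i : \mathbf{m}\in\max_{\preceq_S}\mathrm{Ap}(S,E)\}$. When $R$ is Cohen-Macaulay, a finitely generated graded $R$-module $C$ is a canonical module of $R$ if there are homogeneous isomorphisms (up to a shift of degree) $\mathrm{Ext}^i_R(R/\mathfrak{m},C)\cong 0$ for $i\neq d$ and $\mathrm{Ext}^d_R(R/\mathfrak{m},C)\cong R/\mathfrak{m}$. *)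

theory Defs
  imports
    "HOL-Analysis.Analysis"
    "HOL-Library.Poly_Mapping"
    "HOL-Library.Extended_Nat"
    "HOL-Algebra.Ring_Divisibility"
    "HOL-Algebra.Module"
begin

section \<open>Simplicial affine semigroups\<close>

text \<open>All vectors live in \<open>int ^ 'd\<close>, the group \<open>\<int>\<^sup>d\<close> with \<open>d = CARD('d) \<ge> 1\<close>; this way differences
  such as the elements of \<open>group(S)\<close> and \<open>QF(S)\<close> are taken in \<open>\<int>\<^sup>d\<close> without truncation.\<close>

definition add_submonoid :: "'a::monoid_add set \<Rightarrow> bool" where
  "add_submonoid T \<longleftrightarrow> 0 \<in> T \<and> (\<forall>x\<in>T. \<forall>y\<in>T. x + y \<in> T)"

definition minimally_generated_by :: "'a::monoid_add set \<Rightarrow> 'a set \<Rightarrow> bool" where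
  "minimally_generated_by S A \<longleftrightarrow>
     add_submonoid hull A = S \<and> (\<forall>B. B \<subset> A \<longrightarrow> add_submonoid hull B \<noteq> S)"

definition rat_vec :: "int ^ 'd \<Rightarrow> rat ^ 'd" where
  "rat_vec v = (\<chi> i. of_int (v $ i))"

locale simplicial_affine_semigroup =
  fixes S :: "(int ^ 'd) set"
    and A :: "(int ^ 'd) set"
    and a :: "'d \<Rightarrow> int ^ 'd"
  assumes nonneg: "v \<in> S \<Longrightarrow> 0 \<le> v $ i"
    and finite_generators: "finite A"
    and generators: "minimally_generated_by S A"
    and rays_generators: "a i \<in> A"
    and rays_inj: "inj a"
    and rays_independent: "vec.independent (range (\<lambda>i. rat_vec (a i)))"
    and simplicial: "v \<in> S \<Longrightarrow> \<exists>q :: 'd \<Rightarrow> rat. (\<forall>i. 0 \<le> q i) \<and> rat_vec v = (\<Sum>i\<in>UNIV. q i *s rat_vec (a i))"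
    and rays_smallest: "b \<in> A \<Longrightarrow> b \<noteq> a i \<Longrightarrow> q \<noteq> 0 \<Longrightarrow> rat_vec b = q *s rat_vec (a i) \<Longrightarrow> q > 1"

definition semigroup_le :: "'a::ab_group_add set \<Rightarrow> 'a \<Rightarrow> 'a \<Rightarrow> bool" where
  "semigroup_le S b c \<longleftrightarrow> c - b \<in> S"

definition Apery :: "'a::ab_group_add set \<Rightarrow> 'a set \<Rightarrow> 'a set" where
  "Apery S E = {x \<in> S. \<forall>e\<in>E. x - e \<notin> S}"

definition maximal_elements :: "('a \<Rightarrow> 'a \<Rightarrow> bool) \<Rightarrow> 'a set \<Rightarrow> 'a set" where
  "maximal_elements leq X = {m \<in> X. \<forall>x\<in>X. leq m x \<longrightarrow> x = m}"

definition QF :: "(int ^ 'd) set \<Rightarrow> ('d \<Rightarrow> int ^ 'd) \<Rightarrow> (int ^ 'd) set" where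
  "QF S a = {m - (\<Sum>i\<in>UNIV. a i) | m. m \<in> maximal_elements (semigroup_le S) (Apery S (range a))}"

definition omega :: "(int ^ 'd) set \<Rightarrow> ('d \<Rightarrow> int ^ 'd) \<Rightarrow> (int ^ 'd) set" where
  "omega S a = {- f + s | f s. f \<in> QF S a \<and> s \<in> S}"


section \<open>Semigroup rings and fractional monomial ideals\<close>

text \<open>The type \<open>'g \<Rightarrow>\<^sub>0 'k\<close> with its convolution product is the group algebra of \<open>'g\<close> over \<open>'k\<close>, in
  which the monomial with exponent \<open>g\<close> is \<open>Poly_Mapping.single g 1\<close>.\<close>

definition monomial_span :: "'g set \<Rightarrow> ('g \<Rightarrow>\<^sub>0 'k::field) set" where
  "monomial_span H = {f. Poly_Mapping.keys f \<subseteq> H}"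

definition semigroup_ring :: "'g::ab_group_add set \<Rightarrow> ('g \<Rightarrow>\<^sub>0 'k::field) ring" where
  "semigroup_ring S =
     \<lparr>carrier = monomial_span S, mult = (*), one = 1, zero = 0, add = (+)\<rparr>"

text \<open>The ring operations of a module record carry no information and are left undefined
  here and below.\<close>

definition monomial_module :: "'g::ab_group_add set \<Rightarrow> ('g \<Rightarrow>\<^sub>0 'k::field, 'g \<Rightarrow>\<^sub>0 'k) module" where
  "monomial_module H =
     \<lparr>carrier = monomial_span H, mult = undefined, one = undefined, zero = 0, add = (+), smult = (*)\<rparr>"

definition monomial_grading :: "'g set \<Rightarrow> 'g \<Rightarrow> ('g \<Rightarrow>\<^sub>0 'k::field) set" where
  "monomial_grading H g = monomial_span (H \<inter> {g})"


section \<open>Cohen-Macaulay rings\<close>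

definition regular_sequence :: "('a, 'r) ring_scheme \<Rightarrow> 'a list \<Rightarrow> bool" where
  "regular_sequence R xs \<longleftrightarrow> set xs \<subseteq> carrier R \<and> genideal R (set xs) \<noteq> carrier R \<and>
     (\<forall>i<length xs. \<forall>r\<in>carrier R.
        xs ! i \<otimes>\<^bsub>R\<^esub> r \<in> genideal R (set (take i xs)) \<longrightarrow> r \<in> genideal R (set (take i xs)))"

definition ideal_depth :: "('a, 'r) ring_scheme \<Rightarrow> 'a set \<Rightarrow> enat" where
  "ideal_depth R I = Sup {enat (length xs) | xs. set xs \<subseteq> I \<and> regular_sequence R xs}"

definition prime_height :: "('a, 'r) ring_scheme \<Rightarrow> 'a set \<Rightarrow> enat" where
  "prime_height R P = Sup {enat n | n. \<exists>Q :: nat \<Rightarrow> 'a set.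
     (\<forall>i\<le>n. primeideal (Q i) R) \<and> (\<forall>i<n. Q i \<subset> Q (Suc i)) \<and> Q n = P}"

text \<open>Cohen-Macaulayness of a not necessarily local ring, as in Eisenbud's \<open>Commutative Algebra\<close>,
  Section 18.2: depth equals codimension at every maximal ideal.\<close>

definition Cohen_Macaulay :: "('a, 'r) ring_scheme \<Rightarrow> bool" where
  "Cohen_Macaulay R \<longleftrightarrow> cring R \<and> noetherian_ring R \<and>
     (\<forall>P. maximalideal P R \<longrightarrow> ideal_depth R P = prime_height R P)"


section \<open>Graded modules\<close>

text \<open>A grading of a module by the group \<open>'g\<close> is given by the family of its homogeneous components.\<close>

definition graded_module ::
  "('a, 'r) ring_scheme \<Rightarrow> ('g::ab_group_add \<Rightarrow> 'a set) \<Rightarrow> ('a, 'b, 'm) module_scheme \<Rightarrow> ('g \<Rightarrow> 'b set) \<Rightarrow> bool" where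
  "graded_module R gR M gM \<longleftrightarrow> Module.module R M \<and>
     (\<forall>g. subgroup (gM g) (add_monoid M)) \<and>
     (\<forall>x\<in>carrier M. \<exists>!c. (\<forall>g. c g \<in> gM g) \<and> finite {g. c g \<noteq> \<zero>\<^bsub>M\<^esub>} \<and>
        x = finsum M c {g. c g \<noteq> \<zero>\<^bsub>M\<^esub>}) \<and>
     (\<forall>g h. \<forall>r\<in>gR g. \<forall>x\<in>gM h. r \<odot>\<^bsub>M\<^esub> x \<in> gM (g + h))"

definition finitely_generated_module :: "('a, 'r) ring_scheme \<Rightarrow> ('a, 'b, 'm) module_scheme \<Rightarrow> bool" where
  "finitely_generated_module R M \<longleftrightarrow>
     (\<exists>A \<subseteq> carrier M. finite A \<and> (\<lambda>N. submodule N R M) hull A = carrier M)"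

definition module_hom ::
  "('a, 'r) ring_scheme \<Rightarrow> ('a, 'b, 'm) module_scheme \<Rightarrow> ('a, 'c, 'n) module_scheme \<Rightarrow> ('b \<Rightarrow> 'c) set" where
  "module_hom R M N = {\<phi> \<in> carrier M \<rightarrow> carrier N.
     (\<forall>x\<in>carrier M. \<forall>y\<in>carrier M. \<phi> (x \<oplus>\<^bsub>M\<^esub> y) = \<phi> x \<oplus>\<^bsub>N\<^esub> \<phi> y) \<and>
     (\<forall>r\<in>carrier R. \<forall>x\<in>carrier M. \<phi> (r \<odot>\<^bsub>M\<^esub> x) = r \<odot>\<^bsub>N\<^esub> \<phi> x)}"

definition homogeneous_of_degree ::
  "'g::ab_group_add \<Rightarrow> ('g \<Rightarrow> 'b set) \<Rightarrow> ('g \<Rightarrow> 'c set) \<Rightarrow> ('b \<Rightarrow> 'c) \<Rightarrow> bool" where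
  "homogeneous_of_degree s gM gN \<phi> \<longleftrightarrow> (\<forall>g. \<phi> ` gM g \<subseteq> gN (g + s))"

definition graded_iso_upto_shift ::
  "('a, 'r) ring_scheme \<Rightarrow> ('a, 'b, 'm) module_scheme \<Rightarrow> ('g::ab_group_add \<Rightarrow> 'b set) \<Rightarrow>
   ('a, 'c, 'n) module_scheme \<Rightarrow> ('g \<Rightarrow> 'c set) \<Rightarrow> bool" where
  "graded_iso_upto_shift R M gM N gN \<longleftrightarrow>
     (\<exists>s. \<exists>\<phi> \<in> module_hom R M N. bij_betw \<phi> (carrier M) (carrier N) \<and> (\<forall>g. \<phi> ` gM g = gN (g + s)))"

definition quot_module ::
  "('a, 'b, 'm) module_scheme \<Rightarrow> 'b set \<Rightarrow> ('a, 'b set) module" where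
  "quot_module M N =
     \<lparr>carrier = a_rcosets\<^bsub>M\<^esub> N, mult = undefined, one = undefined, zero = N, add = set_add M,
      smult = (\<lambda>r X. \<Union>x\<in>X. N +>\<^bsub>M\<^esub> (r \<odot>\<^bsub>M\<^esub> x))\<rparr>"

definition quot_grading ::
  "('a, 'b, 'm) module_scheme \<Rightarrow> 'b set \<Rightarrow> ('g \<Rightarrow> 'b set) \<Rightarrow> 'g \<Rightarrow> 'b set set" where
  "quot_grading M N gM g = (\<lambda>x. N +>\<^bsub>M\<^esub> x) ` gM g"

text \<open>\<open>free_module R n\<close> is \<open>R\<^sup>n\<close>, a vector being a function that vanishes from index \<open>n\<close> on. With the
  shifts \<open>s\<close> it becomes the graded module \<open>R(-s 0) \<oplus> \<dots> \<oplus> R(-s (n - 1))\<close>, whose \<open>j\<close>-th basis vector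
  has degree \<open>s j\<close>.\<close>

definition free_module :: "('a, 'r) ring_scheme \<Rightarrow> nat \<Rightarrow> ('a, nat \<Rightarrow> 'a) module" where
  "free_module R n =
     \<lparr>carrier = {v. (\<forall>j<n. v j \<in> carrier R) \<and> (\<forall>j\<ge>n. v j = \<zero>\<^bsub>R\<^esub>)},
      mult = undefined, one = undefined, zero = (\<lambda>j. \<zero>\<^bsub>R\<^esub>),
      add = (\<lambda>v w j. if j < n then v j \<oplus>\<^bsub>R\<^esub> w j else \<zero>\<^bsub>R\<^esub>),
      smult = (\<lambda>r v j. if j < n then r \<otimes>\<^bsub>R\<^esub> v j else \<zero>\<^bsub>R\<^esub>)\<rparr>"

definition free_grading ::
  "('a, 'r) ring_scheme \<Rightarrow> ('g::ab_group_add \<Rightarrow> 'a set) \<Rightarrow> nat \<Rightarrow> (nat \<Rightarrow> 'g) \<Rightarrow> 'g \<Rightarrow> (nat \<Rightarrow> 'a) set" where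
  "free_grading R gR n s g = {v \<in> carrier (free_module R n). \<forall>j<n. v j \<in> gR (g - s j)}"

definition hom_module ::
  "('a, 'r) ring_scheme \<Rightarrow> ('a, 'b, 'm) module_scheme \<Rightarrow> ('a, 'c, 'n) module_scheme \<Rightarrow> ('a, 'b \<Rightarrow> 'c) module" where
  "hom_module R M N =
     \<lparr>carrier = module_hom R M N \<inter> extensional (carrier M),
      mult = undefined, one = undefined, zero = (\<lambda>x\<in>carrier M. \<zero>\<^bsub>N\<^esub>),
      add = (\<lambda>\<phi> \<psi>. \<lambda>x\<in>carrier M. \<phi> x \<oplus>\<^bsub>N\<^esub> \<psi> x),
      smult = (\<lambda>r \<phi>. \<lambda>x\<in>carrier M. r \<odot>\<^bsub>N\<^esub> \<phi> x)\<rparr>"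


section \<open>Ext and canonical modules\<close>

text \<open>A graded free resolution \<open>\<dots> \<rightarrow> F\<^sub>1 \<rightarrow> F\<^sub>0 \<rightarrow> M \<rightarrow> 0\<close> by modules \<open>F\<^sub>i\<close> of finite rank;
  \<open>res_diff F i\<close> is the differential from \<open>F\<^bsub>i+1\<^esub>\<close> to \<open>F\<^sub>i\<close>. Over a graded Noetherian ring every
  finitely generated graded module has one.\<close>

record ('a, 'b, 'g) graded_resolution =
  res_rank :: "nat \<Rightarrow> nat"
  res_shift :: "nat \<Rightarrow> nat \<Rightarrow> 'g"
  res_diff :: "nat \<Rightarrow> (nat \<Rightarrow> 'a) \<Rightarrow> (nat \<Rightarrow> 'a)"
  res_aug :: "(nat \<Rightarrow> 'a) \<Rightarrow> 'b"

abbreviation res_module ::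
  "('a, 'r) ring_scheme \<Rightarrow> ('a, 'b, 'g, 'f) graded_resolution_scheme \<Rightarrow> nat \<Rightarrow> ('a, nat \<Rightarrow> 'a) module" where
  "res_module R F i \<equiv> free_module R (res_rank F i)"

abbreviation res_grading ::
  "('a, 'r) ring_scheme \<Rightarrow> ('g::ab_group_add \<Rightarrow> 'a set) \<Rightarrow> ('a, 'b, 'g, 'f) graded_resolution_scheme \<Rightarrow>
   nat \<Rightarrow> 'g \<Rightarrow> (nat \<Rightarrow> 'a) set" where
  "res_grading R gR F i \<equiv> free_grading R gR (res_rank F i) (res_shift F i)"

definition graded_free_resolution ::
  "('a, 'r) ring_scheme \<Rightarrow> ('g::ab_group_add \<Rightarrow> 'a set) \<Rightarrow> ('a, 'b, 'm) module_scheme \<Rightarrow> ('g \<Rightarrow> 'b set) \<Rightarrow>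
   ('a, 'b, 'g) graded_resolution \<Rightarrow> bool" where
  "graded_free_resolution R gR M gM F \<longleftrightarrow>
     res_aug F \<in> module_hom R (res_module R F 0) M \<and>
     homogeneous_of_degree 0 (res_grading R gR F 0) gM (res_aug F) \<and>
     (\<forall>i. res_diff F i \<in> module_hom R (res_module R F (Suc i)) (res_module R F i) \<and>
          homogeneous_of_degree 0 (res_grading R gR F (Suc i)) (res_grading R gR F i) (res_diff F i)) \<and>
     res_aug F ` carrier (res_module R F 0) = carrier M \<and>
     res_diff F 0 ` carrier (res_module R F 1) =
       {v \<in> carrier (res_module R F 0). res_aug F v = \<zero>\<^bsub>M\<^esub>} \<and>
     (\<forall>i. res_diff F (Suc i) ` carrier (res_module R F (Suc (Suc i))) =
       {v \<in> carrier (res_module R F (Suc i)). res_diff F i v = \<zero>\<^bsub>res_module R F i\<^esub>})"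

text \<open>The cochain complex \<open>Hom\<^sub>R(F, C)\<close>. As the \<open>F\<^sub>i\<close> have finite rank, \<open>Hom\<^sub>R(F\<^sub>i, C)\<close> is the direct sum
  of its homogeneous components, that of degree \<open>s\<close> being the homomorphisms which raise degrees by \<open>s\<close>.\<close>

definition cochains ::
  "('a, 'r) ring_scheme \<Rightarrow> ('a, 'b, 'g, 'f) graded_resolution_scheme \<Rightarrow> ('a, 'c, 'n) module_scheme \<Rightarrow>
   nat \<Rightarrow> ('a, (nat \<Rightarrow> 'a) \<Rightarrow> 'c) module" where
  "cochains R F C i = hom_module R (res_module R F i) C"

definition codiff ::
  "('a, 'r) ring_scheme \<Rightarrow> ('a, 'b, 'g, 'f) graded_resolution_scheme \<Rightarrow>
   nat \<Rightarrow> ((nat \<Rightarrow> 'a) \<Rightarrow> 'c) \<Rightarrow> (nat \<Rightarrow> 'a) \<Rightarrow> 'c" where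
  "codiff R F i \<phi> = (\<lambda>v\<in>carrier (res_module R F (Suc i)). \<phi> (res_diff F i v))"

definition cocycles ::
  "('a, 'r) ring_scheme \<Rightarrow> ('a, 'b, 'g, 'f) graded_resolution_scheme \<Rightarrow> ('a, 'c, 'n) module_scheme \<Rightarrow>
   nat \<Rightarrow> ((nat \<Rightarrow> 'a) \<Rightarrow> 'c) set" where
  "cocycles R F C i =
     {\<phi> \<in> carrier (cochains R F C i). codiff R F i \<phi> = \<zero>\<^bsub>cochains R F C (Suc i)\<^esub>}"

definition coboundaries ::
  "('a, 'r) ring_scheme \<Rightarrow> ('a, 'b, 'g, 'f) graded_resolution_scheme \<Rightarrow> ('a, 'c, 'n) module_scheme \<Rightarrow>
   nat \<Rightarrow> ((nat \<Rightarrow> 'a) \<Rightarrow> 'c) set" where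
  "coboundaries R F C i = (case i of
       0 \<Rightarrow> {\<zero>\<^bsub>cochains R F C 0\<^esub>}
     | Suc j \<Rightarrow> codiff R F j ` carrier (cochains R F C j))"

definition cocycle_grading ::
  "('a, 'r) ring_scheme \<Rightarrow> ('g::ab_group_add \<Rightarrow> 'a set) \<Rightarrow> ('a, 'b, 'g, 'f) graded_resolution_scheme \<Rightarrow>
   ('a, 'c, 'n) module_scheme \<Rightarrow> ('g \<Rightarrow> 'c set) \<Rightarrow> nat \<Rightarrow> 'g \<Rightarrow> ((nat \<Rightarrow> 'a) \<Rightarrow> 'c) set" where
  "cocycle_grading R gR F C gC i s =
     {\<phi> \<in> cocycles R F C i. homogeneous_of_degree s (res_grading R gR F i) gC \<phi>}"

definition cocycle_module ::
  "('a, 'r) ring_scheme \<Rightarrow> ('a, 'b, 'g, 'f) graded_resolution_scheme \<Rightarrow> ('a, 'c, 'n) module_scheme \<Rightarrow>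
   nat \<Rightarrow> ('a, (nat \<Rightarrow> 'a) \<Rightarrow> 'c) module" where
  "cocycle_module R F C i = (cochains R F C i)\<lparr>carrier := cocycles R F C i\<rparr>"

text \<open>\<open>Ext\<close> is computed from a resolution picked once and for all; up to homogeneous isomorphism of
  degree \<open>0\<close> the result does not depend on it.\<close>

definition chosen_resolution ::
  "('a, 'r) ring_scheme \<Rightarrow> ('g::ab_group_add \<Rightarrow> 'a set) \<Rightarrow> ('a, 'b, 'm) module_scheme \<Rightarrow> ('g \<Rightarrow> 'b set) \<Rightarrow>
   ('a, 'b, 'g) graded_resolution" where
  "chosen_resolution R gR M gM = (SOME F. graded_free_resolution R gR M gM F)"

definition Ext_module ::
  "('a, 'r) ring_scheme \<Rightarrow> ('g::ab_group_add \<Rightarrow> 'a set) \<Rightarrow> nat \<Rightarrow> ('a, 'b, 'm) module_scheme \<Rightarrow> ('g \<Rightarrow> 'b set) \<Rightarrow>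
   ('a, 'c, 'n) module_scheme \<Rightarrow> ('a, ((nat \<Rightarrow> 'a) \<Rightarrow> 'c) set) module" where
  "Ext_module R gR i M gM C = (let F = chosen_resolution R gR M gM in
     quot_module (cocycle_module R F C i) (coboundaries R F C i))"

definition Ext_grading ::
  "('a, 'r) ring_scheme \<Rightarrow> ('g::ab_group_add \<Rightarrow> 'a set) \<Rightarrow> nat \<Rightarrow> ('a, 'b, 'm) module_scheme \<Rightarrow> ('g \<Rightarrow> 'b set) \<Rightarrow>
   ('a, 'c, 'n) module_scheme \<Rightarrow> ('g \<Rightarrow> 'c set) \<Rightarrow> 'g \<Rightarrow> ((nat \<Rightarrow> 'a) \<Rightarrow> 'c) set set" where
  "Ext_grading R gR i M gM C gC = (let F = chosen_resolution R gR M gM in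
     quot_grading (cocycle_module R F C i) (coboundaries R F C i) (cocycle_grading R gR F C gC i))"

definition self_module :: "('a, 'r) ring_scheme \<Rightarrow> ('a, 'a) module" where
  "self_module R =
     \<lparr>carrier = carrier R, mult = undefined, one = undefined, zero = \<zero>\<^bsub>R\<^esub>, add = add R, smult = mult R\<rparr>"

text \<open>\<open>R\<close> is graded by \<open>gR\<close>, with distinguished graded maximal ideal \<open>m\<close> and dimension \<open>d\<close>.\<close>

definition canonical_module ::
  "('a, 'r) ring_scheme \<Rightarrow> ('g::ab_group_add \<Rightarrow> 'a set) \<Rightarrow> 'a set \<Rightarrow> nat \<Rightarrow>
   ('a, 'c, 'n) module_scheme \<Rightarrow> ('g \<Rightarrow> 'c set) \<Rightarrow> bool" where
  "canonical_module R gR m d C gC \<longleftrightarrow>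
     graded_module R gR C gC \<and> finitely_generated_module R C \<and>
     (let k = quot_module (self_module R) m; gk = quot_grading (self_module R) m gR in
        (\<forall>i. i \<noteq> d \<longrightarrow> carrier (Ext_module R gR i k gk C) = {\<zero>\<^bsub>Ext_module R gR i k gk C\<^esub>}) \<and>
        graded_iso_upto_shift R (Ext_module R gR d k gk C) (Ext_grading R gR d k gk C gC) k gk)"

end

theory Submission
  imports Defs
begin

text \<open>
Put \<open>S\<^sub>i = {u | u + N \<Sum>\<^bsub>j\<noteq>i\<^esub> a\<^sub>j \<in> S for some N}\<close>. The primes of the faces of the cone show that
the monomial maximal ideal has height at least \<open>d\<close>, so it contains a regular sequence of length \<open>d\<close>. This
sequence forces the Koszul cohomology of \<open>R\<close> on powers of the monomials of degrees \<open>a\<^sub>i\<close> to vanish below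
degree \<open>d\<close>, whose homogeneous components give \<open>S = \<Inter>\<^sub>i S\<^sub>i\<close>. It follows that \<open>\<omega>\<^sub>S\<close> consists of the
\<open>z \<in> group(S)\<close> with \<open>-z \<notin> S\<^sub>i\<close> for all \<open>i\<close>.

A graded free resolution \<open>F\<close> of the residue field is a sequence of scalar matrices, and the degree \<open>-u\<close> part of
\<open>Hom(F, K[-T])\<close> keeps the rows and columns whose shift \<open>s\<close> satisfies \<open>u - s \<in> T\<close>. For \<open>T = S\<close> this is the dual
of the degree \<open>u\<close> part of \<open>F\<close>, with cohomology only in degrees \<open>(u, i) = (0, 0)\<close>. Let \<open>T\<^sub>X\<close> be the set of
\<open>u \<in> group(S)\<close> lying outside exactly the \<open>S\<^sub>i\<close> with \<open>i \<in> X\<close>. Replacing \<open>T\<^sub>X\<close> by \<open>T\<^bsub>X \<union> {k}\<^esub>\<close> raises the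
cohomological degree by one: the union \<open>U\<close> of both is invariant under \<open>a\<^sub>k\<close> and agrees with \<open>T\<^sub>X\<close> far out in
that direction, so its complex is exact. After \<open>d\<close> steps \<open>-T\<close> is \<open>\<omega>\<^sub>S\<close>.
\<close>

section \<open>Complexes of scalar matrices\<close>

text \<open>In module terms, \<open>U\<close> holds the exponents of the localization of
  \<open>K[T_X]\<close> at the monomial of degree \<open>a_k\<close>, and
  \<open>K[T_X] -> K[U] -> K[T_{X \<union> {k}}]\<close> is short exact. So the sets
  \<open>T_X\<close> carry local cohomology of \<open>R\<close>, and passing from \<open>T\<close>
  to \<open>-T\<close> is graded duality. The monomial acts invertibly on \<open>K[U]\<close> but
  kills the residue field; this is why the middle term contributes nothing. The obstacle in the
  first half is that depth supplies a regular sequence of arbitrary, possibly inhomogeneous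
  elements, while \<open>S = \<Inter> S_i\<close> is a statement about single degrees. The Koszul
  complex mediates: formed on monomials it splits into degrees, and all it has to know about the
  sequence is that each member has a power in the ideal of these monomials. Powers of the ray
  monomials are taken because \<open>S_i\<close> allows arbitrarily large multiples of the rays,
  whereas one degree of the complex sees only fixed ones. Ext is defined by a resolution picked by
  choice. Hence the matrices have to be extracted from an arbitrary graded free resolution, and the
  existence of one has to be proved.\<close>

lemma functional_factors:
  fixes B :: "'l \<Rightarrow> 'j \<Rightarrow> 'k::field" and c :: "'j \<Rightarrow> 'k"
  assumes "finite L" and "finite J"
    and "\<And>v. (\<forall>l\<in>L. (\<Sum>j\<in>J. B l j * v j) = 0) \<Longrightarrow> (\<Sum>j\<in>J. c j * v j) = 0"
  shows "\<exists>b. \<forall>j\<in>J. c j = (\<Sum>l\<in>L. b l * B l j)"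
  using assms(1,3)
proof (induction L arbitrary: c rule: finite_induct)
  case empty
  have "c j = 0" if "j \<in> J" for j
    using empty[of "\<lambda>i. if i = j then 1 else 0"] that \<open>finite J\<close> by (simp add: if_distrib cong: if_cong)
  then show ?case by simp
next
  case (insert l0 L)
  show ?case
  \<comment> \<open>Does the functional of \<open>l0\<close> already vanish on the common kernel of
    \<open>L\<close>? If so, it is redundant and receives the coefficient 0; if not, some
    \<open>v0\<close> in that kernel detects it.\<close>
  proof (cases "\<forall>v. (\<forall>l\<in>L. (\<Sum>j\<in>J. B l j * v j) = 0) \<longrightarrow> (\<Sum>j\<in>J. B l0 j * v j) = 0")
    case True
    then have "\<And>v. (\<forall>l\<in>L. (\<Sum>j\<in>J. B l j * v j) = 0) \<Longrightarrow> (\<Sum>j\<in>J. c j * v j) = 0"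
      using insert.prems by simp
    from insert.IH[OF this] obtain b where b: "\<forall>j\<in>J. c j = (\<Sum>l\<in>L. b l * B l j)" by blast
    have "\<forall>j\<in>J. c j = (\<Sum>l\<in>insert l0 L. (b(l0 := 0)) l * B l j)"
      using b insert.hyps by (auto intro!: sum.cong)
    then show ?thesis by blast
  next
    case False
    then obtain v0 where v0: "\<forall>l\<in>L. (\<Sum>j\<in>J. B l j * v0 j) = 0" and nz: "(\<Sum>j\<in>J. B l0 j * v0 j) \<noteq> 0"
      by blast
    \<comment> \<open>\<open>q\<close> makes \<open>c - q * B l0\<close> kill \<open>v0\<close>. For
      \<open>v\<close> in the common kernel of \<open>L\<close>, the vector
      \<open>v - t * v0\<close> is killed by \<open>B l0\<close> too, so the corrected functional
      vanishes on that whole kernel and the induction hypothesis applies.\<close>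
    define q where "q = (\<Sum>j\<in>J. c j * v0 j) / (\<Sum>j\<in>J. B l0 j * v0 j)"
    define c' where "c' j = c j - q * B l0 j" for j
    have "(\<Sum>j\<in>J. c' j * v j) = 0" if v: "\<forall>l\<in>L. (\<Sum>j\<in>J. B l j * v j) = 0" for v
    proof -
      define t where "t = (\<Sum>j\<in>J. B l0 j * v j) / (\<Sum>j\<in>J. B l0 j * v0 j)"
      have "(\<Sum>j\<in>J. B l j * (v j - t * v0 j)) = (\<Sum>j\<in>J. B l j * v j) - t * (\<Sum>j\<in>J. B l j * v0 j)" for l
        by (simp add: algebra_simps sum_subtractf sum_distrib_left)
      then have "\<forall>l\<in>insert l0 L. (\<Sum>j\<in>J. B l j * (v j - t * v0 j)) = 0"
        using v v0 nz by (simp add: t_def)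
      from insert.prems[OF this] have "(\<Sum>j\<in>J. c j * v j) = t * (\<Sum>j\<in>J. c j * v0 j)"
        by (simp add: algebra_simps sum_subtractf sum_distrib_left)
      moreover have "(\<Sum>j\<in>J. c' j * v j) = (\<Sum>j\<in>J. c j * v j) - q * (\<Sum>j\<in>J. B l0 j * v j)"
        by (simp add: c'_def algebra_simps sum_subtractf sum_distrib_left)
      ultimately show ?thesis by (simp add: q_def t_def)
    qed
    from insert.IH[OF this] obtain b where b: "\<forall>j\<in>J. c' j = (\<Sum>l\<in>L. b l * B l j)" by blast
    have "\<forall>j\<in>J. c j = (\<Sum>l\<in>insert l0 L. (b(l0 := q)) l * B l j)"
    proof
      fix j assume "j \<in> J"
      have "(\<Sum>l\<in>L. (b(l0 := q)) l * B l j) = (\<Sum>l\<in>L. b l * B l j)"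
        using insert.hyps by (auto intro!: sum.cong)
      then show "c j = (\<Sum>l\<in>insert l0 L. (b(l0 := q)) l * B l j)"
        using b \<open>j \<in> J\<close> insert.hyps by (simp add: c'_def algebra_simps)
    qed
    then show ?thesis by blast
  qed
qed

text \<open>\<open>D i\<close> describes a differential \<open>F\<^bsub>i+1\<^esub> \<rightarrow> F\<^sub>i\<close> of free modules with ranks \<open>n\<close> and shifts \<open>s\<close>, the entry at
  \<open>(l, j)\<close> being \<open>D i l j\<close> times the monomial of degree \<open>s (i + 1) j - s i l\<close>.\<close>

locale graded_matrices =
  fixes S :: "'g::ab_group_add set" and n :: "nat \<Rightarrow> nat" and s :: "nat \<Rightarrow> nat \<Rightarrow> 'g"
    and D :: "nat \<Rightarrow> nat \<Rightarrow> nat \<Rightarrow> 'k::field"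
  assumes entry_degree: "D i l j \<noteq> 0 \<Longrightarrow> l < n i \<Longrightarrow> j < n (Suc i) \<Longrightarrow> s (Suc i) j - s i l \<in> S"
    and product_zero: "l < n i \<Longrightarrow> j < n (Suc (Suc i)) \<Longrightarrow> (\<Sum>p<n (Suc i). D i l p * D (Suc i) p j) = 0"
begin

text \<open>For \<open>T = S\<close> these index a basis of the degree \<open>u\<close> part of the
  free module; for general \<open>T\<close>, of the free module tensored with the monomials of
  degrees in \<open>T\<close>.\<close>

definition supp :: "'g set \<Rightarrow> 'g \<Rightarrow> nat \<Rightarrow> nat set" where
  "supp T u i = {j. j < n i \<and> u - s i j \<in> T}"

definition cochain :: "'g set \<Rightarrow> 'g \<Rightarrow> nat \<Rightarrow> (nat \<Rightarrow> 'k) set" where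
  "cochain T u i = {c. \<forall>j. c j \<noteq> 0 \<longrightarrow> j \<in> supp T u i}"

text \<open>The transpose of \<open>D i\<close>, cut off to the positions allowed by
  \<open>T\<close>. It can be formed for every \<open>T\<close>, but its square vanishes only under
  a convexity condition, see \<open>cod_cod\<close>.\<close>

definition cod :: "'g set \<Rightarrow> 'g \<Rightarrow> nat \<Rightarrow> (nat \<Rightarrow> 'k) \<Rightarrow> nat \<Rightarrow> 'k" where
  "cod T u i c = (\<lambda>j. if j \<in> supp T u (Suc i) then \<Sum>l<n i. c l * D i l j else 0)"

definition cocycle :: "'g set \<Rightarrow> 'g \<Rightarrow> nat \<Rightarrow> (nat \<Rightarrow> 'k) set" where
  "cocycle T u i = {c \<in> cochain T u i. cod T u i c = (\<lambda>_. 0)}"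

definition boundary :: "'g set \<Rightarrow> 'g \<Rightarrow> nat \<Rightarrow> (nat \<Rightarrow> 'k) set" where
  "boundary T u i = (case i of 0 \<Rightarrow> {\<lambda>_. 0} | Suc k \<Rightarrow> cod T u k ` cochain T u k)"

definition exact_at :: "'g set \<Rightarrow> 'g \<Rightarrow> nat \<Rightarrow> bool" where
  "exact_at T u i \<longleftrightarrow> cocycle T u i \<subseteq> boundary T u i"

text \<open>Phrased by a spanning class instead of a dimension, because the coefficient
  \<open>q\<close> later provides the isomorphism of Ext with the residue field.\<close>

definition one_dim :: "'g set \<Rightarrow> 'g \<Rightarrow> nat \<Rightarrow> bool" where
  "one_dim T u i \<longleftrightarrow> (\<exists>h\<in>cocycle T u i. h \<notin> boundary T u i \<and>
     (\<forall>c\<in>cocycle T u i. \<exists>q. (\<lambda>j. c j - q * h j) \<in> boundary T u i))"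

definition concentrated :: "'g set \<Rightarrow> nat \<Rightarrow> bool" where
  "concentrated T k \<longleftrightarrow> (\<forall>u i. (u, i) \<noteq> (0, k) \<longrightarrow> exact_at T u i) \<and> one_dim T 0 k"

definition restr :: "'g set \<Rightarrow> 'g \<Rightarrow> nat \<Rightarrow> (nat \<Rightarrow> 'k) \<Rightarrow> nat \<Rightarrow> 'k" where
  "restr T u i c = (\<lambda>j. if j \<in> supp T u i then c j else 0)"

lemma boundary_0 [simp]: "boundary T u 0 = {\<lambda>_. 0}"
  and boundary_Suc [simp]: "boundary T u (Suc k) = cod T u k ` cochain T u k"
  by (simp_all add: boundary_def)

lemma cod_diff: "cod T u i (\<lambda>j. c j - q * e j) = (\<lambda>j. cod T u i c j - q * cod T u i e j)"
  by (rule ext) (simp add: cod_def sum_subtractf algebra_simps sum_distrib_left)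

lemma cochain_diff: "c \<in> cochain T u i \<Longrightarrow> e \<in> cochain T u i \<Longrightarrow> (\<lambda>j. c j - q * e j) \<in> cochain T u i"
  unfolding cochain_def by auto (metis mult_zero_right)

lemma cod_cochain: "cod T u i c \<in> cochain T u (Suc i)"
  by (auto simp: cod_def cochain_def)

lemma cochain_mono: "T \<subseteq> T' \<Longrightarrow> cochain T u i \<subseteq> cochain T' u i"
  by (auto simp: cochain_def supp_def)

lemma restr_cochain: "restr T u i c \<in> cochain T u i"
  by (auto simp: cochain_def restr_def)

lemma restr_idem: "c \<in> cochain T u i \<Longrightarrow> restr T u i c = c"
  by (rule ext) (auto simp: cochain_def restr_def)

lemma exact_at_cong:
  assumes "supp T u i = supp T' u' i" "supp T u (Suc i) = supp T' u' (Suc i)"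
    and "\<And>k. i = Suc k \<Longrightarrow> supp T u k = supp T' u' k"
  shows "exact_at T u i = exact_at T' u' i"
proof -
  have "cocycle T u i = cocycle T' u' i"
    using assms(1,2) by (simp add: cocycle_def cochain_def cod_def)
  moreover have "boundary T u i = boundary T' u' i"
    using assms(1,3) by (cases i) (simp_all add: cochain_def cod_def)
  ultimately show ?thesis by (simp add: exact_at_def)
qed

text \<open>A nonzero product of two entries is a path that descends by two elements of
  \<open>S\<close>. Both ends lie in \<open>U\<close>, so by convexity the intermediate position
  does too; the cut therefore loses no term of the matrix product, which is zero.\<close>

lemma cod_cod:
  assumes convex: "\<And>t x y. t \<in> U \<Longrightarrow> x \<in> S \<Longrightarrow> y \<in> S \<Longrightarrow> t - x - y \<in> U \<Longrightarrow> t - x \<in> U"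
    and c: "c \<in> cochain U u i"
  shows "cod U u (Suc i) (cod U u i c) = (\<lambda>_. 0)"
proof (rule ext)
  fix j
  show "cod U u (Suc i) (cod U u i c) j = 0"
  proof (cases "j \<in> supp U u (Suc (Suc i))")
    case True
    then have j: "j < n (Suc (Suc i))" "u - s (Suc (Suc i)) j \<in> U" by (auto simp: supp_def)
    have *: "cod U u i c p * D (Suc i) p j = (\<Sum>l<n i. c l * (D i l p * D (Suc i) p j))"
      if p: "p < n (Suc i)" for p
    proof (cases "p \<in> supp U u (Suc i)")
      case True
      then show ?thesis by (simp add: cod_def sum_distrib_right mult.assoc)
    next
      case False
      have "c l * (D i l p * D (Suc i) p j) = 0" if l: "l < n i" for l
      proof (rule ccontr)
        assume nz: "c l * (D i l p * D (Suc i) p j) \<noteq> 0"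
        then have "u - s i l \<in> U" using c by (auto simp: cochain_def supp_def)
        moreover have "s (Suc i) p - s i l \<in> S" "s (Suc (Suc i)) j - s (Suc i) p \<in> S"
          using nz entry_degree l p j by auto
        moreover have "u - s i l - (s (Suc i) p - s i l) - (s (Suc (Suc i)) j - s (Suc i) p) \<in> U"
          using j by (simp add: algebra_simps)
        ultimately have "u - s i l - (s (Suc i) p - s i l) \<in> U" using convex by blast
        then show False using False p by (simp add: supp_def)
      qed
      then show ?thesis using False by (simp add: cod_def sum.neutral del: mult_eq_0_iff)
    qed
    have "(\<Sum>p<n (Suc i). cod U u i c p * D (Suc i) p j)
        = (\<Sum>p<n (Suc i). \<Sum>l<n i. c l * (D i l p * D (Suc i) p j))"
      using * by (intro sum.cong) auto
    also have "\<dots> = (\<Sum>l<n i. c l * (\<Sum>p<n (Suc i). D i l p * D (Suc i) p j))"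
      by (subst sum.swap) (simp add: sum_distrib_left)
    also have "\<dots> = 0" using j product_zero by simp
    finally show ?thesis by (simp add: cod_def)
  qed (simp add: cod_def)
qed

text \<open>The long exact sequence of \<open>Td\<close>, \<open>U\<close> and \<open>Tu\<close>: by
  \<open>down\<close> the cochains of \<open>Td\<close> form a subcomplex of those of
  \<open>U\<close>, with quotient map \<open>restr Tu\<close>. As the middle complex is exact, the
  connecting map, which applies \<open>cod U\<close> to a lift, is an isomorphism that raises the
  cohomological degree by one.\<close>

lemma concentrated_Suc:
  assumes U: "U = Tu \<union> Td" and disj: "Tu \<inter> Td = {}"
    and down: "\<And>t x. t \<in> Td \<Longrightarrow> x \<in> S \<Longrightarrow> t - x \<in> U \<Longrightarrow> t - x \<in> Td"
    and convex: "\<And>t x y. t \<in> U \<Longrightarrow> x \<in> S \<Longrightarrow> y \<in> S \<Longrightarrow> t - x - y \<in> U \<Longrightarrow> t - x \<in> U"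
    and exact: "\<And>u i. exact_at U u i"
    and conc: "concentrated Tu k"
  shows "concentrated Td (Suc k)"
proof -
  have down': "j \<in> supp Td u (Suc i)"
    if "j \<in> supp U u (Suc i)" "l \<in> supp Td u i" "D i l j \<noteq> 0" for u i l j
  proof -
    have *: "l < n i" "u - s i l \<in> Td" "j < n (Suc i)" "u - s (Suc i) j \<in> U"
      using that by (auto simp: supp_def)
    have "s (Suc i) j - s i l \<in> S" using entry_degree that * by blast
    then have "u - s i l - (s (Suc i) j - s i l) \<in> Td" using * down[of "u - s i l" "s (Suc i) j - s i l"] by simp
    then show ?thesis using * by (simp add: supp_def)
  qed
  have supp_U: "supp U u i = supp Tu u i \<union> supp Td u i" "supp Tu u i \<inter> supp Td u i = {}" for u i
    using U disj by (auto simp: supp_def)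
  have sub: "cochain Tu u i \<subseteq> cochain U u i" "cochain Td u i \<subseteq> cochain U u i" for u i
    using U by (auto intro!: cochain_mono)
  have cod_down: "cod U u i c = cod Td u i c" if c: "c \<in> cochain Td u i" for u i c
  proof (rule ext)
    fix j
    have "(\<Sum>l<n i. c l * D i l j) = 0" if "j \<in> supp U u (Suc i)" "j \<notin> supp Td u (Suc i)"
    proof (rule sum.neutral, rule ballI, rule ccontr)
      fix l assume "c l * D i l j \<noteq> 0"
      then show False using that c down' by (auto simp: cochain_def)
    qed
    then show "cod U u i c j = cod Td u i c j" using supp_U(1) by (auto simp: cod_def)
  qed
  have restr_cod: "restr Tu u (Suc i) (cod U u i b) = cod Tu u i (restr Tu u i b)"
    if b: "b \<in> cochain U u i" for u i b
  proof (rule ext)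
    fix j
    have "(\<Sum>l<n i. b l * D i l j) = (\<Sum>l<n i. restr Tu u i b l * D i l j)" if j: "j \<in> supp Tu u (Suc i)"
    proof (rule sum.cong[OF refl])
      fix l
      show "b l * D i l j = restr Tu u i b l * D i l j"
      proof (cases "b l = 0 \<or> l \<in> supp Tu u i")
        case False
        then have "l \<in> supp Td u i" using b supp_U(1)[of u i] by (auto simp: cochain_def)
        then have "D i l j = 0" using down' j supp_U[of u "Suc i"] by blast
        then show ?thesis by simp
      qed (auto simp: restr_def)
    qed
    then show "restr Tu u (Suc i) (cod U u i b) j = cod Tu u i (restr Tu u i b) j"
      using supp_U(1) by (auto simp: restr_def cod_def)
  qed
  have to_down: "c \<in> cochain Td u i" if "c \<in> cochain U u i" "restr Tu u i c = (\<lambda>_. 0)" for c u i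
    using that supp_U(1)[of u i] unfolding cochain_def restr_def fun_eq_iff by auto (metis UnE)
  have restr_down: "restr Tu u i c = (\<lambda>_. 0)" if "c \<in> cochain Td u i" for c u i
    using that supp_U(2)[of u i] unfolding cochain_def restr_def fun_eq_iff by auto
  have restr_diff: "restr Tu u i (\<lambda>j. c j - q * e j) = (\<lambda>j. restr Tu u i c j - q * restr Tu u i e j)" for u i c e q
    by (auto simp: restr_def)
  \<comment> \<open>The connecting map respects coboundaries. If the restriction of \<open>b\<close>
    is the coboundary of \<open>e\<close>, subtracting \<open>cod U u m e\<close> from
    \<open>b\<close> moves it into the subcomplex of \<open>Td\<close> without changing
    \<open>cod U u i b\<close>.\<close>
  have lift: "cod U u i b \<in> boundary Td u (Suc i)"
    if b: "b \<in> cochain U u i" and rb: "restr Tu u i b \<in> boundary Tu u i" for u i b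
  proof (cases i)
    case 0
    then have "b \<in> cochain Td u i" using to_down b rb by simp
    then show ?thesis using cod_down by auto
  next
    case (Suc m)
    then obtain e where e: "e \<in> cochain Tu u m" "restr Tu u i b = cod Tu u m e" using rb by auto
    then have eU: "e \<in> cochain U u m" using sub by blast
    define f where "f = (\<lambda>j. b j - 1 * cod U u m e j)"
    have fU: "f \<in> cochain U u i" unfolding f_def using b cod_cochain Suc by (intro cochain_diff) auto
    have "restr Tu u i (cod U u m e) = cod Tu u m e"
      using restr_cod[OF eU] restr_idem[OF e(1)] Suc by simp
    then have "restr Tu u i f = (\<lambda>_. 0)" unfolding f_def restr_diff using e by simp
    then have f: "f \<in> cochain Td u i" using to_down fU by blast
    have "cod U u i f = cod U u i b"
      unfolding f_def cod_diff using cod_cod[OF convex eU] Suc by simp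
    then show ?thesis using cod_down[OF f] f by (simp add: image_iff) metis
  qed
  have cocycle_down: "c \<in> cocycle U u i" if "c \<in> cocycle Td u i" for c u i
    using that cod_down sub(2)[of u i] by (auto simp: cocycle_def)
  \<comment> \<open>The connecting map is onto: a cocycle of \<open>Td\<close> is a cocycle of
    \<open>U\<close>, hence a coboundary there, and its preimage \<open>b\<close> restricts to a
    cocycle of \<open>Tu\<close>.\<close>
  have cocycle_lift: "\<exists>b\<in>cochain U u i. restr Tu u i b \<in> cocycle Tu u i \<and> c = cod U u i b"
    if c: "c \<in> cocycle Td u (Suc i)" for c u i
  proof -
    obtain b where b: "b \<in> cochain U u i" "c = cod U u i b"
      using cocycle_down[OF c] exact[of u "Suc i"] by (auto simp: exact_at_def)
    have "cod Tu u i (restr Tu u i b) = restr Tu u (Suc i) c" using restr_cod b by simp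
    also have "\<dots> = (\<lambda>_. 0)" using c restr_down by (simp add: cocycle_def)
    finally show ?thesis using b restr_cochain by (auto simp: cocycle_def)
  qed
  have "exact_at Td u i" if ui: "(u, i) \<noteq> (0, Suc k)" for u i
  proof (cases i)
    case 0
    then show ?thesis using cocycle_down[of _ u 0] exact[of u 0] by (auto simp: exact_at_def)
  next
    case (Suc m)
    then have m: "exact_at Tu u m" using ui conc by (simp add: concentrated_def)
    have "c \<in> boundary Td u (Suc m)" if c: "c \<in> cocycle Td u (Suc m)" for c
      using cocycle_lift[OF c] lift m by (auto simp: exact_at_def simp del: boundary_Suc)
    then show ?thesis using Suc by (auto simp: exact_at_def)
  qed
  moreover have "one_dim Td 0 (Suc k)"
  proof -
    obtain h where h: "h \<in> cocycle Tu 0 k" "h \<notin> boundary Tu 0 k"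
      and gen: "\<And>c. c \<in> cocycle Tu 0 k \<Longrightarrow> \<exists>q. (\<lambda>j. c j - q * h j) \<in> boundary Tu 0 k"
      using conc by (auto simp: concentrated_def one_dim_def)
    have hT: "h \<in> cochain Tu 0 k" and hU: "h \<in> cochain U 0 k" using h sub by (auto simp: cocycle_def)
    define h' where "h' = cod U 0 k h"
    have "restr Tu 0 (Suc k) h' = (\<lambda>_. 0)"
      using restr_cod[OF hU] restr_idem[OF hT] h by (simp add: h'_def cocycle_def)
    then have h'T: "h' \<in> cochain Td 0 (Suc k)" using to_down cod_cochain by (simp add: h'_def)
    have "cod U 0 (Suc k) h' = (\<lambda>_. 0)" unfolding h'_def by (rule cod_cod[OF convex hU])
    then have h'_cocycle: "h' \<in> cocycle Td 0 (Suc k)" using h'T cod_down by (simp add: cocycle_def)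
    moreover have "h' \<notin> boundary Td 0 (Suc k)"
    proof
      assume "h' \<in> boundary Td 0 (Suc k)"
      then obtain f where f: "f \<in> cochain Td 0 k" "h' = cod Td 0 k f" by auto
      \<comment> \<open>Injectivity of the connecting map: \<open>h - f\<close> is a cocycle over
        \<open>U\<close>, therefore a coboundary, and restricting it to \<open>Tu\<close> gives back
        \<open>h\<close>.\<close>
      define e where "e = (\<lambda>j. h j - 1 * f j)"
      have fU: "f \<in> cochain U 0 k" using f sub by blast
      have eU: "e \<in> cochain U 0 k" unfolding e_def using hU fU by (rule cochain_diff)
      have "cod U 0 k e = (\<lambda>_. 0)"
        unfolding e_def cod_diff using f cod_down[OF f(1)] by (simp add: h'_def fun_eq_iff)
      then have "e \<in> boundary U 0 k" using eU exact[of 0 k] by (auto simp: exact_at_def cocycle_def)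
      moreover have re: "restr Tu 0 k e = h"
        unfolding e_def restr_diff using restr_idem[OF hT] restr_down[OF f(1)] by simp
      ultimately have "h \<in> boundary Tu 0 k"
      proof (cases k)
        case 0
        then show ?thesis using \<open>e \<in> boundary U 0 k\<close> re by (auto simp: restr_def)
      next
        case (Suc m)
        then obtain g where g: "g \<in> cochain U 0 m" "e = cod U 0 m g" using \<open>e \<in> boundary U 0 k\<close> by auto
        then have "h = cod Tu 0 m (restr Tu 0 m g)" using re restr_cod Suc by auto
        then show ?thesis using restr_cochain Suc by auto
      qed
      then show False using h by simp
    qed
    moreover have "\<exists>q. (\<lambda>j. c j - q * h' j) \<in> boundary Td 0 (Suc k)" if c: "c \<in> cocycle Td 0 (Suc k)" for c
    proof -
      obtain b where b: "b \<in> cochain U 0 k" "restr Tu 0 k b \<in> cocycle Tu 0 k" "c = cod U 0 k b"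
        using cocycle_lift[OF c] by blast
      obtain q where q: "(\<lambda>j. restr Tu 0 k b j - q * h j) \<in> boundary Tu 0 k" using gen b by blast
      have "restr Tu 0 k (\<lambda>j. b j - q * h j) \<in> boundary Tu 0 k"
        unfolding restr_diff using q restr_idem[OF hT] by simp
      then have "cod U 0 k (\<lambda>j. b j - q * h j) \<in> boundary Td 0 (Suc k)"
        using lift cochain_diff[OF b(1) hU] by blast
      then show ?thesis unfolding cod_diff h'_def b(3) by blast
    qed
    ultimately show ?thesis unfolding one_dim_def by blast
  qed
  ultimately show ?thesis unfolding concentrated_def by blast
qed

end

section \<open>The augmented complex and its octants\<close>

text \<open>\<open>kernel\<close> and \<open>aug_kernel\<close> express exactness of the augmented
  resolution in the single degree \<open>u\<close>. The functional \<open>\<epsilon>\<close> is the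
  augmentation on the basis; the residue field sits in degree 0, so only basis vectors of that
  degree can have a nonzero value.\<close>

locale augmented_graded_matrices = graded_matrices S n s D
  for S :: "'g::ab_group_add set" and n s and D :: "nat \<Rightarrow> nat \<Rightarrow> nat \<Rightarrow> 'k::field" +
  fixes \<epsilon> :: "nat \<Rightarrow> 'k"
  assumes S_zero: "0 \<in> S" and S_pointed: "x \<in> S \<Longrightarrow> - x \<in> S \<Longrightarrow> x = 0"
    and aug_degree: "j < n 0 \<Longrightarrow> \<epsilon> j \<noteq> 0 \<Longrightarrow> s 0 j = 0"
    and aug_nonzero: "\<exists>j<n 0. \<epsilon> j \<noteq> 0"
    and aug_product: "j < n 1 \<Longrightarrow> s 1 j = 0 \<Longrightarrow> (\<Sum>l<n 0. \<epsilon> l * D 0 l j) = 0"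
    and kernel: "v \<in> cochain S u (Suc i) \<Longrightarrow> (\<forall>l\<in>supp S u i. (\<Sum>j<n (Suc i). D i l j * v j) = 0) \<Longrightarrow>
      \<exists>w\<in>cochain S u (Suc (Suc i)). \<forall>j\<in>supp S u (Suc i). v j = (\<Sum>p<n (Suc (Suc i)). D (Suc i) j p * w p)"
    and aug_kernel: "v \<in> cochain S u 0 \<Longrightarrow> (u = 0 \<Longrightarrow> (\<Sum>j<n 0. \<epsilon> j * v j) = 0) \<Longrightarrow>
      \<exists>w\<in>cochain S u 1. \<forall>j\<in>supp S u 0. v j = (\<Sum>p<n 1. D 0 j p * w p)"
begin

text \<open>Cocycles are the functionals that vanish on the image of the differential: moving
  \<open>D\<close> across the pairing turns it into \<open>cod S u i c\<close> paired with
  \<open>w\<close>.\<close>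

lemma cocycle_orthogonal:
  assumes c: "c \<in> cocycle S u i" and w: "w \<in> cochain S u (Suc i)"
    and v: "\<forall>j\<in>supp S u i. v j = (\<Sum>p<n (Suc i). D i j p * w p)"
  shows "(\<Sum>j\<in>supp S u i. c j * v j) = 0"
proof -
  have c0: "c j = 0" if "j \<notin> supp S u i" for j using c that by (auto simp: cocycle_def cochain_def)
  have "(\<Sum>j\<in>supp S u i. c j * v j) = (\<Sum>j\<in>supp S u i. c j * (\<Sum>p<n (Suc i). D i j p * w p))"
    using v by simp
  also have "\<dots> = (\<Sum>j<n i. c j * (\<Sum>p<n (Suc i). D i j p * w p))"
    by (rule sum.mono_neutral_left) (auto simp: c0, auto simp: supp_def)
  also have "\<dots> = (\<Sum>p<n (Suc i). w p * (\<Sum>j<n i. c j * D i j p))"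
    unfolding sum_distrib_left by (subst sum.swap) (simp add: algebra_simps)
  also have "\<dots> = 0"
  proof (rule sum.neutral, rule ballI)
    fix p
    show "w p * (\<Sum>j<n i. c j * D i j p) = 0"
    proof (cases "w p = 0")
      case False
      then have "p \<in> supp S u (Suc i)" using w by (auto simp: cochain_def)
      then have "(\<Sum>j<n i. c j * D i j p) = cod S u i c p" by (simp add: cod_def)
      then show ?thesis using c by (simp add: cocycle_def)
    qed simp
  qed
  finally show ?thesis .
qed

lemma sum_supp: "(\<Sum>j<n i. f j * restr T u i v j) = (\<Sum>j\<in>supp T u i. f j * v j)"
proof -
  have "(\<Sum>j<n i. f j * restr T u i v j) = (\<Sum>j\<in>supp T u i. f j * restr T u i v j)"
    by (rule sum.mono_neutral_right) (auto simp: supp_def restr_def)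
  then show ?thesis by (simp add: restr_def)
qed

lemma finite_supp [simp]: "finite (supp T u i)"
  by (simp add: supp_def)

text \<open>The homogeneous parts of the resolution are exact sequences of finite-dimensional vector spaces,
  so their duals are exact as well.\<close>

lemma concentrated_0: "concentrated S 0"
proof -
  have "exact_at S u (Suc m)" for u m
  proof -
    have "c \<in> boundary S u (Suc m)" if c: "c \<in> cocycle S u (Suc m)" for c
    proof -
      \<comment> \<open>By exactness, whatever the rows of \<open>D m\<close> kill lies in the image
        of \<open>D (Suc m)\<close>, where \<open>c\<close> vanishes. So \<open>c\<close> is a
        combination of these rows, and the coefficients form the preimage.\<close>
      have "\<exists>b. \<forall>j\<in>supp S u (Suc m). c j = (\<Sum>l\<in>supp S u m. b l * D m l j)"
      proof (rule functional_factors)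
        fix v assume v: "\<forall>l\<in>supp S u m. (\<Sum>j\<in>supp S u (Suc m). D m l j * v j) = 0"
        define v' where "v' = restr S u (Suc m) v"
        have "v' \<in> cochain S u (Suc m)" unfolding v'_def by (rule restr_cochain)
        moreover have "\<forall>l\<in>supp S u m. (\<Sum>j<n (Suc m). D m l j * v' j) = 0"
          using v by (simp add: v'_def sum_supp)
        ultimately obtain w where w: "w \<in> cochain S u (Suc (Suc m))"
          "\<forall>j\<in>supp S u (Suc m). v' j = (\<Sum>p<n (Suc (Suc m)). D (Suc m) j p * w p)"
          using kernel by blast
        have "(\<Sum>j\<in>supp S u (Suc m). c j * v' j) = 0" by (rule cocycle_orthogonal[OF c w])
        then show "(\<Sum>j\<in>supp S u (Suc m). c j * v j) = 0" by (simp add: v'_def restr_def)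
      qed auto
      then obtain b where b: "\<forall>j\<in>supp S u (Suc m). c j = (\<Sum>l\<in>supp S u m. b l * D m l j)" by blast
      have "c = cod S u m (restr S u m b)"
      proof (rule ext)
        fix j
        show "c j = cod S u m (restr S u m b) j"
        proof (cases "j \<in> supp S u (Suc m)")
          case True
          then show ?thesis using b sum_supp[where f = "\<lambda>l. D m l j"] by (simp add: cod_def mult.commute)
        next
          case False
          then show ?thesis using c by (auto simp: cod_def cocycle_def cochain_def)
        qed
      qed
      then show ?thesis using restr_cochain by auto
    qed
    then show ?thesis by (auto simp: exact_at_def)
  qed
  moreover have "exact_at S u 0" if u: "u \<noteq> 0" for u
  proof -
    have "c = (\<lambda>_. 0)" if c: "c \<in> cocycle S u 0" for c
    proof (rule ext, rule ccontr)
      fix j assume j: "c j \<noteq> 0"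
      then have js: "j \<in> supp S u 0" using c by (auto simp: cocycle_def cochain_def)
      \<comment> \<open>Away from degree 0 the augmentation imposes no condition, so even this unit
        vector is in the image, and pairing it with \<open>c\<close> reads off
        \<open>c j\<close>.\<close>
      define v where "v = (\<lambda>i. if i = j then 1 else 0 :: 'k)"
      have "v \<in> cochain S u 0" using js by (auto simp: v_def cochain_def)
      then obtain w where w: "w \<in> cochain S u (Suc 0)" "\<forall>j\<in>supp S u 0. v j = (\<Sum>p<n (Suc 0). D 0 j p * w p)"
        using aug_kernel[of v u] u by auto
      have "(\<Sum>j\<in>supp S u 0. c j * v j) = 0" by (rule cocycle_orthogonal[OF c w])
      then show False using j js by (simp add: v_def if_distrib cong: if_cong)
    qed
    then show ?thesis by (auto simp: exact_at_def)
  qed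
  moreover have "one_dim S 0 0"
  proof -
    define h where "h = restr S 0 0 \<epsilon>"
    have hj: "h j = (if j < n 0 then \<epsilon> j else 0)" for j
      using aug_degree[of j] S_zero by (cases "\<epsilon> j = 0") (auto simp: h_def restr_def supp_def)
    have "h \<in> cochain S 0 0" unfolding h_def by (rule restr_cochain)
    moreover have "(\<Sum>l<n 0. \<epsilon> l * D 0 l j) = 0" if j: "j < n (Suc 0)" "- s (Suc 0) j \<in> S" for j
    proof (cases "s (Suc 0) j = 0")
      case True
      then show ?thesis using aug_product j by simp
    next
      case False
      \<comment> \<open>A nonzero term would put \<open>s 1 j\<close> into \<open>S\<close>, whose
        negative is in \<open>S\<close> as well by the support condition.\<close>
      have "\<epsilon> l * D 0 l j = 0" if l: "l < n 0" for l
      proof (rule ccontr)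
        assume nz: "\<epsilon> l * D 0 l j \<noteq> 0"
        then have "s 0 l = 0" using aug_degree l by auto
        then have "s (Suc 0) j \<in> S" using entry_degree[of 0 l j] nz l j by auto
        then show False using S_pointed j False by blast
      qed
      then show ?thesis by (simp add: sum.neutral)
    qed
    then have "cod S 0 0 h = (\<lambda>_. 0)" by (auto simp: cod_def hj supp_def)
    ultimately have "h \<in> cocycle S 0 0" by (simp add: cocycle_def)
    moreover have "h \<notin> boundary S 0 0" using aug_nonzero by (auto simp: fun_eq_iff hj)
    moreover have "\<exists>q. (\<lambda>j. c j - q * h j) \<in> boundary S 0 0" if c: "c \<in> cocycle S 0 0" for c
    proof -
      \<comment> \<open>With a one-element family of functionals: what vanishes on the kernel of
        \<open>\<epsilon>\<close> is a multiple of \<open>\<epsilon>\<close>.\<close>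
      have "\<exists>b. \<forall>j\<in>supp S 0 0. c j = (\<Sum>l\<in>{()}. b l * \<epsilon> j)"
      proof (rule functional_factors)
        fix v assume v: "\<forall>l\<in>{()}. (\<Sum>j\<in>supp S 0 0. \<epsilon> j * v j) = 0"
        define v' where "v' = restr S 0 0 v"
        have "v' \<in> cochain S 0 0" unfolding v'_def by (rule restr_cochain)
        moreover have "(\<Sum>j<n 0. \<epsilon> j * v' j) = 0" using v by (simp add: v'_def sum_supp)
        ultimately obtain w where w: "w \<in> cochain S 0 (Suc 0)"
            "\<forall>j\<in>supp S 0 0. v' j = (\<Sum>p<n (Suc 0). D 0 j p * w p)"
          using aug_kernel[of v' 0] by auto
        have "(\<Sum>j\<in>supp S 0 0. c j * v' j) = 0" by (rule cocycle_orthogonal[OF c w])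
        then show "(\<Sum>j\<in>supp S 0 0. c j * v j) = 0" by (simp add: v'_def restr_def)
      qed auto
      then obtain q where q: "\<forall>j\<in>supp S 0 0. c j = q * \<epsilon> j" by auto
      have "c j - q * h j = 0" for j
        using q c by (cases "j \<in> supp S 0 0") (auto simp: h_def restr_def cocycle_def cochain_def)
      then have "(\<lambda>j. c j - q * h j) = (\<lambda>_. 0)" by blast
      then show ?thesis by auto
    qed
    ultimately show ?thesis by (auto simp: one_dim_def)
  qed
  ultimately show ?thesis
    unfolding concentrated_def by (metis (no_types, lifting) old.nat.exhaust)
qed

end

section \<open>Localizations of a semigroup at sets of rays\<close>

locale lattice_monoid =
  fixes S :: "(int ^ 'd) set"
  assumes S_zero: "0 \<in> S" and S_add: "x \<in> S \<Longrightarrow> y \<in> S \<Longrightarrow> x + y \<in> S"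
begin

lemma S_smult: "x \<in> S \<Longrightarrow> int N *s x \<in> S"
proof (induction N)
  case (Suc N)
  have "int (Suc N) *s x = x + int N *s x" by (simp add: vector_sadd_rdistrib)
  then show ?case using Suc S_add by metis
qed (simp add: S_zero)

lemma S_smult_int: "x \<in> S \<Longrightarrow> 0 \<le> k \<Longrightarrow> k *s x \<in> S"
  using S_smult[of x "nat k"] by simp

lemma S_sum: "(\<And>i. i \<in> X \<Longrightarrow> f i \<in> S) \<Longrightarrow> sum f X \<in> S"
  by (induction X rule: infinite_finite_induct) (auto simp: S_zero S_add)

end

text \<open>By \<open>S_bound\<close>, inverting the rays inverts every element of \<open>S\<close>;
  this is what makes \<open>loc UNIV\<close> the group generated by \<open>S\<close>.\<close>

locale simplicial_cone = lattice_monoid S for S :: "(int ^ 'd) set" +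
  fixes a :: "'d \<Rightarrow> int ^ 'd"
  assumes a_S: "a i \<in> S"
    and S_bound: "x \<in> S \<Longrightarrow> \<exists>N. (\<Sum>j\<in>UNIV. int N *s a j) - x \<in> S"
begin

lemma lattice_S: "(\<And>i. i \<in> X \<Longrightarrow> 0 \<le> f i) \<Longrightarrow> (\<Sum>i\<in>X. f i *s a i) \<in> S"
  by (intro S_sum S_smult_int a_S)

text \<open>The exponents of the localization of the semigroup ring at the monomials of degrees
  \<open>a j\<close>, \<open>j \<in> X\<close>. The \<open>S_i\<close> of the overview is
  \<open>loc (- {i})\<close>.\<close>

definition loc :: "'d set \<Rightarrow> (int ^ 'd) set" where
  "loc X = {u. \<exists>N. u + (\<Sum>j\<in>X. int N *s a j) \<in> S}"

lemma loc_large: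
  assumes "u \<in> loc X"
  obtains N where "\<And>f. (\<And>j. j \<in> X \<Longrightarrow> int N \<le> f j) \<Longrightarrow> u + (\<Sum>j\<in>X. f j *s a j) \<in> S"
proof -
  obtain N where N: "u + (\<Sum>j\<in>X. int N *s a j) \<in> S" using assms by (auto simp: loc_def)
  have "u + (\<Sum>j\<in>X. f j *s a j) \<in> S" if f: "\<And>j. j \<in> X \<Longrightarrow> int N \<le> f j" for f
  proof -
    have "u + (\<Sum>j\<in>X. int N *s a j) + (\<Sum>j\<in>X. (f j - int N) *s a j) \<in> S"
      using f by (intro S_add[OF N lattice_S]) simp
    moreover have "(\<Sum>j\<in>X. int N *s a j) + (\<Sum>j\<in>X. (f j - int N) *s a j) = (\<Sum>j\<in>X. f j *s a j)"
      by (simp add: sum.distrib[symmetric] vector_sub_rdistrib vector_sadd_rdistrib[symmetric])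
    ultimately show ?thesis by (simp add: add.assoc)
  qed
  then show ?thesis using that by blast
qed

text \<open>Adding nonnegative multiples of rays stays in \<open>S\<close>, so unequal or negative
  coefficients can be raised to a common bound.\<close>

lemma locI: "u + (\<Sum>j\<in>X. f j *s a j) \<in> S \<Longrightarrow> u \<in> loc X"
proof -
  assume u: "u + (\<Sum>j\<in>X. f j *s a j) \<in> S"
  define N where "N = nat (Max (insert 0 (range f)))"
  have "f j \<le> Max (insert 0 (range f))" for j by (rule Max_ge) auto
  then have N: "f j \<le> int N" for j by (simp add: N_def del: Max_insert)
  have "u + (\<Sum>j\<in>X. f j *s a j) + (\<Sum>j\<in>X. (int N - f j) *s a j) \<in> S"
    using N by (intro S_add[OF u lattice_S]) simp
  moreover have "(\<Sum>j\<in>X. f j *s a j) + (\<Sum>j\<in>X. (int N - f j) *s a j) = (\<Sum>j\<in>X. int N *s a j)"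
    by (simp add: sum.distrib[symmetric] vector_sadd_rdistrib[symmetric])
  ultimately have "u + (\<Sum>j\<in>X. int N *s a j) \<in> S" by (simp add: add.assoc)
  then show ?thesis by (auto simp: loc_def)
qed

lemma loc_empty: "loc {} = S"
  by (simp add: loc_def)

lemma loc_mono: assumes "X \<subseteq> Y" shows "loc X \<subseteq> loc Y"
proof
  fix u assume "u \<in> loc X"
  then obtain N where N: "u + (\<Sum>j\<in>X. int N *s a j) \<in> S" by (auto simp: loc_def)
  have "(\<Sum>j\<in>Y. (if j \<in> X then int N else 0) *s a j) = (\<Sum>j\<in>X. int N *s a j)"
    using assms by (intro sum.mono_neutral_cong_right) auto
  then show "u \<in> loc Y" using N by (metis locI)
qed

lemma S_loc: "x \<in> S \<Longrightarrow> x \<in> loc X"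
  using loc_mono[of "{}" X] loc_empty by auto

lemma loc_add: assumes "u \<in> loc X" "x \<in> S" shows "u + x \<in> loc X"
proof -
  obtain N where N: "u + (\<Sum>j\<in>X. int N *s a j) \<in> S" using assms by (auto simp: loc_def)
  then have "(u + (\<Sum>j\<in>X. int N *s a j)) + x \<in> S" using assms S_add by blast
  then have "u + x + (\<Sum>j\<in>X. int N *s a j) \<in> S" by (simp add: add_ac)
  then show ?thesis by (auto simp: loc_def)
qed

lemma loc_shift: "u + (\<Sum>j\<in>X. f j *s a j) \<in> loc X \<longleftrightarrow> u \<in> loc X"
proof -
  have imp: "v + (\<Sum>j\<in>X. g j *s a j) \<in> loc X" if v: "v \<in> loc X" for v g
  proof -
    obtain N where "v + (\<Sum>j\<in>X. int N *s a j) \<in> S" using v by (auto simp: loc_def)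
    moreover have "v + (\<Sum>j\<in>X. int N *s a j) = v + (\<Sum>j\<in>X. g j *s a j) + (\<Sum>j\<in>X. (int N - g j) *s a j)"
      by (simp add: add.assoc sum.distrib[symmetric] vector_sadd_rdistrib[symmetric])
    ultimately show ?thesis using locI by metis
  qed
  show ?thesis
  proof
    assume "u + (\<Sum>j\<in>X. f j *s a j) \<in> loc X"
    then have "u + (\<Sum>j\<in>X. f j *s a j) + (\<Sum>j\<in>X. (- f j) *s a j) \<in> loc X" by (rule imp)
    then show "u \<in> loc X" by (simp add: add.assoc sum.distrib[symmetric] vector_sadd_rdistrib[symmetric])
  qed (rule imp)
qed

lemma loc_unit:
  assumes "j \<in> X" shows "u + k *s a j \<in> loc X \<longleftrightarrow> u \<in> loc X"
proof -
  have "(\<Sum>i\<in>X. (if i = j then k else 0) *s a i) = (\<Sum>i\<in>X. if i = j then k *s a i else 0)"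
    by (intro sum.cong) auto
  also have "\<dots> = k *s a j" using assms by simp
  finally show ?thesis using loc_shift[of u "\<lambda>i. if i = j then k else 0" X] by simp
qed

text \<open>Localization at \<open>insert k X\<close> can be done in two steps; a large multiple of
  \<open>a k\<close> clears the denominator in direction \<open>k\<close> and leaves those in
  \<open>X\<close>.\<close>

lemma loc_large_multiple:
  assumes "u \<in> loc (insert k X)" and "k \<notin> X"
  obtains N where "\<And>n. n \<ge> N \<Longrightarrow> u + int n *s a k \<in> loc X"
proof -
  obtain N where N: "\<And>f. (\<And>j. j \<in> insert k X \<Longrightarrow> int N \<le> f j) \<Longrightarrow> u + (\<Sum>j\<in>insert k X. f j *s a j) \<in> S"
    using loc_large[OF assms(1)] by blast
  have "u + int m *s a k \<in> loc X" if "m \<ge> N" for m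
  proof (rule locI)
    have "u + (\<Sum>j\<in>insert k X. (if j = k then int m else int N) *s a j) \<in> S" using that by (intro N) auto
    moreover have "(\<Sum>j\<in>X. (if j = k then int m else int N) *s a j) = (\<Sum>j\<in>X. int N *s a j)"
      using assms(2) by (intro sum.cong) auto
    ultimately show "u + int m *s a k + (\<Sum>j\<in>X. int N *s a j) \<in> S"
      using assms(2) by (simp add: add.assoc)
  qed
  then show ?thesis using that by blast
qed

lemma loc_UNIV_add: assumes "u \<in> loc UNIV" "v \<in> loc UNIV" shows "u + v \<in> loc UNIV"
proof -
  obtain N M where "u + (\<Sum>j\<in>UNIV. int N *s a j) \<in> S" "v + (\<Sum>j\<in>UNIV. int M *s a j) \<in> S"
    using assms by (auto simp: loc_def)
  then have "(u + (\<Sum>j\<in>UNIV. int N *s a j)) + (v + (\<Sum>j\<in>UNIV. int M *s a j)) \<in> S" by (rule S_add)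
  then have "u + v + (\<Sum>j\<in>UNIV. (int N + int M) *s a j) \<in> S"
    by (simp add: vector_sadd_rdistrib sum.distrib add_ac)
  then show ?thesis by (rule locI)
qed

lemma loc_UNIV_uminus: assumes "u \<in> loc UNIV" shows "- u \<in> loc UNIV"
proof -
  obtain N where N: "u + (\<Sum>j\<in>UNIV. int N *s a j) \<in> S" using assms by (auto simp: loc_def)
  obtain M where "(\<Sum>j\<in>UNIV. int M *s a j) - (u + (\<Sum>j\<in>UNIV. int N *s a j)) \<in> S"
    using S_bound[OF N] by blast
  then have "- u + (\<Sum>j\<in>UNIV. (int M - int N) *s a j) \<in> S"
    by (simp add: vector_sub_rdistrib sum_subtractf algebra_simps)
  then show ?thesis by (rule locI)
qed

text \<open>The sets \<open>T_X\<close> of the overview, \<open>loc UNIV\<close> being the group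
  generated by \<open>S\<close>.\<close>

definition octant :: "'d set \<Rightarrow> (int ^ 'd) set" where
  "octant X = {u \<in> loc UNIV. \<forall>i. u \<in> loc (- {i}) \<longleftrightarrow> i \<notin> X}"

end

locale graded_matrices_cone = graded_matrices S n s D + simplicial_cone S a
  for S :: "(int ^ 'd) set" and n s and D :: "nat \<Rightarrow> nat \<Rightarrow> nat \<Rightarrow> 'k::field" and a :: "'d \<Rightarrow> int ^ 'd"
begin

lemma concentrated_octant:
  assumes S: "octant {} = S" and base: "concentrated S 0" and nz: "\<And>i. a i \<noteq> 0"
  shows "concentrated (octant X) (card X)"
proof -
  have "finite X" by simp
  then show ?thesis
  proof (induction X rule: finite_induct)
    case empty
    then show ?case using S base by simp
  next
    case (insert k X)
    define U where "U = octant X \<union> octant (insert k X)"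
    \<comment> \<open>In the union the condition at \<open>k\<close> disappears, which is the source
      of the invariance under \<open>a k\<close>.\<close>
    have U_iff: "u \<in> U \<longleftrightarrow> u \<in> loc UNIV \<and> (\<forall>i. i \<noteq> k \<longrightarrow> (u \<in> loc (- {i}) \<longleftrightarrow> i \<notin> X))" for u
      using insert.hyps by (auto simp: U_def octant_def)
    have "concentrated (octant (insert k X)) (Suc (card X))"
    proof (rule concentrated_Suc[OF U_def _ _ _ _ insert.IH])
      show "octant X \<inter> octant (insert k X) = {}" using insert.hyps by (auto simp: octant_def)
    next
      fix t x assume t: "t \<in> octant (insert k X)" and x: "x \<in> S" and tx: "t - x \<in> U"
      have "t - x \<notin> loc (- {k})" using t loc_add[OF _ x, of "t - x"] by (auto simp: octant_def)
      then show "t - x \<in> octant (insert k X)" using tx insert.hyps by (auto simp: U_def octant_def)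
    next
      fix t x y assume t: "t \<in> U" and x: "x \<in> S" and y: "y \<in> S" and txy: "t - x - y \<in> U"
      \<comment> \<open>Membership in a localization is inherited upwards from
        \<open>t - x - y\<close>, non-membership downwards from \<open>t\<close>; so
        \<open>t - x\<close> satisfies the conditions of both kinds.\<close>
      have "t - x \<in> loc (- {i}) \<Longrightarrow> t \<in> loc (- {i})" for i using loc_add[OF _ x, of "t - x"] by simp
      moreover have "t - x - y \<in> loc Y \<Longrightarrow> t - x \<in> loc Y" for Y using loc_add[OF _ y, of "t - x - y"] by simp
      ultimately show "t - x \<in> U" using t txy unfolding U_iff by blast
    next
      fix u i
      \<comment> \<open>The free modules have finite rank, so one bound serves all positions in
        cohomological degree \<open>p\<close>.\<close>
      have "\<exists>N. \<forall>m\<ge>N. \<forall>j<n p. u - s p j + int m *s a k \<in> octant X \<longleftrightarrow> u - s p j \<in> U" for p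
      proof -
        have "\<exists>N. \<forall>m\<ge>N. u - s p j + int m *s a k \<in> octant X \<longleftrightarrow> u - s p j \<in> U" for j
        proof (cases "u - s p j \<in> loc UNIV")
          case True
          have "insert k (- {k}) = UNIV" by auto
          then obtain N where N: "\<And>m. m \<ge> N \<Longrightarrow> u - s p j + int m *s a k \<in> loc (- {k})"
            using loc_large_multiple[of "u - s p j" k "- {k}"] True by auto
          have "u - s p j + int m *s a k \<in> octant X \<longleftrightarrow> u - s p j \<in> U" if "m \<ge> N" for m
          proof -
            have "u - s p j + int m *s a k \<in> loc (- {i}) \<longleftrightarrow> u - s p j \<in> loc (- {i})" if "i \<noteq> k" for i
              using that by (intro loc_unit) simp
            moreover have "u - s p j + int m *s a k \<in> loc UNIV" using True by (simp add: loc_unit)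
            ultimately show ?thesis
              using N[OF that] True insert.hyps(2) unfolding octant_def U_iff mem_Collect_eq by metis
          qed
          then show ?thesis by blast
        next
          case False
          then show ?thesis by (simp add: octant_def U_iff loc_unit)
        qed
        then obtain N where N: "\<And>j m. m \<ge> N j \<Longrightarrow> u - s p j + int m *s a k \<in> octant X \<longleftrightarrow> u - s p j \<in> U"
          by metis
        have "N j \<le> Max (insert 0 (N ` {..<n p}))" if "j < n p" for j using that by (intro Max_ge) auto
        then show ?thesis using N by (intro exI[of _ "Max (insert 0 (N ` {..<n p}))"]) (meson order_trans)
      qed
      then obtain N where N: "\<And>p m j. m \<ge> N p \<Longrightarrow> j < n p \<Longrightarrow> u - s p j + int m *s a k \<in> octant X \<longleftrightarrow> u - s p j \<in> U"
        by metis
      \<comment> \<open>Exactness at \<open>i\<close> involves the cochains in degrees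
        \<open>i - 1\<close>, \<open>i\<close> and \<open>i + 1\<close>; for \<open>i = 0\<close>
        the truncated \<open>i - 1\<close> is harmless, as it only counts \<open>N 0\<close>
        twice.\<close>
      define M where "M = N i + N (Suc i) + N (i - 1)"
      \<comment> \<open>The induction hypothesis gives exactness in degree \<open>card X\<close>
        only away from internal degree 0. Two consecutive translates cannot both be 0 because
        \<open>a k\<close> is not.\<close>
      have "\<exists>m\<ge>M. u + int m *s a k \<noteq> 0"
      proof (rule ccontr)
        assume "\<not> ?thesis"
        then have "u + int M *s a k = 0" "u + int (Suc M) *s a k = 0" using le_SucI by blast+
        moreover have "u + int (Suc M) *s a k = (u + int M *s a k) + a k"
          by (simp add: vector_sadd_rdistrib add_ac)
        ultimately have "a k = 0" by simp
        then show False using nz by blast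
      qed
      then obtain m where m: "m \<ge> M" "u + int m *s a k \<noteq> 0" by blast
      have supp_eq: "supp U u p = supp (octant X) (u + int m *s a k) p" if "N p \<le> M" for p
        using N[of p m] that m by (auto simp: supp_def algebra_simps)
      have "exact_at U u i = exact_at (octant X) (u + int m *s a k) i"
        by (rule exact_at_cong; rule supp_eq) (auto simp: M_def)
      then show "exact_at U u i" using insert.IH m by (simp add: concentrated_def)
    qed
    then show ?case using insert.hyps by simp
  qed
qed

end

section \<open>Coordinates along the extremal rays\<close>

lemma rat_vec_add: "rat_vec (u + v) = rat_vec u + rat_vec v"
  and rat_vec_smult: "rat_vec (k *s v) = of_int k *s rat_vec v"
  and rat_vec_zero: "rat_vec 0 = 0"
  by (simp_all add: rat_vec_def vec_eq_iff)

lemma rat_vec_inject: "rat_vec u = rat_vec v \<longleftrightarrow> u = v"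
  by (simp add: rat_vec_def vec_eq_iff)

context simplicial_affine_semigroup
begin

sublocale lattice_monoid S
proof -
  have "add_submonoid (add_submonoid hull A)"
    by (rule hull_in) (auto simp: add_submonoid_def)
  then have "add_submonoid S" using generators by (simp add: minimally_generated_by_def)
  then show "lattice_monoid S" by unfold_locales (auto simp: add_submonoid_def)
qed

lemma rays_S: "a i \<in> S"
  using rays_generators[of i] generators hull_subset[of A add_submonoid]
  by (auto simp: minimally_generated_by_def)

lemma pointed: assumes "x \<in> S" "- x \<in> S" shows "x = 0"
  using nonneg[OF assms(1)] nonneg[OF assms(2)] by (simp add: vec_eq_iff) (meson antisym)

lemma rays_span: "vec.span (range (\<lambda>i. rat_vec (a i))) = UNIV"
proof -
  have "inj (\<lambda>i. rat_vec (a i))" using rays_inj by (auto simp: inj_def rat_vec_inject)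
  then have "card (range (\<lambda>i. rat_vec (a i))) = CARD('d)" by (simp add: card_image)
  then have "UNIV \<subseteq> vec.span (range (\<lambda>i. rat_vec (a i)))"
    using rays_independent by (intro vec.card_ge_dim_independent) (auto simp: card_cart_basis)
  then show ?thesis by auto
qed

definition coord :: "'d \<Rightarrow> int ^ 'd \<Rightarrow> rat" where
  "coord i v = vec.representation (range (\<lambda>i. rat_vec (a i))) (rat_vec v) (rat_vec (a i))"

lemma coord_add: "coord i (u + v) = coord i u + coord i v"
  using rays_span by (simp add: coord_def rat_vec_add vec.representation_add[OF rays_independent])

lemma coord_smult: "coord i (k *s v) = of_int k * coord i v"
  using rays_span by (simp add: coord_def rat_vec_smult vec.representation_scale[OF rays_independent])

lemma coord_zero: "coord i 0 = 0"
  using coord_smult[of i 0 0] by simp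

lemma coord_diff: "coord i (u - v) = coord i u - coord i v"
  using coord_add[of i "u - v" v] by simp

lemma coord_sum: "coord i (sum f X) = (\<Sum>x\<in>X. coord i (f x))"
  by (induction X rule: infinite_finite_induct) (auto simp: coord_zero coord_add)

lemma coord_a: "coord i (a j) = (if i = j then 1 else 0)"
  using rays_inj
  by (auto simp: coord_def vec.representation_basis[OF rays_independent] rat_vec_inject inj_eq)

lemma coord_combination: "coord i (\<Sum>j\<in>X. f j *s a j) = (if i \<in> X then of_int (f i) else 0)"
proof -
  have "coord i (\<Sum>j\<in>X. f j *s a j) = (\<Sum>j\<in>X. if j = i then of_int (f j) else 0)"
    unfolding coord_sum by (intro sum.cong) (auto simp: coord_smult coord_a)
  then show ?thesis by simp
qed

lemma rat_vec_coord: "rat_vec v = (\<Sum>i\<in>UNIV. coord i v *s rat_vec (a i))"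
proof -
  have inj: "inj (\<lambda>i. rat_vec (a i))" using rays_inj by (auto simp: inj_def rat_vec_inject)
  have "(\<Sum>b\<in>range (\<lambda>i. rat_vec (a i)). vec.representation (range (\<lambda>i. rat_vec (a i))) (rat_vec v) b *s b) = rat_vec v"
    using rays_span by (intro vec.sum_representation_eq rays_independent) auto
  then show ?thesis using inj by (simp add: sum.reindex coord_def)
qed

lemma coord_eq_0: "(\<And>i. coord i v = 0) \<Longrightarrow> v = 0"
  using rat_vec_coord[of v] by (metis (no_types, lifting) rat_vec_inject rat_vec_zero sum.neutral vec.scale_zero_left)

lemma coord_nonneg: assumes "v \<in> S" shows "0 \<le> coord i v"
proof -
  obtain q :: "'d \<Rightarrow> rat" where q: "\<forall>i. 0 \<le> q i" "rat_vec v = (\<Sum>i\<in>UNIV. q i *s rat_vec (a i))"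
    using simplicial[OF assms] by blast
  have "coord i v = (\<Sum>j\<in>UNIV. q j * coord i (a j))"
    unfolding coord_def q(2) using rays_span
    by (simp add: vec.representation_sum[OF rays_independent] vec.representation_scale[OF rays_independent])
  also have "\<dots> = (\<Sum>j\<in>UNIV. if j = i then q j else 0)" by (intro sum.cong) (auto simp: coord_a)
  finally show ?thesis using q by simp
qed

lemma a_nonzero: "a i \<noteq> 0"
  using coord_a[of i i] coord_zero[of i] by auto

text \<open>Vectors are integer combinations of the standard basis, so the product of the finitely
  many denominators of its coordinates serves for all of them.\<close>

lemma common_denominator:
  obtains M :: nat where "M > 0" and "\<And>v i. of_nat M * coord i v \<in> \<int>"
proof -
  have "\<exists>m>0. of_int m * coord i (axis j 1) \<in> \<int>" for i j
  proof -
    obtain x y where "quotient_of (coord i (axis j 1)) = (x, y)" by (cases "quotient_of (coord i (axis j 1))")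
    then have "coord i (axis j 1) = of_int x / of_int y" "y > 0"
      using quotient_of_div quotient_of_denom_pos by blast+
    then show ?thesis by (intro exI[of _ y]) auto
  qed
  then obtain m where m: "\<And>i j. m i j > 0" "\<And>i j. of_int (m i j) * coord i (axis j 1) \<in> \<int>" by metis
  define M where "M = (\<Prod>i\<in>UNIV. \<Prod>j\<in>UNIV. m i j)"
  have "M > 0" by (simp add: M_def prod_pos m)
  have "of_int M * coord i (axis j 1) \<in> \<int>" for i j
  proof -
    have "m i j dvd (\<Prod>j\<in>UNIV. m i j)" by (rule dvd_prodI) auto
    also have "\<dots> dvd M" unfolding M_def by (rule dvd_prodI) auto
    finally obtain c where "M = c * m i j" by (metis dvdE mult.commute)
    then have "of_int M * coord i (axis j 1) = of_int c * (of_int (m i j) * coord i (axis j 1))" by simp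
    then show ?thesis using m by (metis Ints_mult Ints_of_int)
  qed note axis = this
  have "of_int M * coord i v \<in> \<int>" for i v
  proof -
    have "v = (\<Sum>j\<in>UNIV. v $ j *s axis j 1)"
      by (simp add: vec_eq_iff axis_def if_distrib cong: if_cong)
    then have "coord i v = (\<Sum>j\<in>UNIV. of_int (v $ j) * coord i (axis j 1))"
      by (metis (no_types, lifting) coord_smult coord_sum sum.cong)
    then have "of_int M * coord i v = (\<Sum>j\<in>UNIV. of_int (v $ j) * (of_int M * coord i (axis j 1)))"
      by (simp add: sum_distrib_left algebra_simps)
    then show ?thesis by (simp only:) (intro Ints_sum Ints_mult Ints_of_int axis)
  qed
  then show ?thesis using that[of "nat M"] \<open>M > 0\<close> by simp
qed

text \<open>The floors do not round: they only convert rationals known to be integral into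
  integers.\<close>

lemma multiple_in_lattice:
  obtains M :: nat where "M > 0" "\<And>v. int M *s v = (\<Sum>i\<in>UNIV. \<lfloor>of_nat M * coord i v\<rfloor> *s a i)"
    "\<And>v i. of_nat M * coord i v = of_int \<lfloor>of_nat M * coord i v\<rfloor>"
proof -
  obtain M :: nat where M: "M > 0" "\<And>v i. of_nat M * coord i v \<in> \<int>" using common_denominator by blast
  have fl: "of_nat M * coord i v = of_int \<lfloor>of_nat M * coord i v\<rfloor>" for v i
    using M(2) by (metis Ints_cases floor_of_int)
  have "int M *s v - (\<Sum>i\<in>UNIV. \<lfloor>of_nat M * coord i v\<rfloor> *s a i) = 0" for v
    by (rule coord_eq_0) (simp add: coord_diff coord_smult coord_combination fl[symmetric])
  then show ?thesis using that M(1) fl by simp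
qed

sublocale simplicial_cone S a
proof
  fix x assume x: "x \<in> S"
  obtain M :: nat where M: "M > 0" "\<And>v. int M *s v = (\<Sum>i\<in>UNIV. \<lfloor>of_nat M * coord i v\<rfloor> *s a i)"
    by (rule multiple_in_lattice) (rule that)
  define k where "k i = \<lfloor>of_nat M * coord i x\<rfloor>" for i
  define N where "N = nat (Max (insert 0 (range k)))"
  have "k i \<le> Max (insert 0 (range k))" for i by (rule Max_ge) auto
  then have N: "k i \<le> int N" for i by (simp add: N_def del: Max_insert)
  \<comment> \<open>The element \<open>N \<Sum> a_i - x\<close> is split as
    \<open>(N \<Sum> a_i - M x) + (M - 1) x\<close>. The first part is a nonnegative combination of
    rays, since \<open>N\<close> bounds all coefficients \<open>k i\<close> of
    \<open>M x\<close>.\<close>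
  have "(\<Sum>i\<in>UNIV. (int N - k i) *s a i) + int (M - 1) *s x \<in> S"
    using N by (intro S_add S_sum S_smult_int S_smult rays_S x) simp
  moreover have "int M *s x = int (M - 1) *s x + x"
    using M(1) by (cases M) (simp_all add: vector_sadd_rdistrib)
  ultimately have "(\<Sum>i\<in>UNIV. int N *s a i) - x \<in> S"
    using M(2)[of x] by (simp add: k_def vector_sub_rdistrib sum_subtractf algebra_simps)
  then show "\<exists>N. (\<Sum>j\<in>UNIV. int N *s a j) - x \<in> S" by blast
qed (rule rays_S)

section \<open>The Apery set and the exponents of the canonical module\<close>

context
  assumes octant: "octant {} = S"
begin

lemma S_iff_loc: "u \<in> S \<longleftrightarrow> (\<forall>i. u \<in> loc (- {i}))"
proof -
  have "u \<in> loc UNIV" if "u \<in> loc (- {i})" for i using that loc_mono[of "- {i}" UNIV] by auto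
  then have "u \<in> octant {} \<longleftrightarrow> (\<forall>i. u \<in> loc (- {i}))" by (auto simp: octant_def)
  then show ?thesis using octant by simp
qed

text \<open>The ray \<open>a i\<close> is invertible in \<open>loc (- {j})\<close> for
  \<open>j \<noteq> i\<close>, so subtracting it can lead out of the localization at
  \<open>i\<close> only. It must do so, since \<open>S\<close> is the intersection of these
  localizations and \<open>w - a i\<close> is not in \<open>S\<close>.\<close>

lemma Apery_not_loc:
  assumes w: "w \<in> Apery S (range a)"
  shows "w - a i \<notin> loc (- {i})"
proof
  assume i: "w - a i \<in> loc (- {i})"
  have "w - a i \<in> loc (- {j})" if "j \<noteq> i" for j
  proof -
    have "w \<in> loc (- {j})" using w by (intro S_loc) (simp add: Apery_def)
    then show ?thesis using loc_unit[of i "- {j}" w "-1"] that by (simp flip: vector_sneg_minus1)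
  qed
  then have "w - a i \<in> S" using i S_iff_loc by metis
  then show False using w by (auto simp: Apery_def)
qed

text \<open>Within its coset of the lattice of rays, an Apery element is the least member of
  \<open>S\<close>: if \<open>f i\<close> were negative, adding back all but one of the subtracted
  copies of \<open>a i\<close> would place \<open>w - a i\<close> into
  \<open>loc (- {i})\<close>.\<close>

lemma Apery_congruent_le:
  assumes w: "w \<in> Apery S (range a)" and w': "w + (\<Sum>i\<in>UNIV. f i *s a i) \<in> S"
  shows "0 \<le> f i"
proof (rule ccontr)
  assume f: "\<not> 0 \<le> f i"
  have eq: "(\<Sum>j\<in>UNIV. f j *s a j) = f i *s a i + (\<Sum>j\<in>- {i}. f j *s a j)"
    by (simp add: sum.remove[of UNIV i] Compl_eq_Diff_UNIV)
  have "w + f i *s a i \<in> loc (- {i})" using w' by (intro locI[of _ "f"]) (simp add: eq add.assoc)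
  moreover have "(- f i - 1) *s a i \<in> S" using lattice_S[of "{i}" "\<lambda>_. - f i - 1"] f by simp
  ultimately have "w + f i *s a i + (- f i - 1) *s a i \<in> loc (- {i})" by (rule loc_add)
  moreover have "w + f i *s a i + (- f i - 1) *s a i = w - a i"
    by (simp add: vector_sub_rdistrib vector_smult_lneg)
  ultimately show False using Apery_not_loc[OF w] by metis
qed

text \<open>The scaled coordinates modulo \<open>M\<close> determine the coset of the lattice of
  rays, and two Apery elements of one coset coincide because each is least in it.\<close>

lemma finite_Apery: "finite (Apery S (range a))"
proof -
  obtain M :: nat where M: "M > 0" "\<And>v i. of_nat M * coord i v = of_int \<lfloor>of_nat M * coord i v\<rfloor>"
    by (rule multiple_in_lattice) (rule that)
  define \<phi> where "\<phi> v = (\<lambda>i. \<lfloor>of_nat M * coord i v\<rfloor> mod int M)" for v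
  have "inj_on \<phi> (Apery S (range a))"
  proof (rule inj_onI)
    fix w w' assume w: "w \<in> Apery S (range a)" and w': "w' \<in> Apery S (range a)" and eq: "\<phi> w = \<phi> w'"
    have "int M dvd \<lfloor>of_nat M * coord i w'\<rfloor> - \<lfloor>of_nat M * coord i w\<rfloor>" for i
      using fun_cong[OF eq, of i] by (simp add: \<phi>_def mod_eq_dvd_iff[symmetric])
    then obtain f where f: "\<And>i. \<lfloor>of_nat M * coord i w'\<rfloor> - \<lfloor>of_nat M * coord i w\<rfloor> = int M * f i"
      unfolding dvd_def by metis
    have "of_nat M * (coord i w' - coord i w) = of_nat M * of_int (f i)" for i
    proof -
      have "of_nat M * (coord i w' - coord i w) = of_int (\<lfloor>of_nat M * coord i w'\<rfloor> - \<lfloor>of_nat M * coord i w\<rfloor>)"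
        using M(2)[of i w] M(2)[of i w'] by (simp add: algebra_simps)
      then show ?thesis unfolding f by simp
    qed
    then have "coord i w' - coord i w = of_int (f i)" for i using M(1) by simp
    then have "w' - w - (\<Sum>i\<in>UNIV. f i *s a i) = 0"
      by (intro coord_eq_0) (simp add: coord_diff coord_combination)
    then have w'_eq: "w' = w + (\<Sum>i\<in>UNIV. f i *s a i)" by (simp add: algebra_simps)
    have "0 \<le> f i" for i using Apery_congruent_le[OF w] w' w'_eq by (simp add: Apery_def)
    moreover have "w' + (\<Sum>i\<in>UNIV. (- f i) *s a i) = w"
      by (simp add: w'_eq vector_smult_lneg sum_negf)
    then have "0 \<le> - f i" for i using Apery_congruent_le[OF w', of "\<lambda>i. - f i"] w by (simp add: Apery_def)
    ultimately have "f i = 0" for i by (metis antisym neg_0_le_iff_le)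
    then show "w = w'" using w'_eq by simp
  qed
  moreover have "\<phi> ` Apery S (range a) \<subseteq> (\<Pi>\<^sub>E i\<in>UNIV. {0..<int M})" using M(1) by (auto simp: \<phi>_def)
  then have "finite (\<phi> ` Apery S (range a))" by (rule finite_subset) (simp add: finite_PiE)
  ultimately show ?thesis by (metis finite_imageD)
qed

lemma below_maximal:
  assumes "w \<in> Apery S (range a)"
  shows "\<exists>m\<in>maximal_elements (semigroup_le S) (Apery S (range a)). m - w \<in> S"
proof -
  define X where "X = {m \<in> Apery S (range a). m - w \<in> S}"
  have X: "finite X" "w \<in> X" using assms finite_Apery S_zero by (auto simp: X_def)
  obtain m where m: "m \<in> X" "\<And>x. x \<in> X \<Longrightarrow> x - m \<in> S \<Longrightarrow> x = m"
  proof -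
    \<comment> \<open>The coordinate sum grows strictly along the order, as elements of
      \<open>S\<close> have nonnegative entries; so an element with the largest sum is
      maximal.\<close>
    define t where "t v = (\<Sum>i\<in>UNIV. v $ i)" for v :: "int ^ 'd"
    have "Max (t ` X) \<in> t ` X" using X by (intro Max_in) auto
    then obtain m where m: "m \<in> X" "t m = Max (t ` X)" by auto
    have "x = m" if x: "x \<in> X" "x - m \<in> S" for x
    proof -
      have "t x \<le> t m" using X x m(2) by simp
      then have "(\<Sum>i\<in>UNIV. (x - m) $ i) \<le> 0" by (simp add: t_def sum_subtractf)
      moreover have "\<And>i. 0 \<le> (x - m) $ i" using nonneg[OF x(2)] .
      ultimately have "\<forall>i\<in>UNIV. (x - m) $ i = 0"
        using sum_nonneg_eq_0_iff[of UNIV "\<lambda>i. (x - m) $ i"] by (metis antisym finite sum_nonneg)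
      then show ?thesis by (simp add: vec_eq_iff)
    qed
    then show ?thesis using that m(1) by blast
  qed
  have "x = m" if "x \<in> Apery S (range a)" "x - m \<in> S" for x
  proof -
    have "x - w \<in> S" using S_add[OF that(2), of "m - w"] m(1) by (simp add: X_def)
    then show ?thesis using that m(2) by (simp add: X_def)
  qed
  then show ?thesis using m(1) by (auto simp: maximal_elements_def semigroup_le_def X_def)
qed

lemma omega_octant: "omega S a = uminus ` octant UNIV"
proof
  show "omega S a \<subseteq> uminus ` octant UNIV"
  proof
    fix z assume "z \<in> omega S a"
    then obtain m s where m: "m \<in> Apery S (range a)" and s: "s \<in> S"
      and z: "z = - (m - (\<Sum>i\<in>UNIV. a i)) + s"
      by (auto simp: omega_def QF_def maximal_elements_def)
    have "- z \<notin> loc (- {i})" for i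
    proof
      assume "- z \<in> loc (- {i})"
      then have "- z + s \<in> loc (- {i})" using s by (rule loc_add)
      \<comment> \<open>All rays except \<open>a i\<close> are invertible in
        \<open>loc (- {i})\<close>, so of the full sum of rays only \<open>a i\<close> has to be
        kept.\<close>
      moreover have "- z + s = m - a i + (\<Sum>j\<in>- {i}. (- 1) *s a j)"
        by (simp add: z sum.remove[of UNIV i] Compl_eq_Diff_UNIV sum_negf vector_smult_lneg)
      ultimately have "m - a i \<in> loc (- {i})"
        using loc_shift[of "m - a i" "\<lambda>_. - 1" "- {i}"] by metis
      then show False using Apery_not_loc[OF m] by blast
    qed
    moreover have "- z \<in> loc UNIV"
    proof -
      have "m \<in> loc UNIV" "(\<Sum>i\<in>UNIV. a i) + s \<in> loc UNIV"
        using m s by (auto intro!: S_loc S_add S_sum a_S simp: Apery_def)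
      then have "m + - ((\<Sum>i\<in>UNIV. a i) + s) \<in> loc UNIV" by (metis loc_UNIV_add loc_UNIV_uminus)
      moreover have "- z = m + - ((\<Sum>i\<in>UNIV. a i) + s)" by (simp add: z algebra_simps)
      ultimately show ?thesis by simp
    qed
    ultimately have "- z \<in> octant UNIV" by (simp add: octant_def)
    then show "z \<in> uminus ` octant UNIV" by force
  qed
next
  show "uminus ` octant UNIV \<subseteq> omega S a"
  proof
    fix z assume "z \<in> uminus ` octant UNIV"
    then have z: "- z \<in> loc UNIV" "\<And>i. - z \<notin> loc (- {i})" by (auto simp: octant_def)
    have "\<exists>N. - z + int N *s a i \<in> loc (- {i})" for i
    proof -
      have "insert i (- {i}) = UNIV" by auto
      then show ?thesis using loc_large_multiple[of "- z" i "- {i}"] z(1) by (metis ComplD insertI1 order_refl)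
    qed
    \<comment> \<open>The first multiple of \<open>a i\<close> that carries \<open>- z\<close> into
      \<open>loc (- {i})\<close>. Adding these multiples for all \<open>i\<close> gives an element
      of \<open>S\<close>, and by minimality it leaves \<open>S\<close> as soon as one ray is
      subtracted, so it is an Apery element.\<close>
    then have *: "\<exists>N. - z + int N *s a i \<in> loc (- {i}) \<and> (\<forall>N'<N. - z + int N' *s a i \<notin> loc (- {i}))" for i
      using exists_least_iff[of "\<lambda>N. - z + int N *s a i \<in> loc (- {i})"] by blast
    from choice[OF allI[of "\<lambda>i. \<exists>N. - z + int N *s a i \<in> loc (- {i}) \<and>
        (\<forall>N'<N. - z + int N' *s a i \<notin> loc (- {i}))", OF *]]
    obtain N where N: "\<And>i. - z + int (N i) *s a i \<in> loc (- {i})"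
        "\<And>i N'. N' < N i \<Longrightarrow> - z + int N' *s a i \<notin> loc (- {i})"
      by blast
    have N_pos: "N i > 0" for i using N(1)[of i] z(2)[of i] by (cases "N i = 0") auto
    define w where "w = - z + (\<Sum>i\<in>UNIV. int (N i) *s a i)"
    have split: "w = - z + int (N i) *s a i + (\<Sum>j\<in>- {i}. int (N j) *s a j)" for i
      by (simp add: w_def sum.remove[of UNIV i] Compl_eq_Diff_UNIV add.assoc)
    have "w \<in> loc (- {i})" for i unfolding split[of i] using N(1) by (simp add: loc_shift)
    then have "w \<in> S" using S_iff_loc by blast
    moreover have "w - a i \<notin> S" for i
    proof
      assume "w - a i \<in> S"
      then have "w - a i \<in> loc (- {i})" by (rule S_loc)
      moreover have "w - a i = - z + int (N i - 1) *s a i + (\<Sum>j\<in>- {i}. int (N j) *s a j)"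
        using N_pos[of i] by (simp add: split[of i] of_nat_diff vector_sub_rdistrib)
      ultimately have "- z + int (N i - 1) *s a i \<in> loc (- {i})" by (simp add: loc_shift)
      then show False using N(2)[of "N i - 1" i] N_pos[of i] by simp
    qed
    ultimately have "w \<in> Apery S (range a)" by (auto simp: Apery_def)
    then obtain m where m: "m \<in> maximal_elements (semigroup_le S) (Apery S (range a))" "m - w \<in> S"
      using below_maximal by blast
    \<comment> \<open>Every \<open>N i\<close> is positive, so one copy of each ray can be split
      off; it turns the maximal element \<open>m\<close> into the quasi-Frobenius element
      \<open>m - \<Sum> a_i\<close>.\<close>
    define s where "s = (m - w) + (\<Sum>i\<in>UNIV. (int (N i) - 1) *s a i)"
    have "s \<in> S" unfolding s_def using m(2) N_pos
      by (intro S_add lattice_S) (simp_all add: Suc_le_eq)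
    moreover have "z = - (m - (\<Sum>i\<in>UNIV. a i)) + s"
      by (simp add: s_def w_def vector_sub_rdistrib sum_subtractf)
    moreover have "m - (\<Sum>i\<in>UNIV. a i) \<in> QF S a" using m(1) by (auto simp: QF_def)
    ultimately show "z \<in> omega S a" unfolding omega_def by blast
  qed
qed

end
end

section \<open>Koszul complexes\<close>

text \<open>The semigroup ring is a subset of the group algebra, so the Koszul computations use the
  operations of the ambient type and only track closure.\<close>

locale subring_set =
  fixes B :: "'r::comm_ring_1 set"
  assumes B_1 [intro, simp]: "1 \<in> B" and B_add [intro]: "x \<in> B \<Longrightarrow> y \<in> B \<Longrightarrow> x + y \<in> B"
    and B_uminus [intro]: "x \<in> B \<Longrightarrow> - x \<in> B" and B_mult [intro]: "x \<in> B \<Longrightarrow> y \<in> B \<Longrightarrow> x * y \<in> B"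
begin

lemma B_diff [intro]: "x \<in> B \<Longrightarrow> y \<in> B \<Longrightarrow> x - y \<in> B"
  using B_add[of x "- y"] by auto

lemma B_0 [intro, simp]: "0 \<in> B"
  using B_diff[of 1 1] by simp

lemma B_sum [intro]: "(\<And>x. x \<in> X \<Longrightarrow> f x \<in> B) \<Longrightarrow> sum f X \<in> B"
  by (induction X rule: infinite_finite_induct) auto

lemma B_power [intro]: "x \<in> B \<Longrightarrow> x ^ n \<in> B"
  by (induction n) auto

lemma B_of_nat [intro, simp]: "of_nat n \<in> B"
  by (induction n) auto

definition ideal_set :: "'r set \<Rightarrow> bool" where
  "ideal_set J \<longleftrightarrow> J \<subseteq> B \<and> 0 \<in> J \<and> (\<forall>x\<in>J. \<forall>y\<in>J. x + y \<in> J) \<and> (\<forall>r\<in>B. \<forall>x\<in>J. r * x \<in> J)"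

lemma ideal_setD:
  assumes "ideal_set J"
  shows "x \<in> J \<Longrightarrow> x \<in> B" "0 \<in> J" "x \<in> J \<Longrightarrow> y \<in> J \<Longrightarrow> x + y \<in> J" "r \<in> B \<Longrightarrow> x \<in> J \<Longrightarrow> r * x \<in> J"
    "x \<in> J \<Longrightarrow> - x \<in> J" "x \<in> J \<Longrightarrow> y \<in> J \<Longrightarrow> x - y \<in> J"
proof -
  have add: "x + y \<in> J" if "x \<in> J" "y \<in> J" for x y using assms that by (simp add: ideal_set_def)
  have mult: "r * x \<in> J" if "r \<in> B" "x \<in> J" for r x using assms that by (simp add: ideal_set_def)
  have um: "- x \<in> J" if "x \<in> J" for x using mult[of "- 1" x] that by auto
  show "x \<in> J \<Longrightarrow> x \<in> B" "0 \<in> J" using assms by (auto simp: ideal_set_def)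
  show "x \<in> J \<Longrightarrow> y \<in> J \<Longrightarrow> x + y \<in> J" by (rule add)
  show "r \<in> B \<Longrightarrow> x \<in> J \<Longrightarrow> r * x \<in> J" by (rule mult)
  show "x \<in> J \<Longrightarrow> - x \<in> J" by (rule um)
  show "x \<in> J \<Longrightarrow> y \<in> J \<Longrightarrow> x - y \<in> J" using add[of x "- y"] um by simp
qed

lemma ideal_set_sum: "ideal_set J \<Longrightarrow> (\<And>x. x \<in> X \<Longrightarrow> f x \<in> J) \<Longrightarrow> sum f X \<in> J"
  by (induction X rule: infinite_finite_induct) (auto intro: ideal_setD)

lemma radical_add:
  assumes J: "ideal_set J" and f: "f \<in> B" "f ^ N \<in> J" and g: "g \<in> B" "g ^ M \<in> J"
  shows "(f + g) ^ (N + M) \<in> J"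
proof -
  \<comment> \<open>In every binomial term either \<open>f\<close> has exponent at least
    \<open>N\<close> or \<open>g\<close> has exponent at least \<open>M\<close>.\<close>
  have "of_nat (N + M choose k) * f ^ k * g ^ (N + M - k) \<in> J" for k
  proof (cases "N \<le> k")
    case True
    then have "f ^ k = f ^ (k - N) * f ^ N" by (simp flip: power_add)
    then have "of_nat (N + M choose k) * f ^ k * g ^ (N + M - k)
        = (of_nat (N + M choose k) * f ^ (k - N) * g ^ (N + M - k)) * f ^ N" by (simp add: mult_ac)
    then show ?thesis using J f g by (auto intro!: ideal_setD(4)[OF J])
  next
    case False
    then have "g ^ (N + M - k) = g ^ (N - k) * g ^ M" by (simp flip: power_add)
    then have "of_nat (N + M choose k) * f ^ k * g ^ (N + M - k)
        = (of_nat (N + M choose k) * f ^ k * g ^ (N - k)) * g ^ M" by (simp add: mult_ac)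
    then show ?thesis using J f g by (auto intro!: ideal_setD(4)[OF J])
  qed
  then show ?thesis unfolding binomial_ring by (intro ideal_set_sum[OF J])
qed

lemma radical_sum:
  assumes J: "ideal_set J" and X: "finite X" and f: "\<And>x. x \<in> X \<Longrightarrow> f x \<in> B \<and> (\<exists>N. f x ^ N \<in> J)"
  shows "\<exists>N. sum f X ^ N \<in> J"
  using X f
proof (induction X rule: finite_induct)
  case empty
  have "(0 :: 'r) ^ 1 \<in> J" using J by (simp add: ideal_setD)
  then show ?case unfolding sum.empty by blast
next
  case (insert x X)
  then obtain N M where "f x ^ N \<in> J" "sum f X ^ M \<in> J" by (meson insertI1 insertI2)
  then have "(f x + sum f X) ^ (N + M) \<in> J" using insert.prems by (intro radical_add[OF J]) auto
  then show ?case using insert.hyps by auto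
qed

end

text \<open>The exterior algebra sign: the number of basis vectors that the \<open>i\<close>-th one
  must pass to reach its place among those indexed by \<open>I\<close>.\<close>

definition kosign :: "nat \<Rightarrow> nat set \<Rightarrow> 'r::comm_ring_1" where
  "kosign i I = (- 1) ^ card {j \<in> I. j < i}"

lemma kosign_remove:
  assumes "finite I"
  shows "kosign i (I - {k}) = (if k \<in> I \<and> k < i then - kosign i I else (kosign i I :: 'r::comm_ring_1))"
proof (cases "k \<in> I \<and> k < i")
  case True
  then have "{j \<in> I. j < i} = insert k {j \<in> I - {k}. j < i}" by auto
  then have "card {j \<in> I. j < i} = Suc (card {j \<in> I - {k}. j < i})"
    using assms by (metis (no_types, lifting) card_insert_disjoint finite_Diff finite_subset DiffE
        Collect_mem_eq Collect_mono insertI1 mem_Collect_eq)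
  then show ?thesis using True by (simp add: kosign_def)
next
  case False
  then have "{j \<in> I - {k}. j < i} = {j \<in> I. j < i}" by auto
  then show ?thesis using False by (auto simp: kosign_def)
qed

lemma kosign_insert:
  assumes "finite I" "k \<notin> I"
  shows "kosign i (insert k I) = (if k < i then - kosign i I else (kosign i I :: 'r::comm_ring_1))"
  using kosign_remove[where 'r = 'r, of "insert k I" i k] assms by (simp split: if_splits)

lemma kosign_square: "kosign i I * kosign i I = (1 :: 'r::comm_ring_1)"
  by (simp add: kosign_def flip: power_mult_distrib)

text \<open>Exterior multiplication by \<open>\<Sum> x_i e_i\<close>; the element \<open>b\<close>
  is given by its coefficients at the exterior monomials, which are indexed by sets.\<close>

definition koszul :: "(nat \<Rightarrow> 'r::comm_ring_1) \<Rightarrow> (nat set \<Rightarrow> 'r) \<Rightarrow> nat set \<Rightarrow> 'r" where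
  "koszul x b I = (\<Sum>i\<in>I. kosign i I * x i * b (I - {i}))"

text \<open>The terms of the pairs \<open>(i, j)\<close> and \<open>(j, i)\<close> cancel: removing
  the smaller index first flips the sign of the larger one, while the other order changes
  nothing.\<close>

lemma koszul_koszul:
  assumes I: "finite I" shows "koszul x (koszul x e) I = 0"
proof -
  define t where "t = (\<lambda>(i, j). kosign i I * kosign j (I - {i}) * x i * x j * e (I - {i} - {j}))"
  define P where "P = {(i, j). i \<in> I \<and> j \<in> I \<and> i < j}"
  define P' where "P' = {(i, j). i \<in> I \<and> j \<in> I \<and> j < i}"
  have P: "finite P" "finite P'" using I by (auto simp: P_def P'_def intro: finite_subset[of _ "I \<times> I"])
  have "koszul x (koszul x e) I = (\<Sum>i\<in>I. \<Sum>j\<in>I - {i}. t (i, j))"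
    by (simp add: koszul_def t_def sum_distrib_left mult_ac)
  also have "\<dots> = sum t (SIGMA i:I. I - {i})" using I by (subst sum.Sigma) auto
  also have "(SIGMA i:I. I - {i}) = P \<union> P'" by (auto simp: P_def P'_def)
  also have "sum t (P \<union> P') = sum t P + sum t P'"
    using P by (intro sum.union_disjoint) (auto simp: P_def P'_def)
  also have "sum t P' = sum (t \<circ> prod.swap) P"
    by (rule sum.reindex_cong[of prod.swap]) (auto simp: P_def P'_def inj_on_def image_iff)
  also have "sum t P + sum (t \<circ> prod.swap) P = (\<Sum>p\<in>P. t p + t (prod.swap p))"
    by (simp add: sum.distrib)
  also have "\<dots> = 0"
  proof (rule sum.neutral, rule ballI)
    fix p assume "p \<in> P"
    then obtain i j where p: "p = (i, j)" "i \<in> I" "j \<in> I" "i < j" by (auto simp: P_def)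
    have "I - {j} - {i} = I - {i} - {j}" by blast
    then show "t p + t (prod.swap p) = 0"
      using p I by (simp add: t_def kosign_remove mult_ac)
  qed
  finally show ?thesis .
qed

locale koszul_complex = subring_set B for B :: "'r::comm_ring_1 set" +
  fixes x :: "nat \<Rightarrow> 'r" and d :: nat
  assumes x_B: "k < d \<Longrightarrow> x k \<in> B"
begin

text \<open>Only the values on sets of size \<open>i\<close> count. Cohomology with coefficients in
  \<open>B / J\<close> is expressed by representatives in \<open>B\<close>, with equations replaced
  by membership in \<open>J\<close>.\<close>

definition kcochain :: "nat \<Rightarrow> (nat set \<Rightarrow> 'r) set" where
  "kcochain i = {c. \<forall>I\<subseteq>{..<d}. card I = i \<longrightarrow> c I \<in> B}"

definition kcocycle :: "'r set \<Rightarrow> nat \<Rightarrow> (nat set \<Rightarrow> 'r) set" where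
  "kcocycle J i = {c \<in> kcochain i. \<forall>I\<subseteq>{..<d}. card I = Suc i \<longrightarrow> koszul x c I \<in> J}"

text \<open>In degree 0 any \<open>b\<close> may be used, because \<open>koszul x b {}\<close> is an
  empty sum and the condition reduces to \<open>c {} \<in> J\<close>.\<close>

definition kboundary :: "'r set \<Rightarrow> nat \<Rightarrow> (nat set \<Rightarrow> 'r) set" where
  "kboundary J i = {c. \<exists>b. (\<forall>i'. i = Suc i' \<longrightarrow> b \<in> kcochain i') \<and>
     (\<forall>I\<subseteq>{..<d}. card I = i \<longrightarrow> c I - koszul x b I \<in> J)}"

lemma kosign_B [simp]: "kosign i I \<in> B"
  unfolding kosign_def by (intro B_power B_uminus B_1)

lemma koszul_B:
  assumes b: "b \<in> kcochain i" and I: "I \<subseteq> {..<d}" "card I = Suc i"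
  shows "koszul x b I \<in> B"
proof -
  have "finite I" using I finite_subset by blast
  then have "b (I - {k}) \<in> B" if "k \<in> I" for k
    using b I that by (auto simp: kcochain_def dest!: spec[of _ "I - {k}"])
  then show ?thesis unfolding koszul_def using I by (auto intro!: B_sum B_mult x_B)
qed

lemma koszul_linear:
  "koszul x (\<lambda>I. r * b I + r' * b' I) I = r * koszul x b I + r' * koszul x b' I"
  by (simp add: koszul_def sum_distrib_left algebra_simps sum.distrib)

lemma kboundary_combination:
  assumes J: "ideal_set J" and r: "r \<in> B" "r' \<in> B" and c: "c \<in> kboundary J i" "c' \<in> kboundary J i"
  shows "(\<lambda>I. r * c I + r' * c' I) \<in> kboundary J i"
proof -
  obtain b b' where b: "\<And>i'. i = Suc i' \<Longrightarrow> b \<in> kcochain i'" "\<And>I. I \<subseteq> {..<d} \<Longrightarrow> card I = i \<Longrightarrow> c I - koszul x b I \<in> J"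
    and b': "\<And>i'. i = Suc i' \<Longrightarrow> b' \<in> kcochain i'" "\<And>I. I \<subseteq> {..<d} \<Longrightarrow> card I = i \<Longrightarrow> c' I - koszul x b' I \<in> J"
    using c by (auto simp: kboundary_def)
  define e where "e = (\<lambda>I. r * b I + r' * b' I)"
  have "e \<in> kcochain i'" if "i = Suc i'" for i'
    using b(1)[OF that] b'(1)[OF that] r by (auto simp: e_def kcochain_def)
  moreover have "r * c I + r' * c' I - koszul x e I \<in> J" if "I \<subseteq> {..<d}" "card I = i" for I
  proof -
    have "r * c I + r' * c' I - koszul x e I = r * (c I - koszul x b I) + r' * (c' I - koszul x b' I)"
      by (simp add: e_def koszul_linear algebra_simps)
    then show ?thesis using b(2)[OF that] b'(2)[OF that] r J by (auto intro!: ideal_setD(3,4)[OF J])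
  qed
  ultimately show ?thesis by (auto simp: kboundary_def)
qed

text \<open>Contraction with the \<open>k\<close>-th basis vector is a homotopy between multiplication by \<open>x k\<close> and \<open>0\<close>.\<close>

lemma homotopy:
  assumes J: "ideal_set J" and k: "k < d" and c: "c \<in> kcocycle J i"
  shows "(\<lambda>I. x k * c I) \<in> kboundary J i"
proof -
  define h where "h I = (if k \<in> I then 0 else kosign k I * c (insert k I))" for I
  have cB: "c I \<in> B" if "I \<subseteq> {..<d}" "card I = i" for I
    using c that by (auto simp: kcocycle_def kcochain_def)
  have "h \<in> kcochain i'" if i: "i = Suc i'" for i'
  proof -
    have "h I \<in> B" if I: "I \<subseteq> {..<d}" "card I = i'" for I
    proof -
      have "finite I" using I finite_subset by blast
      then show ?thesis using I i k by (auto simp: h_def intro!: B_mult cB)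
    qed
    then show ?thesis by (simp add: kcochain_def)
  qed
  moreover have "x k * c I - koszul x h I \<in> J" if I: "I \<subseteq> {..<d}" "card I = i" for I
  proof -
    have fin: "finite I" using I finite_subset by blast
    show ?thesis
    \<comment> \<open>If \<open>k \<in> I\<close>, then \<open>h\<close> vanishes on all
      \<open>I - {j}\<close> with \<open>j \<noteq> k\<close> and a single term remains. Otherwise
      the identity is the cocycle condition at \<open>insert k I\<close>, solved for the term of
      \<open>k\<close>.\<close>
    proof (cases "k \<in> I")
      case True
      have "koszul x h I = (\<Sum>j\<in>I. if j = k then kosign k I * x k * h (I - {k}) else 0)"
        unfolding koszul_def using True by (intro sum.cong) (auto simp: h_def)
      also have "\<dots> = kosign k I * x k * (kosign k (I - {k}) * c (insert k I))"
        using True fin by (simp add: h_def)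
      also have "\<dots> = (kosign k I * kosign k I) * x k * c I"
        using True fin by (simp add: kosign_remove insert_absorb mult_ac)
      finally show ?thesis using J by (simp add: kosign_square ideal_setD)
    next
      case False
      have "koszul x c (insert k I) \<in> J"
        using c I fin False k by (simp add: kcocycle_def)
      then have "kosign k I * koszul x c (insert k I) \<in> J" by (rule ideal_setD(4)[OF J kosign_B])
      moreover have "x k * c I - koszul x h I = kosign k I * koszul x c (insert k I)"
      proof -
        have *: "kosign k I * (kosign j (insert k I) * x j * c (insert k I - {j}))
            = - (kosign j I * x j * h (I - {j}))" if j: "j \<in> I" for j
        proof -
          have "insert k (I - {j}) = insert k I - {j}" "j \<noteq> k" using j False by auto
          then show ?thesis using fin False j
            by (auto simp: h_def kosign_insert kosign_remove mult_ac)
        qed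
        have "kosign k I * koszul x c (insert k I)
            = kosign k I * (kosign k (insert k I) * x k * c I)
              + (\<Sum>j\<in>I. kosign k I * (kosign j (insert k I) * x j * c (insert k I - {j})))"
          using fin False by (simp add: koszul_def algebra_simps sum_distrib_left)
        also have "(\<Sum>j\<in>I. kosign k I * (kosign j (insert k I) * x j * c (insert k I - {j}))) = - koszul x h I"
          unfolding koszul_def sum_negf[symmetric] using * by (intro sum.cong) auto
        also have "kosign k I * (kosign k (insert k I) * x k * c I) = (kosign k I * kosign k I) * x k * c I"
          using fin False by (simp add: kosign_insert mult_ac)
        finally show ?thesis by (simp add: kosign_square)
      qed
      ultimately show ?thesis by simp
    qed
  qed
  ultimately show ?thesis by (auto simp: kboundary_def)
qed

definition xideal :: "'r set" where
  "xideal = {\<Sum>k<d. r k * x k | r. \<forall>k. r k \<in> B}"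

lemma ideal_set_xideal: "ideal_set xideal"
  unfolding ideal_set_def
proof (intro conjI ballI)
  show "xideal \<subseteq> B" by (auto simp: xideal_def intro!: B_sum B_mult x_B)
  show "0 \<in> xideal" unfolding xideal_def by (rule CollectI, rule exI[of _ "\<lambda>_. 0"]) simp
next
  fix f g assume "f \<in> xideal" "g \<in> xideal"
  then obtain r r' where r: "f = (\<Sum>k<d. r k * x k)" "g = (\<Sum>k<d. r' k * x k)" "\<forall>k. r k \<in> B" "\<forall>k. r' k \<in> B"
    by (auto simp: xideal_def)
  then have "f + g = (\<Sum>k<d. (r k + r' k) * x k)" by (simp add: algebra_simps sum.distrib)
  then show "f + g \<in> xideal" unfolding xideal_def using r by (intro CollectI exI[of _ "\<lambda>k. r k + r' k"]) auto
next
  fix q f assume q: "q \<in> B" and "f \<in> xideal"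
  then obtain r where r: "f = (\<Sum>k<d. r k * x k)" "\<forall>k. r k \<in> B"
    by (auto simp: xideal_def)
  then have "q * f = (\<Sum>k<d. (q * r k) * x k)" by (simp add: sum_distrib_left mult_ac)
  then show "q * f \<in> xideal" unfolding xideal_def using r q by (intro CollectI exI[of _ "\<lambda>k. q * r k"]) auto
qed

lemma xideal_mem: assumes "k < d" "r \<in> B" shows "r * x k \<in> xideal"
proof -
  have "(\<Sum>j<d. (if j = k then r else 0) * x j) = (\<Sum>j<d. if j = k then r * x k else 0)"
    by (intro sum.cong) auto
  then have "r * x k = (\<Sum>j<d. (if j = k then r else 0) * x j)" using assms by simp
  then show ?thesis unfolding xideal_def using assms
    by (intro CollectI exI[of _ "\<lambda>j. if j = k then r else 0"]) auto
qed

text \<open>By \<open>homotopy\<close> each \<open>x k\<close> annihilates the cohomology, and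
  boundaries are closed under combinations.\<close>

lemma xideal_annihilates:
  assumes J: "ideal_set J" and f: "f \<in> xideal" and c: "c \<in> kcocycle J i"
  shows "(\<lambda>I. f * c I) \<in> kboundary J i"
proof -
  obtain r where r: "f = (\<Sum>k<d. r k * x k)" "\<forall>k. r k \<in> B" using f by (auto simp: xideal_def)
  have "(\<lambda>I. (\<Sum>k<m. r k * x k) * c I) \<in> kboundary J i" if "m \<le> d" for m
    using that
  proof (induction m)
    case 0
    have "(\<lambda>I. 0 * (x k * c I) + 0 * (x k * c I)) \<in> kboundary J i" if "k < d" for k
      using homotopy[OF J that c] by (intro kboundary_combination[OF J]) auto
    moreover have "(\<lambda>_. 0) \<in> kboundary J i"
      unfolding kboundary_def using J
      by (intro CollectI exI[of _ "\<lambda>_. 0"]) (auto simp: koszul_def kcochain_def ideal_setD)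
    ultimately show ?case by simp
  next
    case (Suc m)
    then have "(\<lambda>I. 1 * ((\<Sum>k<m. r k * x k) * c I) + r m * (x m * c I)) \<in> kboundary J i"
      using r(2) homotopy[OF J _ c] by (intro kboundary_combination[OF J]) auto
    then show ?case by (simp add: algebra_simps)
  qed
  then show ?thesis using r(1) by auto
qed

definition kexact :: "'r set \<Rightarrow> nat \<Rightarrow> bool" where
  "kexact J i \<longleftrightarrow> kcocycle J i \<subseteq> kboundary J i"

text \<open>Injectivity of multiplication by \<open>f\<close> on the cohomology modulo \<open>J\<close>, by the connecting homomorphism of
  \<open>0 \<rightarrow> R/J \<rightarrow> R/J \<rightarrow> R/J' \<rightarrow> 0\<close>.\<close>

lemma kboundary_cancel:
  assumes J: "ideal_set J" and J': "J' = {j + r * f | j r. j \<in> J \<and> r \<in> B}" and f: "f \<in> B"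
    and regular: "\<And>r. r \<in> B \<Longrightarrow> f * r \<in> J \<Longrightarrow> r \<in> J"
    and IH: "\<And>i'. i = Suc i' \<Longrightarrow> kexact J' i'"
    and c: "c \<in> kcochain i" and fc: "(\<lambda>I. f * c I) \<in> kboundary J i"
  shows "c \<in> kboundary J i"
proof -
  obtain b where b: "\<And>i'. i = Suc i' \<Longrightarrow> b \<in> kcochain i'"
      "\<And>I. I \<subseteq> {..<d} \<Longrightarrow> card I = i \<Longrightarrow> f * c I - koszul x b I \<in> J"
    using fc by (auto simp: kboundary_def)
  have cB: "c I \<in> B" if "I \<subseteq> {..<d}" "card I = i" for I
    using c that by (auto simp: kcochain_def)
  show ?thesis
  proof (cases i)
    case 0
    have "c I \<in> J" if I: "I \<subseteq> {..<d}" "card I = i" for I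
    proof -
      have "I = {}" using I 0 finite_subset by fastforce
      then show ?thesis using b(2)[OF I] regular cB[OF I] by (simp add: koszul_def)
    qed
    moreover have "koszul x b I = 0" if I: "I \<subseteq> {..<d}" "card I = i" for I
    proof -
      have "I = {}" using I 0 finite_subset by fastforce
      then show ?thesis by (simp add: koszul_def)
    qed
    ultimately show ?thesis
      unfolding kboundary_def by (intro CollectI exI[of _ b]) (simp add: 0)
  next
    case (Suc i')
    have JJ': "J \<subseteq> J'"
    proof
      fix j assume "j \<in> J"
      moreover have "j = j + 0 * f" by simp
      ultimately show "j \<in> J'" unfolding J' by blast
    qed
    have bc: "b \<in> kcochain i'" using b(1) Suc by blast
    \<comment> \<open>Modulo \<open>J\<close>, \<open>koszul x b\<close> is the multiple
      \<open>f * c\<close>, so \<open>b\<close> is a cocycle modulo \<open>J'\<close>. Exactness one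
      degree lower writes \<open>b\<close> as a coboundary plus \<open>b1 * f\<close>, up to
      elements of \<open>J\<close>.\<close>
    have "b \<in> kcocycle J' i'"
    proof -
      have "koszul x b I \<in> J'" if I: "I \<subseteq> {..<d}" "card I = i" for I
      proof -
        have "koszul x b I = - (f * c I - koszul x b I) + c I * f" by (simp add: mult.commute)
        then show ?thesis unfolding J' using b(2)[OF I] cB[OF I] ideal_setD(5)[OF J] by blast
      qed
      then show ?thesis using bc Suc by (simp add: kcocycle_def)
    qed
    then have "b \<in> kboundary J' i'" using IH[OF Suc] by (auto simp: kexact_def)
    then obtain e where e: "\<And>i''. i' = Suc i'' \<Longrightarrow> e \<in> kcochain i''"
        "\<And>I. I \<subseteq> {..<d} \<Longrightarrow> card I = i' \<Longrightarrow> b I - koszul x e I \<in> J'"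
      by (auto simp: kboundary_def)
    have "\<exists>r. I \<subseteq> {..<d} \<longrightarrow> card I = i' \<longrightarrow> r \<in> B \<and> b I - koszul x e I - r * f \<in> J" for I
    proof (cases "I \<subseteq> {..<d} \<and> card I = i'")
      case True
      then obtain j r where "j \<in> J" "r \<in> B" "b I - koszul x e I = j + r * f" using e(2) J' by blast
      then show ?thesis by (intro exI[of _ r]) simp
    qed auto
    then obtain b1 where b1: "\<And>I. I \<subseteq> {..<d} \<Longrightarrow> card I = i' \<Longrightarrow> b1 I \<in> B"
        "\<And>I. I \<subseteq> {..<d} \<Longrightarrow> card I = i' \<Longrightarrow> b I - koszul x e I - b1 I * f \<in> J" by metis
    have b1c: "b1 \<in> kcochain i'" using b1 by (simp add: kcochain_def)
    \<comment> \<open>Applying the differential to the decomposition of \<open>b\<close> kills the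
      part from \<open>e\<close>. What remains says that \<open>f * (c - koszul x b1)\<close> lies
      in \<open>J\<close>, where \<open>f\<close> may be cancelled.\<close>
    have "c I - koszul x b1 I \<in> J" if I: "I \<subseteq> {..<d}" "card I = i" for I
    proof -
      have fin: "finite I" using I finite_subset by blast
      have "koszul x (\<lambda>I. b I - koszul x e I - b1 I * f) I \<in> J"
        unfolding koszul_def[of x _ I]
      proof (rule ideal_set_sum[OF J])
        fix j assume j: "j \<in> I"
        then have "I - {j} \<subseteq> {..<d}" "card (I - {j}) = i'" using I fin Suc by auto
        then show "kosign j I * x j * (b (I - {j}) - koszul x e (I - {j}) - b1 (I - {j}) * f) \<in> J"
          using b1(2) j I by (auto intro!: ideal_setD(4)[OF J] x_B)
      qed
      moreover have "koszul x (\<lambda>I. b I - koszul x e I - b1 I * f) I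
          = koszul x b I - koszul x (koszul x e) I - f * koszul x b1 I"
        by (simp add: koszul_def[of x _ I] algebra_simps sum_subtractf sum.distrib sum_distrib_left)
      ultimately have "koszul x b I - f * koszul x b1 I \<in> J" using koszul_koszul[OF fin, of x e] by simp
      then have "(f * c I - koszul x b I) + (koszul x b I - f * koszul x b1 I) \<in> J"
        using b(2)[OF I] ideal_setD(3)[OF J] by blast
      then have "f * (c I - koszul x b1 I) \<in> J" by (simp add: algebra_simps)
      moreover have "c I - koszul x b1 I \<in> B"
        using cB[OF I] koszul_B[OF b1c] I Suc by blast
      ultimately show ?thesis using regular by blast
    qed
    then show ?thesis using b1c Suc by (auto simp: kboundary_def)
  qed
qed

text \<open>A power of \<open>f\<close> lies in the ideal of the \<open>x k\<close> and so
  annihilates the cohomology modulo \<open>J\<close>, whereas \<open>f\<close> acts on it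
  injectively by \<open>kboundary_cancel\<close>. Hence the cohomology is zero.\<close>

lemma kexact_step:
  assumes J: "ideal_set J" and J': "J' = {j + r * f | j r. j \<in> J \<and> r \<in> B}" and f: "f \<in> B"
    and nilpotent: "f ^ N \<in> xideal"
    and regular: "\<And>r. r \<in> B \<Longrightarrow> f * r \<in> J \<Longrightarrow> r \<in> J"
    and IH: "\<And>i'. i = Suc i' \<Longrightarrow> kexact J' i'"
  shows "kexact J i"
  unfolding kexact_def
proof
  fix c assume c: "c \<in> kcocycle J i"
  have "(\<lambda>I. f ^ n * c I) \<in> kboundary J i \<Longrightarrow> c \<in> kboundary J i" for n
  proof (induction n)
    case (Suc n)
    have c1: "(\<lambda>I. f ^ n * c I) \<in> kcochain i" using c f by (auto simp: kcocycle_def kcochain_def)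
    have c2: "(\<lambda>I. f * (f ^ n * c I)) \<in> kboundary J i" using Suc.prems by (simp add: mult.assoc)
    have "(\<lambda>I. f ^ n * c I) \<in> kboundary J i"
      by (rule kboundary_cancel[OF J J' f _ _ c1 c2]) (metis regular IH)+
    then show ?case by (rule Suc.IH)
  qed simp
  then show "c \<in> kboundary J i" using xideal_annihilates[OF J nilpotent c] by blast
qed

end

section \<open>Semigroup rings\<close>

lemma poly_mapping_sum_single: "f = (\<Sum>k\<in>Poly_Mapping.keys f. Poly_Mapping.single k (Poly_Mapping.lookup f k))"
proof (rule poly_mapping_eqI)
  fix x
  have "(\<Sum>k\<in>Poly_Mapping.keys f. Poly_Mapping.lookup (Poly_Mapping.single k (Poly_Mapping.lookup f k)) x)
      = (\<Sum>k\<in>Poly_Mapping.keys f. if k = x then Poly_Mapping.lookup f x else 0)"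
    by (intro sum.cong) (auto simp: lookup_single when_def)
  then show "Poly_Mapping.lookup f x = Poly_Mapping.lookup (\<Sum>k\<in>Poly_Mapping.keys f. Poly_Mapping.single k (Poly_Mapping.lookup f k)) x"
    by (simp add: lookup_sum in_keys_iff)
qed

lemma lookup_single_times:
  fixes f :: "'g::ab_group_add \<Rightarrow>\<^sub>0 'k::comm_ring_1"
  shows "Poly_Mapping.lookup (Poly_Mapping.single g c * f) x = c * Poly_Mapping.lookup f (x - g)"
proof -
  have "Poly_Mapping.single g c * f = (\<Sum>k\<in>Poly_Mapping.keys f. Poly_Mapping.single (g + k) (c * Poly_Mapping.lookup f k))"
    by (subst poly_mapping_sum_single[of f]) (simp add: sum_distrib_left mult_single)
  then have "Poly_Mapping.lookup (Poly_Mapping.single g c * f) x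
      = (\<Sum>k\<in>Poly_Mapping.keys f. Poly_Mapping.lookup (Poly_Mapping.single (g + k) (c * Poly_Mapping.lookup f k)) x)"
    by (simp add: lookup_sum)
  also have "\<dots> = (\<Sum>k\<in>Poly_Mapping.keys f. if k = x - g then c * Poly_Mapping.lookup f (x - g) else 0)"
    by (intro sum.cong) (auto simp: lookup_single when_def)
  finally show ?thesis by (simp add: in_keys_iff)
qed

lemma lookup_times:
  fixes f h :: "'g::ab_group_add \<Rightarrow>\<^sub>0 'k::comm_ring_1"
  shows "Poly_Mapping.lookup (f * h) x = (\<Sum>p\<in>Poly_Mapping.keys f. Poly_Mapping.lookup f p * Poly_Mapping.lookup h (x - p))"
proof -
  have "f * h = (\<Sum>p\<in>Poly_Mapping.keys f. Poly_Mapping.single p (Poly_Mapping.lookup f p) * h)"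
    by (subst poly_mapping_sum_single[of f]) (simp add: sum_distrib_right)
  then show ?thesis by (simp add: lookup_sum lookup_single_times)
qed

lemma monomial_spanI: "(\<And>x. Poly_Mapping.lookup f x \<noteq> 0 \<Longrightarrow> x \<in> H) \<Longrightarrow> f \<in> monomial_span H"
  by (auto simp: monomial_span_def in_keys_iff)

lemma monomial_spanD: "f \<in> monomial_span H \<Longrightarrow> Poly_Mapping.lookup f x \<noteq> 0 \<Longrightarrow> x \<in> H"
  by (auto simp: monomial_span_def in_keys_iff)

lemma monomial_span_zero [simp]: "0 \<in> monomial_span H"
  by (simp add: monomial_span_def)

lemma monomial_span_add: "f \<in> monomial_span H \<Longrightarrow> h \<in> monomial_span H \<Longrightarrow> f + h \<in> monomial_span H"
  using keys_add[of f h] by (auto simp: monomial_span_def)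

lemma monomial_span_uminus: "f \<in> monomial_span H \<Longrightarrow> - f \<in> monomial_span H"
  by (auto intro!: monomial_spanI dest: monomial_spanD)

lemma monomial_span_times:
  fixes f h :: "'g::ab_group_add \<Rightarrow>\<^sub>0 'k::field"
  assumes "f \<in> monomial_span S" "h \<in> monomial_span H" "\<And>x y. x \<in> S \<Longrightarrow> y \<in> H \<Longrightarrow> x + y \<in> H'"
  shows "f * h \<in> monomial_span H'"
  using keys_mult[of f h] assms by (fastforce simp: monomial_span_def)

lemma monomial_span_sum: "(\<And>x. x \<in> X \<Longrightarrow> f x \<in> monomial_span H) \<Longrightarrow> sum f X \<in> monomial_span H"
  by (induction X rule: infinite_finite_induct) (auto simp: monomial_span_add)

lemma monomial_span_single: "c = 0 \<or> g \<in> H \<Longrightarrow> Poly_Mapping.single g c \<in> monomial_span H"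
  by (auto simp: monomial_span_def)

lemma monomial_span_mono: "H \<subseteq> H' \<Longrightarrow> monomial_span H \<subseteq> monomial_span H'"
  by (auto simp: monomial_span_def)

lemma monomial_span_singleton:
  "f \<in> monomial_span (H \<inter> {g}) \<Longrightarrow> f = Poly_Mapping.single g (Poly_Mapping.lookup f g)"
  by (rule poly_mapping_eqI) (auto simp: lookup_single when_def dest: monomial_spanD)

locale semigroup_algebra =
  fixes S :: "'g::ab_group_add set" and R :: "('g \<Rightarrow>\<^sub>0 'k::field) ring"
  assumes R: "R = semigroup_ring S"
    and S_zero: "0 \<in> S" and S_add: "x \<in> S \<Longrightarrow> y \<in> S \<Longrightarrow> x + y \<in> S"
    and cring_R: "cring R"
begin

lemma R_simps [simp]: "carrier R = monomial_span S" "mult R = (*)" "one R = 1" "zero R = 0" "add R = (+)"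
  by (simp_all add: R semigroup_ring_def)

sublocale subring_set "monomial_span S :: ('g \<Rightarrow>\<^sub>0 'k) set"
proof
  have "Poly_Mapping.single 0 1 \<in> (monomial_span S :: ('g \<Rightarrow>\<^sub>0 'k) set)"
    by (intro monomial_span_single) (simp add: S_zero)
  then show "1 \<in> (monomial_span S :: ('g \<Rightarrow>\<^sub>0 'k) set)" by simp
qed (auto intro: monomial_span_add monomial_span_uminus monomial_span_times S_add)

lemma ideal_iff: "ideal J R \<longleftrightarrow> ideal_set J"
proof
  interpret cring R by (rule cring_R)
  assume J: "ideal J R"
  interpret ideal J R by (rule J)
  show "ideal_set J"
    using a_subset zero_closed a_closed I_l_closed by (simp add: ideal_set_def)
next
  interpret cring R by (rule cring_R)
  assume J: "ideal_set J"
  have inv: "\<ominus>\<^bsub>R\<^esub> x = - x" if "x \<in> monomial_span S" for x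
    using that by (intro minus_equality) auto
  have right: "x * r \<in> J" if "x \<in> J" "r \<in> monomial_span S" for x r
    using ideal_setD(4)[OF J that(2,1)] by (simp add: mult.commute)
  show "ideal J R"
  proof (rule idealI)
    show "subgroup J (add_monoid R)"
    proof
      show "inv\<^bsub>add_monoid R\<^esub> x \<in> J" if "x \<in> J" for x
        using that ideal_setD(1,5)[OF J that] inv[of x] by (simp add: a_inv_def)
    qed (use ideal_setD[OF J] in auto)
  qed (use ideal_setD[OF J] right ring_axioms in auto)
qed

lemma genideal_insert:
  assumes Y: "Y \<subseteq> monomial_span S" and f: "f \<in> monomial_span S"
  shows "genideal R (insert f Y) = {j + r * f | j r. j \<in> genideal R Y \<and> r \<in> monomial_span S}" (is "_ = ?J'")
proof
  interpret cring R by (rule cring_R)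
  have J: "ideal_set (genideal R Y)" using genideal_ideal[of Y] Y by (simp add: ideal_iff)
  have J1: "ideal_set (genideal R (insert f Y))" using genideal_ideal[of "insert f Y"] Y f by (simp add: ideal_iff)
  have "ideal_set ?J'"
    unfolding ideal_set_def
  proof (intro conjI ballI)
    show "?J' \<subseteq> monomial_span S" using ideal_setD(1)[OF J] f by auto
    have "0 = 0 + 0 * f" by simp
    then show "0 \<in> ?J'" using ideal_setD(2)[OF J] B_0 by blast
  next
    fix u v assume "u \<in> ?J'" "v \<in> ?J'"
    then obtain j r j' r' where *: "u = j + r * f" "v = j' + r' * f" "j \<in> genideal R Y" "r \<in> monomial_span S"
      "j' \<in> genideal R Y" "r' \<in> monomial_span S" by blast
    then have "u + v = (j + j') + (r + r') * f" by (simp add: algebra_simps)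
    moreover have "j + j' \<in> genideal R Y" "r + r' \<in> monomial_span S" using * ideal_setD(3)[OF J] by auto
    ultimately show "u + v \<in> ?J'" by blast
  next
    fix q u :: "'g \<Rightarrow>\<^sub>0 'k" assume q: "q \<in> monomial_span S" and "u \<in> ?J'"
    then obtain j r where *: "u = j + r * f" "j \<in> genideal R Y" "r \<in> monomial_span S" by blast
    then have "q * u = q * j + (q * r) * f" by (simp add: algebra_simps)
    moreover have "q * j \<in> genideal R Y" "q * r \<in> monomial_span S" using * q ideal_setD(4)[OF J] by auto
    ultimately show "q * u \<in> ?J'" by blast
  qed
  moreover have "insert f Y \<subseteq> ?J'"
  proof -
    have "f = 0 + 1 * f" by simp
    then have "f \<in> ?J'" using ideal_setD(2)[OF J] B_1 by blast
    moreover have "y \<in> ?J'" if "y \<in> Y" for y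
    proof -
      have "y \<in> genideal R Y" using genideal_self[of Y] Y that by auto
      moreover have "y = y + 0 * f" by simp
      ultimately show ?thesis using B_0 by blast
    qed
    ultimately show ?thesis by blast
  qed
  ultimately show "genideal R (insert f Y) \<subseteq> ?J'"
    by (intro genideal_minimal) (simp_all add: ideal_iff)
  have "genideal R Y \<subseteq> genideal R (insert f Y)" using Y f by (intro subset_Idl_subset) auto
  moreover have "f \<in> genideal R (insert f Y)" using genideal_self[of "insert f Y"] Y f by auto
  ultimately show "?J' \<subseteq> genideal R (insert f Y)"
    using ideal_setD(3,4)[OF J1] by auto
qed

lemma genideal_empty: "genideal R {} = {0}"
proof -
  interpret cring R by (rule cring_R)
  have "genideal R {} \<subseteq> {0}" using genideal_minimal[of "{0}" "{}"] zeroideal by simp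
  moreover have "ideal_set (genideal R {})" using genideal_ideal[of "{}"] by (simp add: ideal_iff)
  ultimately show ?thesis using ideal_setD(2) by blast
qed

text \<open>Depth sensitivity of the Koszul complex. The induction trades cohomological degrees for
  members of the sequence: degree \<open>Suc i\<close> modulo the first \<open>k\<close> members is
  reduced to degree \<open>i\<close> modulo the first \<open>Suc k\<close>, which keeps the sum of
  the two numbers below the length.\<close>

lemma kexact_regular_sequence:
  assumes kc: "koszul_complex (monomial_span S) x d"
    and reg: "regular_sequence R xs"
    and nil: "\<And>f. f \<in> set xs \<Longrightarrow> \<exists>N. f ^ N \<in> koszul_complex.xideal (monomial_span S) x d"
    and i: "i < length xs"
  shows "koszul_complex.kexact (monomial_span S) x d {0} i"
proof -
  interpret kc: koszul_complex "monomial_span S" x d by (rule kc)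
  interpret cring R by (rule cring_R)
  have xs: "set xs \<subseteq> monomial_span S" using reg by (simp add: regular_sequence_def)
  have "kc.kexact (genideal R (set (take k xs))) i" if "i + k < length xs" for i k
    using that
  proof (induction i arbitrary: k)
    case 0
    show ?case
    proof (rule kc.kexact_step[where f = "xs ! k" and J' = "{j + r * xs ! k | j r.
        j \<in> genideal R (set (take k xs)) \<and> r \<in> monomial_span S}"])
      have tk: "set (take k xs) \<subseteq> monomial_span S" by (rule order_trans[OF set_take_subset xs])
      show "ideal_set (genideal R (set (take k xs)))" using genideal_ideal[of "set (take k xs)"] tk by (simp add: ideal_iff)
      show "xs ! k \<in> monomial_span S" using 0 xs by auto
      show "xs ! k ^ (SOME N. (xs ! k) ^ N \<in> kc.xideal) \<in> kc.xideal"
        by (rule someI_ex) (use nil 0 in auto)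
      show "r \<in> genideal R (set (take k xs))"
        if "r \<in> monomial_span S" "xs ! k * r \<in> genideal R (set (take k xs))" for r
        using reg that 0 by (auto simp: regular_sequence_def)
    qed simp_all
  next
    case (Suc i)
    have tk: "set (take k xs) \<subseteq> monomial_span S" by (rule order_trans[OF set_take_subset xs])
    have k: "k < length xs" "xs ! k \<in> monomial_span S" using Suc.prems xs by auto
    show ?case
    proof (rule kc.kexact_step[where f = "xs ! k" and J' = "genideal R (set (take (Suc k) xs))"])
      show "ideal_set (genideal R (set (take k xs)))" using genideal_ideal[of "set (take k xs)"] tk by (simp add: ideal_iff)
      show "xs ! k \<in> monomial_span S" by (rule k)
      show "xs ! k ^ (SOME N. (xs ! k) ^ N \<in> kc.xideal) \<in> kc.xideal"
        by (rule someI_ex) (use nil k in auto)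
      show "r \<in> genideal R (set (take k xs))"
        if "r \<in> monomial_span S" "xs ! k * r \<in> genideal R (set (take k xs))" for r
        using reg that k by (auto simp: regular_sequence_def)
      have "set (take (Suc k) xs) = insert (xs ! k) (set (take k xs))"
        using k by (simp add: take_Suc_conv_app_nth)
      then show "genideal R (set (take (Suc k) xs))
          = {j + r * xs ! k | j r. j \<in> genideal R (set (take k xs)) \<and> r \<in> monomial_span S}"
        using genideal_insert[OF tk k(2)] by simp
      show "kc.kexact (genideal R (set (take (Suc k) xs))) i'" if "Suc i = Suc i'" for i'
        using that Suc.IH[of "Suc k"] Suc.prems by simp
    qed
  qed
  from this[of i 0] show ?thesis using i by (simp add: genideal_empty)
qed

lemma monomial_ideal:
  assumes "H \<subseteq> S" "\<And>x y. x \<in> S \<Longrightarrow> y \<in> H \<Longrightarrow> x + y \<in> H"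
  shows "ideal_set (monomial_span H)"
  unfolding ideal_set_def
proof (intro conjI ballI)
  show "monomial_span H \<subseteq> (monomial_span S :: ('g \<Rightarrow>\<^sub>0 'k) set)" by (rule monomial_span_mono[OF assms(1)])
  show "r * f \<in> monomial_span H" if "r \<in> monomial_span S" "f \<in> monomial_span H" for r f :: "'g \<Rightarrow>\<^sub>0 'k"
    using that assms(2) by (rule monomial_span_times)
next
  show "f + h \<in> monomial_span H" if "f \<in> monomial_span H" "h \<in> monomial_span H" for f h :: "'g \<Rightarrow>\<^sub>0 'k"
    using that by (rule monomial_span_add)
qed (rule monomial_span_zero)

lemma maximal_monomial_ideal:
  assumes pointed: "\<And>x. x \<in> S \<Longrightarrow> - x \<in> S \<Longrightarrow> x = 0"
  shows "maximalideal (monomial_span (S - {0})) R"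
proof (rule maximalidealI)
  have nz: "x + y \<in> S - {0}" if "x \<in> S" "y \<in> S - {0}" for x y
    using that pointed[of y] S_add by (auto simp: add_eq_0_iff)
  then show "ideal (monomial_span (S - {0})) R" unfolding ideal_iff by (intro monomial_ideal) auto
  have "(1 :: 'g \<Rightarrow>\<^sub>0 'k) \<notin> monomial_span (S - {0})" by (auto simp: monomial_span_def)
  then show "carrier R \<noteq> monomial_span (S - {0})" using B_1 by auto
next
  fix J assume J: "ideal J R" "monomial_span (S - {0}) \<subseteq> J" "J \<subseteq> carrier R"
  then have JI: "ideal_set J" by (simp add: ideal_iff)
  show "J = monomial_span (S - {0}) \<or> J = carrier R"
  proof (cases "J \<subseteq> monomial_span (S - {0})")
    case False
    then obtain f where f: "f \<in> J" "f \<notin> monomial_span (S - {0})" by blast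
    define c where "c = Poly_Mapping.lookup f 0"
    have fS: "f \<in> monomial_span S" using f J by auto
    have c: "c \<noteq> 0"
    proof
      assume "c = 0"
      then have "f \<in> monomial_span (S - {0})"
        using fS by (intro monomial_spanI) (auto simp: c_def dest: monomial_spanD)
      then show False using f by simp
    qed
    \<comment> \<open>Up to the monomial ideal, \<open>f\<close> equals its nonzero constant term,
      so \<open>J\<close> contains a unit.\<close>
    have "f - Poly_Mapping.single 0 c \<in> monomial_span (S - {0})"
      using fS by (intro monomial_spanI) (auto simp: lookup_minus lookup_single when_def c_def dest: monomial_spanD split: if_splits)
    then have "f - (f - Poly_Mapping.single 0 c) \<in> J" using f J ideal_setD(6)[OF JI] by blast
    then have "Poly_Mapping.single 0 c \<in> J" by simp
    then have "Poly_Mapping.single 0 (1 / c) * Poly_Mapping.single 0 c \<in> J"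
      by (intro ideal_setD(4)[OF JI] monomial_span_single) (simp add: S_zero)
    then have "1 \<in> J" using c by (simp add: mult_single)
    then have "r \<in> J" if "r \<in> carrier R" for r using ideal_setD(4)[OF JI, of r 1] that by simp
    then show ?thesis using J(3) by blast
  qed (use J in blast)
qed

end

text \<open>Passing to the maxima in one coordinate after the other finds \<open>x\<close> and \<open>y\<close>.\<close>

lemma unique_sum:
  fixes X Y :: "(int ^ 'd) set"
  assumes X: "finite X" "X \<noteq> {}" and Y: "finite Y" "Y \<noteq> {}"
  shows "\<exists>x\<in>X. \<exists>y\<in>Y. \<forall>p\<in>X. \<forall>q\<in>Y. p + q = x + y \<longrightarrow> p = x"
proof -
  have "\<exists>X' Y'. X' \<subseteq> X \<and> Y' \<subseteq> Y \<and> X' \<noteq> {} \<and> Y' \<noteq> {} \<and> (\<forall>i\<in>I. \<forall>p\<in>X'. \<forall>p'\<in>X'. p $ i = p' $ i) \<and>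
      (\<forall>p\<in>X. \<forall>q\<in>Y. \<forall>x\<in>X'. \<forall>y\<in>Y'. p + q = x + y \<longrightarrow> p \<in> X' \<and> q \<in> Y')" for I :: "'d set"
    using finite[of I]
  proof (induction I rule: finite_induct)
    case empty
    then show ?case using X Y by (intro exI[of _ X] exI[of _ Y]) auto
  next
    case (insert i I)
    then obtain X' Y' where XY: "X' \<subseteq> X" "Y' \<subseteq> Y" "X' \<noteq> {}" "Y' \<noteq> {}"
      and const: "\<forall>i\<in>I. \<forall>p\<in>X'. \<forall>p'\<in>X'. p $ i = p' $ i"
      and dec': "\<forall>p\<in>X. \<forall>q\<in>Y. \<forall>x\<in>X'. \<forall>y\<in>Y'. p + q = x + y \<longrightarrow> p \<in> X' \<and> q \<in> Y'"
      by (elim exE conjE)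
    have dec: "p \<in> X' \<and> q \<in> Y'" if "p \<in> X" "q \<in> Y" "x \<in> X'" "y \<in> Y'" "p + q = x + y" for p q x y
      using dec' that by metis
    have fin: "finite X'" "finite Y'" using XY X Y finite_subset by auto
    define mx where "mx = Max ((\<lambda>p. p $ i) ` X')"
    define my where "my = Max ((\<lambda>p. p $ i) ` Y')"
    define X'' where "X'' = {p \<in> X'. p $ i = mx}"
    define Y'' where "Y'' = {p \<in> Y'. p $ i = my}"
    have mx: "p $ i \<le> mx" if "p \<in> X'" for p using fin that by (simp add: mx_def)
    have my: "p $ i \<le> my" if "p \<in> Y'" for p using fin that by (simp add: my_def)
    have "mx \<in> (\<lambda>p. p $ i) ` X'" "my \<in> (\<lambda>p. p $ i) ` Y'"
      unfolding mx_def my_def using fin XY by (auto intro!: Max_in)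
    then have ne: "X'' \<noteq> {}" "Y'' \<noteq> {}" by (auto simp: X''_def Y''_def)
    have "p \<in> X'' \<and> q \<in> Y''" if "p \<in> X" "q \<in> Y" "x \<in> X''" "y \<in> Y''" "p + q = x + y" for p q x y
    proof -
      have "p \<in> X'" "q \<in> Y'" using dec[of p q x y] that by (auto simp: X''_def Y''_def)
      moreover have "p $ i + q $ i = mx + my"
        using that(3,4) arg_cong[OF that(5), of "\<lambda>v. v $ i", unfolded vector_add_component]
        by (simp add: X''_def Y''_def)
      ultimately show ?thesis using mx[of p] my[of q] by (auto simp: X''_def Y''_def)
    qed
    then have "\<forall>p\<in>X. \<forall>q\<in>Y. \<forall>x\<in>X''. \<forall>y\<in>Y''. p + q = x + y \<longrightarrow> p \<in> X'' \<and> q \<in> Y''" by blast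
    moreover have "X'' \<subseteq> X" "Y'' \<subseteq> Y" using XY by (auto simp: X''_def Y''_def)
    moreover have "\<forall>j\<in>insert i I. \<forall>p\<in>X''. \<forall>p'\<in>X''. p $ j = p' $ j"
      using const by (simp add: X''_def)
    ultimately show ?case using ne by (intro exI[of _ X''] exI[of _ Y'']) (intro conjI)
  qed
  from this[of UNIV] obtain X' Y' where *: "X' \<subseteq> X" "Y' \<subseteq> Y" "X' \<noteq> {}" "Y' \<noteq> {}"
      "\<forall>i\<in>UNIV. \<forall>p\<in>X'. \<forall>p'\<in>X'. p $ i = p' $ i"
      "\<forall>p\<in>X. \<forall>q\<in>Y. \<forall>x\<in>X'. \<forall>y\<in>Y'. p + q = x + y \<longrightarrow> p \<in> X' \<and> q \<in> Y'"
    by (elim exE conjE)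
  obtain x y where xy: "x \<in> X'" "y \<in> Y'" using *(3,4) by blast
  have eq: "p = x" if "p \<in> X'" for p
    unfolding vec_eq_iff using *(5) that xy(1) by blast
  have "p = x" if "p \<in> X" "q \<in> Y" "p + q = x + y" for p q using *(6) eq that xy by metis
  then show ?thesis using xy *(1,2) by blast
qed

text \<open>If both factors have exponents in the face \<open>F\<close>, \<open>unique\<close>
  yields a sum \<open>x + y\<close> of two of them that is attained only once among exponents in
  \<open>F\<close>. A sum in \<open>F\<close> has both summands in \<open>F\<close>, so nothing else
  contributes to this exponent, and the product has a nonzero coefficient there.\<close>

lemma (in semigroup_algebra) prime_face_ideal:
  assumes unique: "\<And>X Y. finite X \<Longrightarrow> X \<noteq> {} \<Longrightarrow> finite Y \<Longrightarrow> Y \<noteq> {} \<Longrightarrow>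
      \<exists>x\<in>X. \<exists>y\<in>Y. \<forall>p\<in>X. \<forall>q\<in>Y. p + q = x + y \<longrightarrow> p = (x :: 'g)"
    and F: "F \<subseteq> S" "0 \<in> F" "\<And>x y. x \<in> S \<Longrightarrow> y \<in> S \<Longrightarrow> x + y \<in> F \<longleftrightarrow> x \<in> F \<and> y \<in> F"
  shows "primeideal (monomial_span (S - F)) R"
proof (rule primeidealI)
  show "ideal (monomial_span (S - F)) R" unfolding ideal_iff using F S_add by (intro monomial_ideal) auto
  have "(1 :: 'g \<Rightarrow>\<^sub>0 'k) \<notin> monomial_span (S - F)" using F by (auto simp: monomial_span_def)
  then show "carrier R \<noteq> monomial_span (S - F)" using B_1 by auto
  show "cring R" by (rule cring_R)
next
  fix f h assume "f \<in> carrier R" "h \<in> carrier R" and fh: "f \<otimes>\<^bsub>R\<^esub> h \<in> monomial_span (S - F)"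
  then have f: "f \<in> monomial_span S" and h: "h \<in> monomial_span S" by auto
  show "f \<in> monomial_span (S - F) \<or> h \<in> monomial_span (S - F)"
  proof (rule ccontr)
    assume neg: "\<not> ?thesis"
    define X where "X = Poly_Mapping.keys f \<inter> F"
    define Y where "Y = Poly_Mapping.keys h \<inter> F"
    have "X \<noteq> {}" "Y \<noteq> {}" using neg f h by (auto simp: X_def Y_def monomial_span_def)
    then obtain x y where xy: "x \<in> X" "y \<in> Y" "\<And>p q. p \<in> X \<Longrightarrow> q \<in> Y \<Longrightarrow> p + q = x + y \<Longrightarrow> p = x"
      using unique[of X Y] by (auto simp: X_def Y_def)
    have xyF: "x + y \<in> F" using xy F(3)[of x y] F(1) by (auto simp: X_def Y_def)
    have "Poly_Mapping.lookup f p * Poly_Mapping.lookup h (x + y - p) = 0"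
      if p: "p \<in> Poly_Mapping.keys f" "p \<noteq> x" for p
    proof (rule ccontr)
      assume "\<not> ?thesis"
      then have q: "x + y - p \<in> Poly_Mapping.keys h" by (auto simp: in_keys_iff)
      then have "p \<in> S" "x + y - p \<in> S" using p f h by (auto simp: monomial_span_def)
      then have "p \<in> F" "x + y - p \<in> F" using F(3)[of p "x + y - p"] xyF by auto
      then show False using xy(3)[of p "x + y - p"] p q by (simp add: X_def Y_def)
    qed
    then have "Poly_Mapping.lookup (f * h) (x + y) = (\<Sum>p\<in>Poly_Mapping.keys f. if p = x then Poly_Mapping.lookup f x * Poly_Mapping.lookup h y else 0)"
      unfolding lookup_times by (intro sum.cong) auto
    also have "\<dots> \<noteq> 0" using xy by (simp add: X_def Y_def in_keys_iff)
    finally have "x + y \<in> S - F" using fh monomial_spanD by fastforce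
    then show False using xyF by simp
  qed
qed

section \<open>Cohen-Macaulay semigroup rings\<close>

lemma kosign_cases: "kosign i I = (1 :: 'r::comm_ring_1) \<or> kosign i I = (- 1 :: 'r)"
  unfolding kosign_def by (cases "even (card {j \<in> I. j < i})") auto

lemma vector_smult_sum: "k *s sum f X = (\<Sum>x\<in>X. k *s f x)" for f :: "'b \<Rightarrow> 'c::ring ^ 'd"
  by (induction X rule: infinite_finite_induct) (simp_all add: vector_add_ldistrib)

context semigroup_algebra
begin

text \<open>In degree \<open>u\<close> the Koszul complex is spanned by the sets \<open>I\<close>
  with \<open>u + sum y I \<in> S\<close>, here the proper supersets of \<open>K\<close>. The
  complex of all supersets of \<open>K\<close> is exact; removing its bottom element creates
  cohomology in degree \<open>card K + 1\<close>.\<close>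

lemma koszul_contradiction:
  fixes y :: "nat \<Rightarrow> 'g"
  defines "x \<equiv> \<lambda>k. Poly_Mapping.single (y k) (1 :: 'k)"
  assumes y: "\<And>k. k < d \<Longrightarrow> y k \<in> S"
    and K: "K \<subset> {..<d}"
    and iff: "\<And>I. I \<subseteq> {..<d} \<Longrightarrow> u + sum y I \<in> S \<longleftrightarrow> K \<subset> I"
    and exact: "koszul_complex.kexact (monomial_span S) x d {0} (Suc (card K))"
  shows False
proof -
  interpret kc: koszul_complex "monomial_span S" x d
    by unfold_locales (auto simp: x_def intro: monomial_span_single y)
  have finK: "finite K" using K finite_subset by blast
  \<comment> \<open>The removed bottom element: its monomial lies outside the semigroup ring, but
    its differential lies inside and is a cocycle.\<close>
  define b0 where "b0 I = (if I = K then Poly_Mapping.single (u + sum y K) (1 :: 'k) else 0)" for I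
  have x_b0: "x i * b0 K = Poly_Mapping.single (u + sum y (insert i K)) 1" if "i \<notin> K" for i
    using that finK by (simp add: x_def b0_def mult_single add_ac)
  have "koszul x b0 I \<in> monomial_span S" if I: "I \<subseteq> {..<d}" for I
    unfolding koszul_def
  proof (rule B_sum)
    fix i assume i: "i \<in> I"
    show "kosign i I * x i * b0 (I - {i}) \<in> monomial_span S"
    proof (cases "I - {i} = K")
      case True
      then have "K \<subset> I" "insert i K = I" "i \<notin> K" using i by auto
      then have "x i * b0 K \<in> monomial_span S" using iff[OF I] x_b0 by (auto intro: monomial_span_single)
      then have "kosign i I * (x i * b0 (I - {i})) \<in> monomial_span S" unfolding True by (rule B_mult[OF kc.kosign_B])
      then show ?thesis by (simp add: mult.assoc)
    next
      case False
      then show ?thesis by (simp add: b0_def)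
    qed
  qed
  moreover have "koszul x (koszul x b0) I = 0" if "I \<subseteq> {..<d}" for I
    using that finite_subset by (intro koszul_koszul) blast
  ultimately have "koszul x b0 \<in> kc.kcocycle {0} (Suc (card K))"
    by (simp add: kc.kcocycle_def kc.kcochain_def)
  then have "koszul x b0 \<in> kc.kboundary {0} (Suc (card K))" using exact by (auto simp: kc.kexact_def)
  then obtain b where b: "b \<in> kc.kcochain (card K)"
      "\<And>I. I \<subseteq> {..<d} \<Longrightarrow> card I = Suc (card K) \<Longrightarrow> koszul x b0 I = koszul x b I"
    by (auto simp: kc.kboundary_def)
  obtain k where k: "k < d" "k \<notin> K" using K by auto
  define I where "I = insert k K"
  have I: "I \<subseteq> {..<d}" "card I = Suc (card K)" "finite I" using K k finK by (auto simp: I_def)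
  define w where "w = u + sum y I"
  have lookup_sign: "Poly_Mapping.lookup (kosign i I * f) w = 0 \<longleftrightarrow> Poly_Mapping.lookup f w = 0" for i and f :: "'g \<Rightarrow>\<^sub>0 'k"
    using kosign_cases[where 'r = "'g \<Rightarrow>\<^sub>0 'k", of i I] by auto
  have "koszul x b0 I = (\<Sum>i\<in>I. if i = k then kosign k I * (x k * b0 K) else 0)"
    unfolding koszul_def
  proof (rule sum.cong[OF refl])
    fix i assume "i \<in> I"
    then have "I - {i} = K \<longleftrightarrow> i = k" using k by (auto simp: I_def)
    then show "kosign i I * x i * b0 (I - {i}) = (if i = k then kosign k I * (x k * b0 K) else 0)"
      by (auto simp: b0_def mult.assoc)
  qed
  also have "\<dots> = kosign k I * Poly_Mapping.single w 1"
    using I x_b0[OF k(2)] by (simp add: I_def w_def)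
  finally have "Poly_Mapping.lookup (koszul x b0 I) w \<noteq> 0" using lookup_sign by simp
  \<comment> \<open>A cochain over the semigroup ring has no monomial of the required degree on sets
    of size \<open>card K\<close>, so its differential misses the exponent \<open>w\<close> that
    occurs in \<open>koszul x b0\<close>.\<close>
  moreover have "Poly_Mapping.lookup (koszul x b I) w = 0"
    unfolding koszul_def lookup_sum
  proof (rule sum.neutral, rule ballI)
    fix i assume i: "i \<in> I"
    have Ii: "I - {i} \<subseteq> {..<d}" "card (I - {i}) = card K" using I i by auto
    then have "\<not> K \<subset> I - {i}" using I by (metis finite_Diff less_irrefl psubset_card_mono)
    then have "u + sum y (I - {i}) \<notin> S" using iff Ii by blast
    moreover have "w - y i = u + sum y (I - {i})" using i I by (simp add: w_def sum.remove[of I i])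
    moreover have "b (I - {i}) \<in> monomial_span S" using b(1) Ii by (simp add: kc.kcochain_def)
    ultimately have "Poly_Mapping.lookup (b (I - {i})) (w - y i) = 0" using monomial_spanD by metis
    then have "Poly_Mapping.lookup (x i * b (I - {i})) w = 0" by (simp add: x_def lookup_single_times)
    then show "Poly_Mapping.lookup (kosign i I * x i * b (I - {i})) w = 0"
      using lookup_sign by (simp add: mult.assoc)
  qed
  ultimately show False using b(2)[OF I(1,2)] by simp
qed

end

section \<open>Height, depth and the intersection of the localizations\<close>

context simplicial_affine_semigroup
begin

lemma coord_add_eq_0_iff: "s \<in> S \<Longrightarrow> t \<in> S \<Longrightarrow> coord i (s + t) = 0 \<longleftrightarrow> coord i s = 0 \<and> coord i t = 0"
  using coord_nonneg[of s i] coord_nonneg[of t i] by (auto simp: coord_add)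

text \<open>A complete flag of faces: \<open>F i\<close> is cut out by the vanishing of the first
  \<open>i\<close> coordinates, the ray \<open>a (e i)\<close> separates it from
  \<open>F (Suc i)\<close>, and the last face is the origin. The primes of the faces increase along
  the flag.\<close>

lemma prime_height_ge:
  fixes R :: "((int ^ 'd) \<Rightarrow>\<^sub>0 'k::field) ring"
  assumes "semigroup_algebra S R"
  shows "enat CARD('d) \<le> prime_height R (monomial_span (S - {0}))"
proof -
  interpret semigroup_algebra S R by fact
  obtain e :: "nat \<Rightarrow> 'd" where e: "bij_betw e {..<CARD('d)} UNIV"
    using ex_bij_betw_nat_finite[of "UNIV :: 'd set"] by (auto simp: atLeast0LessThan)
  define F where "F i = {s \<in> S. \<forall>j<i. coord (e j) s = 0}" for i
  define Q :: "nat \<Rightarrow> ((int ^ 'd) \<Rightarrow>\<^sub>0 'k) set" where "Q i = monomial_span (S - F i)" for i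
  have "primeideal (Q i) R" for i
    unfolding Q_def
  proof (rule prime_face_ideal[OF unique_sum])
    show "0 \<in> F i" using S_zero by (simp add: F_def coord_zero)
    show "x + y \<in> F i \<longleftrightarrow> x \<in> F i \<and> y \<in> F i" if "x \<in> S" "y \<in> S" for x y
      using that S_add coord_add_eq_0_iff[OF that] by (auto simp: F_def)
  qed (auto simp: F_def)
  moreover have "Q i \<subset> Q (Suc i)" if i: "i < CARD('d)" for i
  proof -
    have "Q i \<subseteq> Q (Suc i)" unfolding Q_def F_def by (intro monomial_span_mono) auto
    moreover have "e j \<noteq> e i" if "j < i" for j
      using e that i unfolding bij_betw_def inj_on_def by fastforce
    then have "a (e i) \<in> F i" "a (e i) \<notin> F (Suc i)" using a_S by (auto simp: F_def coord_a)
    then have "Poly_Mapping.single (a (e i)) 1 \<in> Q (Suc i)" "Poly_Mapping.single (a (e i)) 1 \<notin> Q i"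
      using a_S by (auto simp: Q_def monomial_span_def)
    ultimately show ?thesis by blast
  qed
  moreover have "F CARD('d) = {0}"
  proof -
    have "s = 0" if "s \<in> F CARD('d)" for s
    proof (rule coord_eq_0)
      fix i
      obtain j where "j < CARD('d)" "i = e j" using e unfolding bij_betw_def by (metis UNIV_I imageE lessThan_iff)
      then show "coord i s = 0" using that by (simp add: F_def)
    qed
    then show ?thesis using S_zero by (auto simp: F_def coord_zero)
  qed
  then have "Q CARD('d) = monomial_span (S - {0})" by (simp add: Q_def)
  ultimately show ?thesis
    unfolding prime_height_def by (intro Sup_upper) blast
qed

lemma monomial_power:
  fixes c :: "'k::field"
  shows "Poly_Mapping.single s c ^ n = Poly_Mapping.single (int n *s s) (c ^ n)"
proof (induction n)
  case (Suc n)
  have "int (Suc n) *s s = s + int n *s s" by (simp add: vector_sadd_rdistrib)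
  then show ?case using Suc by (simp add: mult_single)
qed simp

lemma nilpotent_modulo_ray_powers:
  fixes R :: "((int ^ 'd) \<Rightarrow>\<^sub>0 'k::field) ring" and y :: "nat \<Rightarrow> int ^ 'd" and n :: "'d \<Rightarrow> nat"
  assumes "semigroup_algebra S R"
    and kc: "koszul_complex (monomial_span S) (\<lambda>k. Poly_Mapping.single (y k) (1 :: 'k)) d"
    and y: "\<And>i. \<exists>k<d. y k = int (n i) *s a i"
    and f: "f \<in> monomial_span (S - {0})"
  shows "\<exists>N. f ^ N \<in> koszul_complex.xideal (monomial_span S) (\<lambda>k. Poly_Mapping.single (y k) (1 :: 'k)) d"
proof -
  interpret semigroup_algebra S R by fact
  interpret kc: koszul_complex "monomial_span S" "\<lambda>k. Poly_Mapping.single (y k) (1 :: 'k)" d by (rule kc)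
  obtain M :: nat where M: "M > 0" "\<And>v. int M *s v = (\<Sum>i\<in>UNIV. \<lfloor>of_nat M * coord i v\<rfloor> *s a i)"
      "\<And>v i. of_nat M * coord i v = of_int \<lfloor>of_nat M * coord i v\<rfloor>"
    by (rule multiple_in_lattice) (rule that)
  have "\<exists>N. Poly_Mapping.single s c ^ N \<in> kc.xideal" if s: "s \<in> S" "s \<noteq> 0" for s and c :: 'k
  proof -
    obtain i where i: "coord i s \<noteq> 0" using coord_eq_0 s by blast
    then have "coord i s > 0" using coord_nonneg[OF s(1), of i] by simp
    then have "of_nat M * coord i s > 0" using M(1) by simp
    define q where "q j = \<lfloor>of_nat M * coord j s\<rfloor>" for j
    have "(0 :: rat) < of_int (q i)" unfolding q_def using \<open>of_nat M * coord i s > 0\<close> M(3) by metis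
    then have qi: "q i > 0" by simp
    have q: "q j \<ge> 0" for j using coord_nonneg[OF s(1), of j] M(1) by (simp add: q_def)
    obtain k where k: "k < d" "y k = int (n i) *s a i" using y by blast
    \<comment> \<open>What remains of \<open>n i * M\<close> times \<open>s\<close> after
      \<open>n i\<close> copies of \<open>a i\<close> are removed. This is possible because
      \<open>q i\<close> is a positive integer.\<close>
    define t where "t = (\<Sum>j\<in>UNIV. (int (n i) * q j - (if j = i then int (n i) else 0)) *s a j)"
    have "t \<in> S" unfolding t_def
      by (rule lattice_S) (use q qi in \<open>auto simp: mult_le_cancel_left1\<close>)
    have "int (n i * M) *s s = int (n i) *s (int M *s s)" by (simp add: vector_smult_assoc)
    also have "\<dots> = (\<Sum>j\<in>UNIV. (int (n i) * q j) *s a j)"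
      unfolding M(2)[of s] q_def by (simp add: vector_smult_sum vector_smult_assoc)
    also have "\<dots> = t + (\<Sum>j\<in>UNIV. (if j = i then int (n i) else 0) *s a j)"
      unfolding t_def by (simp add: sum.distrib[symmetric] vector_sadd_rdistrib[symmetric])
    also have "(\<Sum>j\<in>UNIV. (if j = i then int (n i) else 0) *s a j) = (\<Sum>j\<in>UNIV. if j = i then int (n i) *s a i else 0)"
      by (intro sum.cong) auto
    also have "\<dots> = y k" using k by simp
    finally have "Poly_Mapping.single s c ^ (n i * M) = Poly_Mapping.single t (c ^ (n i * M)) * Poly_Mapping.single (y k) 1"
      by (simp add: monomial_power mult_single)
    moreover have "\<dots> \<in> kc.xideal"
      using \<open>t \<in> S\<close> k by (intro kc.xideal_mem) (auto intro: monomial_span_single)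
    ultimately show ?thesis by metis
  qed
  note * = this
  have "\<exists>N. (\<Sum>s\<in>Poly_Mapping.keys f. Poly_Mapping.single s (Poly_Mapping.lookup f s)) ^ N \<in> kc.xideal"
  proof (rule radical_sum[OF kc.ideal_set_xideal finite_keys])
    fix s assume "s \<in> Poly_Mapping.keys f"
    then have "s \<in> S" "s \<noteq> 0" using f by (auto simp: monomial_span_def)
    with * show "Poly_Mapping.single s (Poly_Mapping.lookup f s) \<in> monomial_span S \<and>
        (\<exists>N. Poly_Mapping.single s (Poly_Mapping.lookup f s) ^ N \<in> kc.xideal)"
      by (auto intro: monomial_span_single)
  qed
  then show ?thesis using poly_mapping_sum_single[of f] by simp
qed

text \<open>Translating \<open>u\<close> far enough in the directions \<open>- a j\<close>, \<open>j \<in> Y\<close>, leaves exactly the index sets that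
  properly contain \<open>Y\<close>, which is the configuration excluded by \<open>koszul_contradiction\<close>.\<close>

lemma loc_contradiction:
  fixes R :: "((int ^ 'd) \<Rightarrow>\<^sub>0 'k::field) ring"
  assumes sa: "semigroup_algebra S R"
    and reg: "regular_sequence R xs" "set xs \<subseteq> monomial_span (S - {0})" "CARD('d) \<le> length xs"
    and Y: "Suc (card Y) < CARD('d)"
    and loc: "\<And>k. k \<notin> Y \<Longrightarrow> u \<in> loc (insert k Y)"
  shows "u \<in> loc Y"
proof (rule ccontr)
  assume notin: "u \<notin> loc Y"
  interpret semigroup_algebra S R by (rule sa)
  obtain e :: "nat \<Rightarrow> 'd" where e: "bij_betw e {..<CARD('d)} UNIV"
    using ex_bij_betw_nat_finite[of "UNIV :: 'd set"] by (auto simp: atLeast0LessThan)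
  have inj: "inj_on e I" if "I \<subseteq> {..<CARD('d)}" for I using e that inj_on_subset unfolding bij_betw_def by blast
  have "\<exists>N. k \<notin> Y \<longrightarrow> (\<forall>f. (\<forall>j\<in>insert k Y. int N \<le> f j) \<longrightarrow> u + (\<Sum>j\<in>insert k Y. f j *s a j) \<in> S)" for k
  proof (cases "k \<in> Y")
    case False
    then show ?thesis using loc_large[OF loc[OF False]] by metis
  qed auto
  then obtain N0 where N0: "\<And>k f. k \<notin> Y \<Longrightarrow> (\<And>j. j \<in> insert k Y \<Longrightarrow> int (N0 k) \<le> f j) \<Longrightarrow>
      u + (\<Sum>j\<in>insert k Y. f j *s a j) \<in> S" by metis
  \<comment> \<open>One multiple that clears the denominators for all \<open>k\<close> outside
    \<open>Y\<close> at once.\<close>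
  define N where "N = Max (range N0)"
  have N: "N0 k \<le> N" for k by (simp add: N_def)
  \<comment> \<open>\<open>P\<close> exceeds all coordinates of \<open>u\<close>, so after
    subtracting \<open>P\<close> copies of the rays in \<open>Y\<close> the point leaves the cone
    unless each of these rays is added back.\<close>
  define P where "P = Max (range (\<lambda>j. nat \<lceil>coord j u\<rceil>)) + 1"
  have P: "coord j u < of_nat P" for j
  proof -
    have "nat \<lceil>coord j u\<rceil> \<le> Max (range (\<lambda>j. nat \<lceil>coord j u\<rceil>))" by (rule Max_ge) auto
    then have "\<lceil>coord j u\<rceil> < int P" unfolding P_def by linarith
    then show ?thesis by (metis ceiling_less_iff le_less_trans le_of_int_ceiling of_int_less_iff of_int_of_nat_eq)
  qed
  \<comment> \<open>For rays in \<open>Y\<close> the exponent first undoes the translation by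
    \<open>P\<close> and then supplies the multiple \<open>N\<close>.\<close>
  define n where "n j = (if j \<in> Y then P + N else N)" for j
  define y where "y k = int (n (e k)) *s a (e k)" for k
  define v where "v = u - (\<Sum>j\<in>Y. int P *s a j)"
  define K where "K = {k. k < CARD('d) \<and> e k \<in> Y}"
  have eK: "e ` K = Y" using e unfolding K_def bij_betw_def by force
  have Ksub: "K \<subseteq> {..<CARD('d)}" by (auto simp: K_def)
  have cardK: "card K = card Y" using card_image[OF inj[OF Ksub]] eK by simp
  have sum_y: "sum y I = (\<Sum>j\<in>e ` I. int (n j) *s a j)" if "I \<subseteq> {..<CARD('d)}" for I
    using inj[OF that] by (simp add: sum.reindex y_def)
  have split_v: "v + (\<Sum>j\<in>Z. int (n j) *s a j) = u + (\<Sum>j\<in>Y. int N *s a j) + (\<Sum>j\<in>Z - Y. int N *s a j)"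
    if "Y \<subseteq> Z" for Z
  proof -
    have "(\<Sum>j\<in>Z. int (n j) *s a j) = (\<Sum>j\<in>Z - Y. int (n j) *s a j) + (\<Sum>j\<in>Y. int (n j) *s a j)"
      using that by (intro sum.subset_diff) auto
    also have "(\<Sum>j\<in>Z - Y. int (n j) *s a j) = (\<Sum>j\<in>Z - Y. int N *s a j)"
      by (intro sum.cong) (auto simp: n_def)
    also have "(\<Sum>j\<in>Y. int (n j) *s a j) = (\<Sum>j\<in>Y. int P *s a j) + (\<Sum>j\<in>Y. int N *s a j)"
      unfolding sum.distrib[symmetric] by (intro sum.cong) (auto simp: n_def vector_sadd_rdistrib)
    finally show ?thesis by (simp add: v_def)
  qed
  have iff: "v + sum y I \<in> S \<longleftrightarrow> K \<subset> I" if I: "I \<subseteq> {..<CARD('d)}" for I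
  proof -
    have KI: "K \<subseteq> I \<longleftrightarrow> Y \<subseteq> e ` I"
      using eK inj_on_image_subset_iff[OF inj[OF order_refl] Ksub I] by simp
    show ?thesis
    \<comment> \<open>There are three cases. If a ray of \<open>Y\<close> is missing, a coordinate
      is negative; \<open>I = K\<close> would put \<open>u\<close> into \<open>loc Y\<close>; and if
      \<open>I\<close> has one index more, the choice of \<open>N\<close> gives membership, further
      rays doing no harm.\<close>
    proof (cases "K \<subseteq> I")
      case False
      then obtain j where j: "j \<in> Y" "j \<notin> e ` I" using KI by blast
      have "coord j (v + sum y I) = coord j u - of_nat P"
        using j by (simp add: v_def sum_y[OF I] coord_add coord_diff coord_combination)
      then have "coord j (v + sum y I) < 0" using P[of j] by simp
      then have "v + sum y I \<notin> S" using coord_nonneg[of "v + sum y I" j] by linarith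
      then show ?thesis using False by blast
    next
      case True
      note eq = split_v[of "e ` I"]
      show ?thesis
      proof (cases "I = K")
        case True
        have "u + (\<Sum>j\<in>Y. int N *s a j) \<notin> S" using notin by (auto simp: loc_def)
        then show ?thesis using eq sum_y[OF I] True eK by simp
      next
        case False
        then obtain i where i: "i \<in> I" "i \<notin> K" using True by blast
        then have ei: "e i \<notin> Y" using I by (auto simp: K_def)
        have "u + (\<Sum>j\<in>insert (e i) Y. int N *s a j) \<in> S" by (rule N0[OF ei]) (use N in simp)
        moreover have "(\<Sum>j\<in>e ` I - insert (e i) Y. int N *s a j) \<in> S" by (intro lattice_S) simp
        ultimately have "u + (\<Sum>j\<in>insert (e i) Y. int N *s a j) + (\<Sum>j\<in>e ` I - insert (e i) Y. int N *s a j) \<in> S"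
          by (rule S_add)
        moreover have "e ` I - Y = insert (e i) (e ` I - insert (e i) Y)" using i ei by auto
        ultimately have "v + sum y I \<in> S"
          using eq KI True sum_y[OF I] ei by (simp add: add_ac)
        then show ?thesis using True False by blast
      qed
    qed
  qed
  have y_S: "y k \<in> S" for k unfolding y_def by (intro S_smult a_S)
  have kc: "koszul_complex (monomial_span S) (\<lambda>k. Poly_Mapping.single (y k) (1 :: 'k)) CARD('d)"
    by unfold_locales (auto intro: monomial_span_single y_S)
  have ray: "\<exists>k<CARD('d). y k = int (n i) *s a i" for i
    using e unfolding y_def bij_betw_def by (metis UNIV_I imageE lessThan_iff)
  \<comment> \<open>The bound on \<open>card Y\<close> keeps the Koszul degree
    \<open>card K + 1\<close> below the length of the regular sequence.\<close>
  have "koszul_complex.kexact (monomial_span S) (\<lambda>k. Poly_Mapping.single (y k) (1 :: 'k)) CARD('d) {0} (Suc (card K))"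
    using reg Y cardK
    by (intro kexact_regular_sequence[OF kc reg(1)] nilpotent_modulo_ray_powers[OF sa kc ray]) auto
  moreover have "K \<subset> {..<CARD('d)}" using Ksub cardK Y by (metis card_lessThan lessI less_trans order.strict_iff_order less_irrefl)
  ultimately show False using koszul_contradiction[of "CARD('d)" y K v] y_S iff by blast
qed

text \<open>Descending induction over \<open>Y\<close>: an element of the octant lies in
  \<open>loc UNIV\<close> and in every \<open>loc (- {i})\<close> by definition, and
  \<open>loc_contradiction\<close> shrinks \<open>Y\<close> whenever at least two rays are outside
  it, until \<open>loc {} = S\<close> is reached.\<close>

lemma Cohen_Macaulay_octant:
  fixes R :: "((int ^ 'd) \<Rightarrow>\<^sub>0 'k::field) ring"
  assumes R: "R = semigroup_ring S" and CM: "Cohen_Macaulay R"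
  shows "octant {} = S"
proof
  have cring: "cring R" using CM by (simp add: Cohen_Macaulay_def)
  have sa: "semigroup_algebra S R" by (rule semigroup_algebra.intro[OF R S_zero S_add cring])
  interpret semigroup_algebra S R by (rule sa)
  have "maximalideal (monomial_span (S - {0})) R" using maximal_monomial_ideal pointed by blast
  then have "enat CARD('d) \<le> ideal_depth R (monomial_span (S - {0}))"
    using CM prime_height_ge[OF sa] by (simp add: Cohen_Macaulay_def)
  \<comment> \<open>Depth is a supremum that need not be attained; the strict inequality makes it
    possible to extract an actual sequence of length at least \<open>d\<close>.\<close>
  then have "enat (CARD('d) - 1) < ideal_depth R (monomial_span (S - {0}))"
    by (rule less_le_trans[rotated]) simp
  then obtain xs where xs: "regular_sequence R xs" "set xs \<subseteq> monomial_span (S - {0})" "CARD('d) - 1 < length xs"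
    unfolding ideal_depth_def less_Sup_iff by auto
  show "octant {} \<subseteq> S"
  proof
    fix u assume u: "u \<in> octant {}"
    have "u \<in> loc Y" if "card (- Y) = m" for Y m
      using that
    proof (induction m arbitrary: Y)
      case 0
      then have "Y = UNIV" by auto
      then show ?case using u by (simp add: octant_def)
    next
      case (Suc m)
      show ?case
      proof (cases m)
        case 0
        then obtain i where "- Y = {i}" using Suc.prems by (auto simp: card_Suc_eq)
        then have "Y = - {i}" by auto
        then show ?thesis using u by (simp add: octant_def)
      next
        case (Suc m')
        have "card Y + card (- Y) = CARD('d)"
          by (metis Compl_partition card_Un_disjoint finite inf_compl_bot)
        then have Y: "Suc (card Y) < CARD('d)" using Suc.prems Suc by simp
        show ?thesis
        proof (rule loc_contradiction[OF sa xs(1,2) _ Y])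
          show "CARD('d) \<le> length xs" using xs(3) by simp
          show "u \<in> loc (insert k Y)" if "k \<notin> Y" for k
          proof (rule Suc.IH)
            have "- insert k Y = - Y - {k}" by auto
            then show "card (- insert k Y) = m" using that Suc.prems by simp
          qed
        qed
      qed
    qed
    from this[of "{}" "card (UNIV :: 'd set)"] show "u \<in> S" by (simp add: loc_empty)
  qed
  show "S \<subseteq> octant {}" using S_loc by (auto simp: octant_def)
qed

end

section \<open>Graded free modules\<close>

context semigroup_algebra
begin

lemma free_module_simps:
  "carrier (free_module R n) = {v. (\<forall>j<n. v j \<in> monomial_span S) \<and> (\<forall>j\<ge>n. v j = 0)}"
  "zero (free_module R n) = (\<lambda>_. 0)"
  "add (free_module R n) v w = (\<lambda>j. if j < n then v j + w j else 0)"
  "smult (free_module R n) r v = (\<lambda>j. if j < n then r * v j else 0)"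
  by (simp_all add: free_module_def fun_eq_iff)

lemma free_carrierI: "(\<And>j. j < n \<Longrightarrow> v j \<in> monomial_span S) \<Longrightarrow> (\<And>j. j \<ge> n \<Longrightarrow> v j = 0) \<Longrightarrow> v \<in> carrier (free_module R n)"
  by (simp add: free_module_simps)

lemma free_carrier_span: "v \<in> carrier (free_module R n) \<Longrightarrow> v j \<in> monomial_span S"
  by (cases "j < n") (auto simp: free_module_simps)

lemma free_carrier_zero: "v \<in> carrier (free_module R n) \<Longrightarrow> j \<ge> n \<Longrightarrow> v j = 0"
  by (simp add: free_module_simps)

definition unit_vec :: "nat \<Rightarrow> nat \<Rightarrow> 'g \<Rightarrow>\<^sub>0 'k" where
  "unit_vec j = (\<lambda>i. if i = j then 1 else 0)"

lemma unit_vec_carrier: "j < n \<Longrightarrow> unit_vec j \<in> carrier (free_module R n)"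
  by (rule free_carrierI) (auto simp: unit_vec_def)

text \<open>The action on the target is a parameter \<open>act\<close>, because \<open>h\<close> is
  used for entries of module maps, for cochains and for the augmentation read as a scalar.\<close>

lemma free_expand:
  fixes h :: "(nat \<Rightarrow> 'g \<Rightarrow>\<^sub>0 'k) \<Rightarrow> 'b::ab_group_add"
  assumes add: "\<And>v w. v \<in> carrier (free_module R n) \<Longrightarrow> w \<in> carrier (free_module R n) \<Longrightarrow>
      h (v \<oplus>\<^bsub>free_module R n\<^esub> w) = h v + h w"
    and smult: "\<And>r v. r \<in> monomial_span S \<Longrightarrow> v \<in> carrier (free_module R n) \<Longrightarrow>
      h (r \<odot>\<^bsub>free_module R n\<^esub> v) = act r (h v)"
    and v: "v \<in> carrier (free_module R n)"
  shows "h v = (\<Sum>j<n. act (v j) (h (unit_vec j)))"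
proof -
  define t where "t m = (\<lambda>j. if j < m then v j else 0)" for m
  have t: "t m \<in> carrier (free_module R n)" if "m \<le> n" for m
    using v that by (intro free_carrierI) (auto simp: t_def free_carrier_span)
  have "h (t m) = (\<Sum>j<m. act (v j) (h (unit_vec j)))" if "m \<le> n" for m
    using that
  proof (induction m)
    case 0
    \<comment> \<open>The zero vector is its own double, so additivity forces the value 0.\<close>
    have "t 0 \<oplus>\<^bsub>free_module R n\<^esub> t 0 = t 0" by (simp add: t_def free_module_simps fun_eq_iff)
    then have "h (t 0) + h (t 0) = h (t 0)" using add[OF t[OF 0] t[OF 0]] by simp
    then show ?case by simp
  next
    case (Suc m)
    have u: "unit_vec m \<in> carrier (free_module R n)" using Suc.prems by (intro unit_vec_carrier) simp
    have "v m \<odot>\<^bsub>free_module R n\<^esub> unit_vec m \<in> carrier (free_module R n)"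
      using v by (intro free_carrierI) (auto simp: free_module_simps unit_vec_def)
    moreover have "t (Suc m) = t m \<oplus>\<^bsub>free_module R n\<^esub> (v m \<odot>\<^bsub>free_module R n\<^esub> unit_vec m)"
      using Suc.prems by (auto simp: t_def free_module_simps unit_vec_def fun_eq_iff less_Suc_eq)
    ultimately have "h (t (Suc m)) = h (t m) + act (v m) (h (unit_vec m))"
      using add t Suc.prems smult[OF free_carrier_span[OF v] u] by simp
    then show ?case using Suc by simp
  qed
  moreover have "t n = v" using v by (auto simp: t_def free_carrier_zero)
  ultimately show ?thesis by force
qed

text \<open>The map of degree 0 given by a scalar matrix. The basis vectors have degrees
  \<open>s' j\<close> and \<open>s l\<close>, which dictates the monomial that accompanies the
  entry.\<close>

definition mat_map :: "nat \<Rightarrow> (nat \<Rightarrow> 'g) \<Rightarrow> nat \<Rightarrow> (nat \<Rightarrow> 'g) \<Rightarrow> (nat \<Rightarrow> nat \<Rightarrow> 'k) \<Rightarrow> (nat \<Rightarrow> 'g \<Rightarrow>\<^sub>0 'k) \<Rightarrow> nat \<Rightarrow> 'g \<Rightarrow>\<^sub>0 'k" where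
  "mat_map n s n' s' D v = (\<lambda>l. if l < n then \<Sum>j<n'. Poly_Mapping.single (s' j - s l) (D l j) * v j else 0)"

lemma free_gradingD:
  "v \<in> free_grading R (monomial_grading S) n s g \<Longrightarrow> v \<in> carrier (free_module R n)"
  "v \<in> free_grading R (monomial_grading S) n s g \<Longrightarrow> j < n \<Longrightarrow> v j = Poly_Mapping.single (g - s j) (Poly_Mapping.lookup (v j) (g - s j))"
  by (auto simp: free_grading_def monomial_grading_def intro: monomial_span_singleton)

context
  fixes n n' :: nat and s s' :: "nat \<Rightarrow> 'g" and D :: "nat \<Rightarrow> nat \<Rightarrow> 'k"
  assumes entry: "\<And>l j. l < n \<Longrightarrow> j < n' \<Longrightarrow> D l j \<noteq> 0 \<Longrightarrow> s' j - s l \<in> S"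
begin

lemma mat_map_carrier:
  assumes v: "v \<in> carrier (free_module R n')" shows "mat_map n s n' s' D v \<in> carrier (free_module R n)"
proof (rule free_carrierI)
  fix l assume "l < n"
  then have "Poly_Mapping.single (s' j - s l) (D l j) * v j \<in> monomial_span S" if "j < n'" for j
    using entry that by (intro B_mult free_carrier_span[OF v] monomial_span_single) blast
  then show "mat_map n s n' s' D v l \<in> monomial_span S" using \<open>l < n\<close> by (auto simp: mat_map_def)
qed (simp add: mat_map_def)

lemma mat_map_hom: "mat_map n s n' s' D \<in> module_hom R (free_module R n') (free_module R n)"
  unfolding module_hom_def
proof (intro CollectI conjI ballI)
  show "mat_map n s n' s' D \<in> carrier (free_module R n') \<rightarrow> carrier (free_module R n)"
    using mat_map_carrier by blast
qed (auto simp: mat_map_def free_module_simps algebra_simps sum.distrib sum_distrib_left intro!: sum.cong)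

lemma mat_map_homogeneous:
  "homogeneous_of_degree 0 (free_grading R (monomial_grading S) n' s') (free_grading R (monomial_grading S) n s) (mat_map n s n' s' D)"
  unfolding homogeneous_of_degree_def
proof (intro allI subsetI)
  fix g w assume "w \<in> mat_map n s n' s' D ` free_grading R (monomial_grading S) n' s' g"
  then obtain v where v: "v \<in> free_grading R (monomial_grading S) n' s' g" "w = mat_map n s n' s' D v" by blast
  have "w l \<in> monomial_span (S \<inter> {g - s l})" if l: "l < n" for l
  proof -
    have "Poly_Mapping.single (s' j - s l) (D l j) * v j \<in> monomial_span (S \<inter> {g - s l})" if j: "j < n'" for j
    proof (cases "D l j = 0")
      case False
      have "v j \<in> monomial_span (S \<inter> {g - s' j})" using v(1) j by (simp add: free_grading_def monomial_grading_def)
      moreover have "x + y \<in> S \<inter> {g - s l}" if "x \<in> {s' j - s l}" "y \<in> S \<inter> {g - s' j}" for x y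
        using S_add[OF entry[OF l j False], of y] that by auto
      ultimately show ?thesis
        by (intro monomial_span_times[of _ "{s' j - s l}" _ "S \<inter> {g - s' j}"]) (auto simp: monomial_span_single)
    qed simp
    then show ?thesis using v l by (auto simp: mat_map_def intro!: monomial_span_sum)
  qed
  then show "w \<in> free_grading R (monomial_grading S) n s (g + 0)"
    using mat_map_carrier[OF free_gradingD(1)[OF v(1)]] v(2) by (simp add: free_grading_def monomial_grading_def)
qed

end

text \<open>A map of degree 0 sends the \<open>j\<close>-th basis vector to a vector of degree
  \<open>s' j\<close>, each entry of which has room for one monomial only; its coefficient is the
  matrix entry.\<close>

lemma hom_mat_map:
  assumes \<phi>: "\<phi> \<in> module_hom R (free_module R n') (free_module R n)"
    and hom: "homogeneous_of_degree 0 (free_grading R (monomial_grading S) n' s') (free_grading R (monomial_grading S) n s) \<phi>"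
  shows "\<exists>D. (\<forall>l j. l < n \<longrightarrow> j < n' \<longrightarrow> D l j \<noteq> 0 \<longrightarrow> s' j - s l \<in> S) \<and>
    (\<forall>v\<in>carrier (free_module R n'). \<phi> v = mat_map n s n' s' D v)"
proof -
  define D where "D l j = Poly_Mapping.lookup (\<phi> (unit_vec j) l) (s' j - s l)" for l j
  have deg: "\<phi> (unit_vec j) \<in> free_grading R (monomial_grading S) n s (s' j)" if j: "j < n'" for j
  proof -
    have "unit_vec j \<in> free_grading R (monomial_grading S) n' s' (s' j)"
      using unit_vec_carrier[OF j] S_zero
      by (auto simp: free_grading_def monomial_grading_def unit_vec_def monomial_span_def)
    then have "\<phi> (unit_vec j) \<in> free_grading R (monomial_grading S) n s (s' j + 0)"
      using hom unfolding homogeneous_of_degree_def by blast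
    then show ?thesis by simp
  qed
  have car: "\<phi> v \<in> carrier (free_module R n)" if "v \<in> carrier (free_module R n')" for v
    using \<phi> that by (auto simp: module_hom_def)
  have "s' j - s l \<in> S" if "l < n" "j < n'" "D l j \<noteq> 0" for l j
    using that free_carrier_span[OF free_gradingD(1)[OF deg[OF that(2)]], of l] by (auto simp: D_def dest: monomial_spanD)
  moreover have "\<phi> v = mat_map n s n' s' D v" if v: "v \<in> carrier (free_module R n')" for v
  proof (rule ext)
    fix l
    show "\<phi> v l = mat_map n s n' s' D v l"
    proof (cases "l < n")
      case True
      have "\<phi> v l = (\<Sum>j<n'. v j * \<phi> (unit_vec j) l)"
        using \<phi> True by (intro free_expand[where h = "\<lambda>v. \<phi> v l" and act = "(*)", OF _ _ v])
          (auto simp: module_hom_def free_module_simps(3,4)[of n])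
      also have "\<dots> = (\<Sum>j<n'. Poly_Mapping.single (s' j - s l) (D l j) * v j)"
        using free_gradingD(2)[OF deg _] True by (intro sum.cong) (auto simp: D_def mult.commute)
      finally show ?thesis using True by (simp add: mat_map_def)
    next
      case False
      then show ?thesis using free_carrier_zero[OF car[OF v]] by (simp add: mat_map_def)
    qed
  qed
  ultimately show ?thesis by blast
qed

text \<open>The homogeneous component of degree \<open>u\<close> of a vector of the free module with shifts \<open>s\<close>, as a vector
  of scalars, and the space of all such vectors.\<close>

definition comp :: "nat \<Rightarrow> (nat \<Rightarrow> 'g) \<Rightarrow> 'g \<Rightarrow> (nat \<Rightarrow> 'g \<Rightarrow>\<^sub>0 'k) \<Rightarrow> nat \<Rightarrow> 'k" where
  "comp n s u v = (\<lambda>l. if l < n then Poly_Mapping.lookup (v l) (u - s l) else 0)"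

definition coch :: "nat \<Rightarrow> (nat \<Rightarrow> 'g) \<Rightarrow> 'g \<Rightarrow> (nat \<Rightarrow> 'k) set" where
  "coch n s u = {c. \<forall>l. c l \<noteq> 0 \<longrightarrow> l < n \<and> u - s l \<in> S}"

lemma comp_coch: "v \<in> carrier (free_module R n) \<Longrightarrow> comp n s u v \<in> coch n s u"
  by (auto simp: comp_def coch_def dest: free_carrier_span monomial_spanD)

lemma comp_mat_map:
  "comp n s u (mat_map n s n' s' D v) = (\<lambda>l. if l < n then \<Sum>j<n'. D l j * comp n' s' u v j else 0)"
  by (auto simp: comp_def mat_map_def lookup_sum lookup_single_times intro!: sum.cong)

lemma comp_eqI:
  assumes v: "v \<in> carrier (free_module R n)" and w: "w \<in> carrier (free_module R n)"
    and eq: "\<And>u. comp n s u v = comp n s u w"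
  shows "v = w"
proof (rule ext, rule poly_mapping_eqI)
  fix l x
  show "Poly_Mapping.lookup (v l) x = Poly_Mapping.lookup (w l) x"
    using fun_cong[OF eq[of "x + s l"], of l] free_carrier_zero[OF v, of l] free_carrier_zero[OF w, of l]
    by (cases "l < n") (auto simp: comp_def)
qed

lemma comp_finite: "finite {u. comp n s u v \<noteq> (\<lambda>_. 0)}"
proof (rule finite_subset)
  show "{u. comp n s u v \<noteq> (\<lambda>_. 0)} \<subseteq> (\<Union>l<n. (\<lambda>x. x + s l) ` Poly_Mapping.keys (v l))"
  proof
    fix u assume "u \<in> {u. comp n s u v \<noteq> (\<lambda>_. 0)}"
    then obtain l where "l < n" "Poly_Mapping.lookup (v l) (u - s l) \<noteq> 0" by (auto simp: comp_def fun_eq_iff split: if_splits)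
    then have "u - s l \<in> Poly_Mapping.keys (v l)" by (simp add: in_keys_iff)
    then have "u \<in> (\<lambda>x. x + s l) ` Poly_Mapping.keys (v l)" by (intro image_eqI[of _ _ "u - s l"]) auto
    then show "u \<in> (\<Union>l<n. (\<lambda>x. x + s l) ` Poly_Mapping.keys (v l))" using \<open>l < n\<close> by blast
  qed
qed auto

lemma assemble:
  assumes c: "\<And>u. c u \<in> coch n s u" and fin: "finite {u. c u \<noteq> (\<lambda>_. 0)}"
  shows "\<exists>v\<in>carrier (free_module R n). \<forall>u. comp n s u v = c u"
proof -
  define v where "v l = Abs_poly_mapping (\<lambda>g. if l < n then c (g + s l) l else 0)" for l
  have "finite {g. (if l < n then c (g + s l) l else 0) \<noteq> 0}" for l
  proof (rule finite_subset)
    show "{g. (if l < n then c (g + s l) l else 0) \<noteq> 0} \<subseteq> (\<lambda>u. u - s l) ` {u. c u \<noteq> (\<lambda>_. 0)}"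
    proof
      fix g assume "g \<in> {g. (if l < n then c (g + s l) l else 0) \<noteq> 0}"
      then have "c (g + s l) \<noteq> (\<lambda>_. 0)" by (auto split: if_splits)
      then show "g \<in> (\<lambda>u. u - s l) ` {u. c u \<noteq> (\<lambda>_. 0)}" by (intro image_eqI[of _ _ "g + s l"]) auto
    qed
  qed (use fin in auto)
  then have lk: "Poly_Mapping.lookup (v l) = (\<lambda>g. if l < n then c (g + s l) l else 0)" for l
    unfolding v_def by simp
  have "v \<in> carrier (free_module R n)"
  proof (rule free_carrierI)
    fix j assume "j < n"
    have "x \<in> S" if "c (x + s j) j \<noteq> 0" for x using c[of "x + s j"] that by (auto simp: coch_def)
    then show "v j \<in> monomial_span S" using \<open>j < n\<close> by (intro monomial_spanI) (simp add: lk)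
  next
    fix j assume "n \<le> j"
    then show "v j = 0" by (intro poly_mapping_eqI) (simp add: lk)
  qed
  moreover have "comp n s u v = c u" for u
    by (rule ext) (use c[of u] in \<open>auto simp: comp_def lk coch_def\<close>)
  ultimately show ?thesis by blast
qed

lemma assemble_single:
  assumes c: "c \<in> coch n s u"
  obtains v where "v \<in> carrier (free_module R n)" "comp n s u v = c" "\<And>u'. u' \<noteq> u \<Longrightarrow> comp n s u' v = (\<lambda>_. 0)"
proof -
  have "\<exists>v\<in>carrier (free_module R n). \<forall>u'. comp n s u' v = (if u' = u then c else (\<lambda>_. 0))"
  proof (rule assemble)
    show "(if u' = u then c else (\<lambda>_. 0)) \<in> coch n s u'" for u' using c by (auto simp: coch_def)
    show "finite {u'. (if u' = u then c else (\<lambda>_. 0)) \<noteq> (\<lambda>_. 0)}" by (rule finite_subset[of _ "{u}"]) auto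
  qed
  then obtain v where v: "v \<in> carrier (free_module R n)" "\<And>u'. comp n s u' v = (if u' = u then c else (\<lambda>_. 0))" by blast
  show ?thesis by (rule that[OF v(1)]) (simp_all add: v(2))
qed

text \<open>Here \<open>Z u\<close> is the degree \<open>u\<close> part of a graded submodule. The
  lemma assembles a statement about modules from linear algebra in single degrees;
  \<open>image_mat_mapD\<close> and \<open>image_mat_mapD'\<close> go back.\<close>

lemma image_mat_map:
  assumes entry: "\<And>l j. l < n \<Longrightarrow> j < n' \<Longrightarrow> D l j \<noteq> 0 \<Longrightarrow> s' j - s l \<in> S"
    and im: "\<And>u w. w \<in> coch n' s' u \<Longrightarrow> (\<lambda>l. if l < n then \<Sum>j<n'. D l j * w j else 0) \<in> Z u"
    and gen: "\<And>u v. v \<in> coch n s u \<Longrightarrow> v \<in> Z u \<Longrightarrow> \<exists>w\<in>coch n' s' u. v = (\<lambda>l. if l < n then \<Sum>j<n'. D l j * w j else 0)"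
  shows "mat_map n s n' s' D ` carrier (free_module R n') = {v \<in> carrier (free_module R n). \<forall>u. comp n s u v \<in> Z u}"
proof (intro equalityI subsetI)
  fix v assume "v \<in> mat_map n s n' s' D ` carrier (free_module R n')"
  then obtain w where w: "w \<in> carrier (free_module R n')" "v = mat_map n s n' s' D w" by blast
  then show "v \<in> {v \<in> carrier (free_module R n). \<forall>u. comp n s u v \<in> Z u}"
    using mat_map_carrier[OF entry] im[OF comp_coch[OF w(1)]] by (simp add: comp_mat_map)
next
  fix v assume "v \<in> {v \<in> carrier (free_module R n). \<forall>u. comp n s u v \<in> Z u}"
  then have v: "v \<in> carrier (free_module R n)" "\<And>u. comp n s u v \<in> Z u" by auto
  \<comment> \<open>A vanishing component receives the preimage 0, so only finitely many preimages
    are nonzero and they can be assembled.\<close>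
  have "\<exists>w. w \<in> coch n' s' u \<and> comp n s u v = (\<lambda>l. if l < n then \<Sum>j<n'. D l j * w j else 0) \<and>
      (comp n s u v = (\<lambda>_. 0) \<longrightarrow> w = (\<lambda>_. 0))" for u
  proof (cases "comp n s u v = (\<lambda>_. 0)")
    case True
    then show ?thesis by (intro exI[of _ "\<lambda>_. 0"]) (auto simp: coch_def)
  next
    case False
    then show ?thesis using gen[OF comp_coch[OF v(1)] v(2)] by blast
  qed
  then obtain w where w: "\<And>u. w u \<in> coch n' s' u" "\<And>u. comp n s u v = (\<lambda>l. if l < n then \<Sum>j<n'. D l j * w u j else 0)"
      "\<And>u. comp n s u v = (\<lambda>_. 0) \<Longrightarrow> w u = (\<lambda>_. 0)" by metis
  have "finite {u. w u \<noteq> (\<lambda>_. 0)}" by (rule finite_subset[OF _ comp_finite[of n s v]]) (use w(3) in blast)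
  then obtain W where W: "W \<in> carrier (free_module R n')" "\<And>u. comp n' s' u W = w u"
    using assemble[OF w(1)] by blast
  have "v = mat_map n s n' s' D W"
    by (rule comp_eqI[where s = s, OF v(1) mat_map_carrier[OF entry W(1)]])
       (assumption | (unfold comp_mat_map W(2), rule w(2)))+
  then show "v \<in> mat_map n s n' s' D ` carrier (free_module R n')" using W(1) by blast
qed

lemma image_mat_mapD:
  assumes im: "mat_map n s n' s' D ` carrier (free_module R n') = {v \<in> carrier (free_module R n). \<forall>u. comp n s u v \<in> Z u}"
    and Z0: "\<And>u. (\<lambda>_. 0) \<in> Z u" and v: "v \<in> coch n s u" "v \<in> Z u"
  shows "\<exists>w\<in>coch n' s' u. v = (\<lambda>l. if l < n then \<Sum>j<n'. D l j * w j else 0)"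
proof -
  obtain V where V: "V \<in> carrier (free_module R n)" "comp n s u V = v" "\<And>u'. u' \<noteq> u \<Longrightarrow> comp n s u' V = (\<lambda>_. 0)"
    using assemble_single[OF v(1)] by blast
  then have "comp n s u' V \<in> Z u'" for u' using Z0 v(2) by (cases "u' = u") auto
  then obtain W where W: "W \<in> carrier (free_module R n')" "V = mat_map n s n' s' D W" using im V(1) by blast
  show ?thesis using comp_coch[OF W(1)] V(2) unfolding W(2) comp_mat_map by blast
qed

lemma image_mat_mapD':
  assumes im: "mat_map n s n' s' D ` carrier (free_module R n') = {v \<in> carrier (free_module R n). \<forall>u. comp n s u v \<in> Z u}"
    and w: "w \<in> coch n' s' u"
  shows "(\<lambda>l. if l < n then \<Sum>j<n'. D l j * w j else 0) \<in> Z u"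
proof -
  obtain W where W: "W \<in> carrier (free_module R n')" "comp n' s' u W = w"
    using assemble_single[OF w] by blast
  then have "comp n s u (mat_map n s n' s' D W) \<in> Z u" using im by blast
  then show ?thesis unfolding comp_mat_map W(2) .
qed

lemma kernel_mat_map:
  assumes "v \<in> carrier (free_module R n')"
  shows "mat_map n s n' s' D v = (\<lambda>_. 0) \<longleftrightarrow> (\<forall>u. \<forall>l<n. (\<Sum>j<n'. D l j * comp n' s' u v j) = 0)"
proof
  assume "mat_map n s n' s' D v = (\<lambda>_. 0)"
  then have "comp n s u (mat_map n s n' s' D v) l = 0" for u l by (simp add: comp_def)
  then show "\<forall>u. \<forall>l<n. (\<Sum>j<n'. D l j * comp n' s' u v j) = 0" by (simp add: comp_mat_map) metis
next
  assume *: "\<forall>u. \<forall>l<n. (\<Sum>j<n'. D l j * comp n' s' u v j) = 0"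
  show "mat_map n s n' s' D v = (\<lambda>_. 0)"
  proof (intro ext poly_mapping_eqI)
    fix l x
    have "comp n s (x + s l) (mat_map n s n' s' D v) l = 0" using * by (simp add: comp_mat_map)
    then show "Poly_Mapping.lookup (mat_map n s n' s' D v l) x = Poly_Mapping.lookup 0 x"
      by (cases "l < n") (auto simp: comp_def mat_map_def)
  qed
qed

end

section \<open>Graded free resolutions of the residue field\<close>

text \<open>Quotients by the kernel of a scalar-valued map \<open>\<theta>\<close>, whose cosets are
  level sets. It is used with the constant coefficient for the residue field and with the class of a
  cocycle, or 0, for Ext; \<open>\<rho>\<close> is the action of the ring on the scalars.\<close>

locale level_sets =
  fixes M :: "('a, 'b, 'm) module_scheme" and \<theta> :: "'b \<Rightarrow> 'k::field" and B :: "'a set" and \<rho> :: "'a \<Rightarrow> 'k"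
  assumes nonempty: "carrier M \<noteq> {}"
    and add_closed: "x \<in> carrier M \<Longrightarrow> y \<in> carrier M \<Longrightarrow> x \<oplus>\<^bsub>M\<^esub> y \<in> carrier M"
    and difference: "x \<in> carrier M \<Longrightarrow> y \<in> carrier M \<Longrightarrow> \<exists>z\<in>carrier M. y = z \<oplus>\<^bsub>M\<^esub> x"
    and smult_closed: "r \<in> B \<Longrightarrow> x \<in> carrier M \<Longrightarrow> r \<odot>\<^bsub>M\<^esub> x \<in> carrier M"
    and \<theta>_add: "x \<in> carrier M \<Longrightarrow> y \<in> carrier M \<Longrightarrow> \<theta> (x \<oplus>\<^bsub>M\<^esub> y) = \<theta> x + \<theta> y"
    and \<theta>_smult: "r \<in> B \<Longrightarrow> x \<in> carrier M \<Longrightarrow> \<theta> (r \<odot>\<^bsub>M\<^esub> x) = \<rho> r * \<theta> x"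
begin

definition level :: "'k \<Rightarrow> 'b set" where
  "level q = {x \<in> carrier M. \<theta> x = q}"

lemma coset_level: assumes x: "x \<in> carrier M" shows "level 0 +>\<^bsub>M\<^esub> x = level (\<theta> x)"
proof
  show "level 0 +>\<^bsub>M\<^esub> x \<subseteq> level (\<theta> x)"
    using x by (auto simp: a_r_coset_def' level_def add_closed \<theta>_add)
  show "level (\<theta> x) \<subseteq> level 0 +>\<^bsub>M\<^esub> x"
  proof
    fix y assume y: "y \<in> level (\<theta> x)"
    then obtain z where z: "z \<in> carrier M" "y = z \<oplus>\<^bsub>M\<^esub> x" using difference[OF x] by (auto simp: level_def)
    then have "\<theta> z = 0" using y \<theta>_add[OF z(1) x] by (simp add: level_def)
    then show "y \<in> level 0 +>\<^bsub>M\<^esub> x" using z unfolding a_r_coset_def' level_def by blast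
  qed
qed

lemma quot_carrier: "carrier (quot_module M (level 0)) = level ` \<theta> ` carrier M"
  by (auto simp: quot_module_def A_RCOSETS_def' coset_level)

lemma quot_zero: "\<zero>\<^bsub>quot_module M (level 0)\<^esub> = level 0"
  by (simp add: quot_module_def)

lemma quot_grading_level: "gM g \<subseteq> carrier M \<Longrightarrow> quot_grading M (level 0) gM g = level ` \<theta> ` gM g"
  unfolding quot_grading_def image_image by (intro image_cong) (auto simp: coset_level)

lemma quot_add:
  assumes x: "x \<in> carrier M" and y: "y \<in> carrier M"
  shows "level (\<theta> x) \<oplus>\<^bsub>quot_module M (level 0)\<^esub> level (\<theta> y) = level (\<theta> x + \<theta> y)"
proof -
  have "z \<in> level (\<theta> x) <+>\<^bsub>M\<^esub> level (\<theta> y)" if z: "z \<in> level (\<theta> x + \<theta> y)" for z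
  proof -
    obtain t where t: "t \<in> carrier M" "z = t \<oplus>\<^bsub>M\<^esub> y" using difference[OF y] z by (auto simp: level_def)
    then have "\<theta> t = \<theta> x" using z \<theta>_add[OF t(1) y] by (simp add: level_def)
    then show ?thesis using t y unfolding set_add_def' level_def by blast
  qed
  then show ?thesis by (auto simp: quot_module_def set_add_def' level_def add_closed \<theta>_add)
qed

lemma quot_smult:
  assumes r: "r \<in> B" and x: "x \<in> carrier M"
  shows "r \<odot>\<^bsub>quot_module M (level 0)\<^esub> level (\<theta> x) = level (\<rho> r * \<theta> x)"
proof -
  have "level 0 +>\<^bsub>M\<^esub> (r \<odot>\<^bsub>M\<^esub> y) = level (\<rho> r * \<theta> x)" if "y \<in> level (\<theta> x)" for y
  proof -
    have y: "y \<in> carrier M" "\<theta> y = \<theta> x" using that by (auto simp: level_def)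
    then show ?thesis using coset_level[OF smult_closed[OF r y(1)]] \<theta>_smult[OF r y(1)] by simp
  qed
  moreover have "x \<in> level (\<theta> x)" using x by (simp add: level_def)
  ultimately show ?thesis by (auto simp: quot_module_def)
qed

lemma level_inject: "x \<in> carrier M \<Longrightarrow> level (\<theta> x) = level q \<longleftrightarrow> \<theta> x = q"
  by (auto simp: level_def)

end

section \<open>The residue field and the construction of syzygies\<close>

locale pointed_semigroup_algebra = semigroup_algebra S R
  for S :: "'g::ab_group_add set" and R :: "('g \<Rightarrow>\<^sub>0 'k::field) ring" +
  assumes pointed: "x \<in> S \<Longrightarrow> - x \<in> S \<Longrightarrow> x = 0"
    and noetherian: "noetherian_ring R"
begin

abbreviation max_ideal :: "('g \<Rightarrow>\<^sub>0 'k) set" where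
  "max_ideal \<equiv> monomial_span (S - {0})"

abbreviation res_field :: "('g \<Rightarrow>\<^sub>0 'k, ('g \<Rightarrow>\<^sub>0 'k) set) module" where
  "res_field \<equiv> quot_module (self_module R) max_ideal"

abbreviation res_field_grading :: "'g \<Rightarrow> ('g \<Rightarrow>\<^sub>0 'k) set set" where
  "res_field_grading \<equiv> quot_grading (self_module R) max_ideal (monomial_grading S)"

definition cs :: "'k \<Rightarrow> ('g \<Rightarrow>\<^sub>0 'k) set" where
  "cs c = {x \<in> monomial_span S. Poly_Mapping.lookup x 0 = c}"

lemma single_zero_span: "Poly_Mapping.single 0 c \<in> monomial_span S"
  by (intro monomial_span_single) (simp add: S_zero)

lemma single_cs: "Poly_Mapping.single 0 c \<in> cs c"
  by (simp add: cs_def single_zero_span)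

lemma cs_inject: "cs c = cs c' \<longleftrightarrow> c = c'"
  using single_cs[of c] by (auto simp: cs_def)

lemma max_ideal_iff: "x \<in> max_ideal \<longleftrightarrow> x \<in> monomial_span S \<and> Poly_Mapping.lookup x 0 = 0"
  unfolding monomial_span_def in_keys_iff subset_iff Diff_iff mem_Collect_eq by auto

text \<open>Since \<open>S\<close> is pointed, two exponents in \<open>S\<close> add up to 0 only if
  both are 0.\<close>

lemma lookup_times_zero:
  assumes "x \<in> monomial_span S" "y \<in> monomial_span S"
  shows "Poly_Mapping.lookup (x * y) 0 = Poly_Mapping.lookup x 0 * Poly_Mapping.lookup y 0"
proof -
  have "Poly_Mapping.lookup x p * Poly_Mapping.lookup y (0 - p)
      = (if p = 0 then Poly_Mapping.lookup x 0 * Poly_Mapping.lookup y 0 else 0)" for p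
  proof (cases "p = 0 \<or> Poly_Mapping.lookup x p * Poly_Mapping.lookup y (0 - p) = 0")
    case False
    then have "p \<in> S" "- p \<in> S" using assms by (auto dest: monomial_spanD)
    then show ?thesis using pointed False by blast
  qed auto
  then show ?thesis unfolding lookup_times by (simp add: in_keys_iff)
qed

lemma self_module_simps:
  "carrier (self_module R) = monomial_span S" "zero (self_module R) = 0"
  "add (self_module R) = (+)" "smult (self_module R) = (*)"
  by (simp_all add: self_module_def)

sublocale residue: level_sets "self_module R" "\<lambda>x. Poly_Mapping.lookup x 0" "monomial_span S" "\<lambda>r. Poly_Mapping.lookup r 0"
proof
  show "carrier (self_module R) \<noteq> {}" using B_0 by (auto simp: self_module_simps)
  fix x y assume xy: "x \<in> carrier (self_module R)" "y \<in> carrier (self_module R)"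
  then have "y - x \<in> carrier (self_module R)" by (auto simp: self_module_simps)
  moreover have "y = (y - x) \<oplus>\<^bsub>self_module R\<^esub> x" by (simp add: self_module_simps)
  ultimately show "\<exists>z\<in>carrier (self_module R). y = z \<oplus>\<^bsub>self_module R\<^esub> x" by blast
qed (auto simp: self_module_simps lookup_add lookup_times_zero)

lemma cs_level: "residue.level = cs"
  by (rule ext) (simp add: residue.level_def cs_def self_module_simps)

lemma max_ideal_cs: "max_ideal = cs 0"
  by (auto simp: cs_def max_ideal_iff)

lemma lookup_zero_surj: "(\<lambda>x. Poly_Mapping.lookup x 0) ` monomial_span S = (UNIV :: 'k set)"
proof -
  have "c \<in> (\<lambda>x. Poly_Mapping.lookup x 0) ` monomial_span S" for c :: 'k
    using single_zero_span[of c] by (intro image_eqI[of _ _ "Poly_Mapping.single 0 c"]) auto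
  then show ?thesis by blast
qed

lemma res_field_simps:
  "carrier res_field = range cs" "zero res_field = cs 0"
  "add res_field (cs c) (cs c') = cs (c + c')"
  "r \<in> monomial_span S \<Longrightarrow> smult res_field r (cs c) = cs (Poly_Mapping.lookup r 0 * c)"
proof -
  show "carrier res_field = range cs"
    using residue.quot_carrier by (simp add: cs_level max_ideal_cs self_module_simps lookup_zero_surj)
  show "zero res_field = cs 0" using residue.quot_zero by (simp add: cs_level max_ideal_cs)
  have s: "Poly_Mapping.single 0 c \<in> carrier (self_module R)" for c by (simp add: self_module_simps single_zero_span)
  show "add res_field (cs c) (cs c') = cs (c + c')"
    using residue.quot_add[OF s s, of c c'] by (simp add: cs_level max_ideal_cs)
  show "r \<in> monomial_span S \<Longrightarrow> smult res_field r (cs c) = cs (Poly_Mapping.lookup r 0 * c)"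
    using residue.quot_smult[OF _ s, of r c] by (simp add: cs_level max_ideal_cs)
qed

lemma res_field_grading_simps: "res_field_grading g = (if g = 0 then range cs else {cs 0})"
proof -
  have "monomial_grading S g \<subseteq> carrier (self_module R)"
    unfolding monomial_grading_def self_module_simps by (rule monomial_span_mono) simp
  then have eq: "res_field_grading g = cs ` (\<lambda>x. Poly_Mapping.lookup x 0) ` monomial_span (S \<inter> {g})"
    using residue.quot_grading_level[of "monomial_grading S" g] by (simp add: cs_level max_ideal_cs monomial_grading_def)
  show ?thesis
  proof (cases "g = 0")
    case True
    have "c \<in> (\<lambda>x. Poly_Mapping.lookup x 0) ` monomial_span (S \<inter> {g})" for c :: 'k
      using True S_zero by (intro image_eqI[of _ _ "Poly_Mapping.single 0 c"]) (auto intro: monomial_span_single)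
    then have "(\<lambda>x. Poly_Mapping.lookup x 0) ` monomial_span (S \<inter> {g}) = (UNIV :: 'k set)" by blast
    then show ?thesis using True eq by simp
  next
    case False
    have "Poly_Mapping.lookup x 0 = 0" if "x \<in> monomial_span (S \<inter> {g})" for x :: "'g \<Rightarrow>\<^sub>0 'k"
      using monomial_spanD[OF that, of 0] False by auto
    then have "(\<lambda>x. Poly_Mapping.lookup x 0) ` monomial_span (S \<inter> {g}) = (\<lambda>_. 0 :: 'k) ` (monomial_span (S \<inter> {g}) :: ('g \<Rightarrow>\<^sub>0 'k) set)"
      by (intro image_cong) auto
    then have "(\<lambda>x. Poly_Mapping.lookup x 0) ` monomial_span (S \<inter> {g}) = {0 :: 'k}"
      using image_constant[OF monomial_span_zero] by metis
    then show ?thesis using False eq by simp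
  qed
qed

text \<open>The monomials in \<open>U\<close> span an ideal, finitely generated as the ring is
  Noetherian. The exponents \<open>Q\<close> of its generators suffice, because the monomials in
  \<open>Q + S\<close> span an ideal that contains these generators.\<close>

lemma upset_finitely_generated:
  assumes U: "U \<subseteq> S" and up: "\<And>x u. x \<in> S \<Longrightarrow> u \<in> U \<Longrightarrow> x + u \<in> U"
  shows "\<exists>Q\<subseteq>U. finite Q \<and> (\<forall>u\<in>U. \<exists>q\<in>Q. u - q \<in> S)"
proof -
  interpret noetherian_ring R by (rule noetherian)
  have "ideal (monomial_span U) R" unfolding ideal_iff using U up by (rule monomial_ideal)
  then obtain A where A: "A \<subseteq> carrier R" "finite A" "monomial_span U = genideal R A"
    using finetely_gen by blast
  define Q where "Q = (\<Union>f\<in>A. Poly_Mapping.keys f)"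
  define W where "W = {q + x | q x. q \<in> Q \<and> x \<in> S}"
  have "A \<subseteq> monomial_span U" using A genideal_self by simp
  then have QU: "Q \<subseteq> U" by (auto simp: Q_def monomial_span_def)
  have "Q \<subseteq> W"
  proof
    fix q assume "q \<in> Q"
    moreover have "q = q + 0" by simp
    ultimately show "q \<in> W" unfolding W_def using S_zero by blast
  qed
  have WS: "W \<subseteq> S" using QU U S_add by (auto simp: W_def)
  have "x + w \<in> W" if x: "x \<in> S" and w: "w \<in> W" for x w
  proof -
    obtain q y where "w = q + y" "q \<in> Q" "y \<in> S" using w by (auto simp: W_def)
    moreover from this have "x + w = q + (x + y)" by (simp add: add_ac)
    ultimately show ?thesis unfolding W_def using S_add[OF x] by blast
  qed
  then have "ideal (monomial_span W) R" unfolding ideal_iff using WS by (intro monomial_ideal)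
  moreover have "A \<subseteq> monomial_span W" using \<open>Q \<subseteq> W\<close> by (auto simp: Q_def monomial_span_def)
  ultimately have "monomial_span U \<subseteq> (monomial_span W :: ('g \<Rightarrow>\<^sub>0 'k) set)" using A(3) genideal_minimal by simp
  then have "Poly_Mapping.single u 1 \<in> (monomial_span W :: ('g \<Rightarrow>\<^sub>0 'k) set)" if "u \<in> U" for u
    using that by (intro subsetD[OF _ monomial_span_single]) auto
  then have "u \<in> W" if "u \<in> U" for u using that by (auto simp: monomial_span_def)
  then have "\<forall>u\<in>U. \<exists>q\<in>Q. u - q \<in> S" by (force simp: W_def)
  moreover have "finite Q" using A(2) by (simp add: Q_def)
  ultimately show ?thesis using QU by blast
qed

lemma coch_mono: "c \<in> coch n s u \<Longrightarrow> x \<in> S \<Longrightarrow> c \<in> coch n s (u + x)"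
proof -
  assume c: "c \<in> coch n s u" and x: "x \<in> S"
  have "u + x - s l \<in> S" if "u - s l \<in> S" for l using S_add[OF that x] by (simp add: algebra_simps)
  then show ?thesis using c by (auto simp: coch_def)
qed

lemma zero_coch: "(\<lambda>_. 0) \<in> coch n s u"
  by (simp add: coch_def)

text \<open>A graded submodule of a free module is a family \<open>Z\<close> of spaces of scalar vectors that increases
  with the degree; generators are found by their leading positions.\<close>

definition graded_family :: "nat \<Rightarrow> (nat \<Rightarrow> 'g) \<Rightarrow> ('g \<Rightarrow> (nat \<Rightarrow> 'k) set) \<Rightarrow> bool" where
  "graded_family n s Z \<longleftrightarrow> (\<forall>u. Z u \<subseteq> coch n s u \<and> (\<lambda>_. 0) \<in> Z u) \<and>
     (\<forall>u v w q. v \<in> Z u \<longrightarrow> w \<in> Z u \<longrightarrow> (\<lambda>l. v l - q * w l) \<in> Z u) \<and>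
     (\<forall>u x v. v \<in> Z u \<longrightarrow> x \<in> S \<longrightarrow> v \<in> Z (u + x))"

text \<open>A Groebner basis argument with scalars. The degrees in which some vector of
  \<open>Z\<close> starts at position \<open>l\<close>, shifted by \<open>s l\<close>, form an
  \<open>S\<close>-stable subset of \<open>S\<close>, hence have finitely many generators. One
  vector is kept for each of them, and multiples of these clear the positions of a given vector in
  order.\<close>

lemma graded_family_generators:
  assumes Z: "graded_family n s Z"
  shows "\<exists>n' s' D. (\<forall>p<n'. (\<lambda>l. D l p) \<in> Z (s' p)) \<and>
    (\<forall>u v. v \<in> Z u \<longrightarrow> (\<exists>w\<in>coch n' s' u. v = (\<lambda>l. \<Sum>p<n'. D l p * w p)))"
proof -
  have Zc: "v \<in> Z u \<Longrightarrow> v \<in> coch n s u" and Zd: "v \<in> Z u \<Longrightarrow> w \<in> Z u \<Longrightarrow> (\<lambda>l. v l - q * w l) \<in> Z u"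
    and Zm: "v \<in> Z u \<Longrightarrow> x \<in> S \<Longrightarrow> v \<in> Z (u + x)" for u v w x q
    using Z by (auto simp: graded_family_def)
  define U where "U l = {u. \<exists>v\<in>Z u. v l = 1 \<and> (\<forall>l'<l. v l' = 0)}" for l
  have "\<exists>Q\<subseteq>U l. finite Q \<and> (\<forall>u\<in>U l. \<exists>q\<in>Q. u - q \<in> S)" for l
  proof -
    define V where "V = (\<lambda>u. u - s l) ` U l"
    have "V \<subseteq> S"
    proof
      fix x assume "x \<in> V"
      then obtain u v where "x = u - s l" "v \<in> Z u" "v l = 1" by (auto simp: V_def U_def)
      then show "x \<in> S" using Zc[of v u] by (auto simp: coch_def)
    qed
    moreover have "x + v \<in> V" if x: "x \<in> S" and v: "v \<in> V" for x v
    proof -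
      obtain u where u: "v = u - s l" "u \<in> U l" using v by (auto simp: V_def)
      have "x + v = (u + x) - s l" using u by simp
      moreover have "u + x \<in> U l" using u Zm x by (auto simp: U_def)
      ultimately show ?thesis unfolding V_def by (rule image_eqI)
    qed
    ultimately obtain Q where Q: "Q \<subseteq> V" "finite Q" "\<forall>v\<in>V. \<exists>q\<in>Q. v - q \<in> S"
      using upset_finitely_generated[of V] by blast
    have "(\<lambda>q. q + s l) ` Q \<subseteq> U l" using Q(1) by (auto simp: V_def)
    moreover have "\<exists>q\<in>(\<lambda>q. q + s l) ` Q. u - q \<in> S" if "u \<in> U l" for u
    proof -
      have "u - s l \<in> V" using that by (simp add: V_def)
      then obtain q where "q \<in> Q" "u - s l - q \<in> S" using Q(3) by blast
      then show ?thesis by (intro bexI[of _ "q + s l"]) (simp_all add: algebra_simps)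
    qed
    ultimately show ?thesis using Q(2) by blast
  qed
  then obtain Q where Q: "\<And>l. Q l \<subseteq> U l" "\<And>l. finite (Q l)" "\<And>l u. u \<in> U l \<Longrightarrow> \<exists>q\<in>Q l. u - q \<in> S"
    by metis
  define G where "G l q = (SOME v. v \<in> Z q \<and> v l = 1 \<and> (\<forall>l'<l. v l' = 0))" for l q
  have "G l q \<in> Z q \<and> G l q l = 1 \<and> (\<forall>l'<l. G l q l' = 0)" if "q \<in> Q l" for l q
  proof -
    have "\<exists>v. v \<in> Z q \<and> v l = 1 \<and> (\<forall>l'<l. v l' = 0)" using Q(1)[of l] that by (auto simp: U_def)
    from someI_ex[OF this] show ?thesis unfolding G_def .
  qed
  then have G: "\<And>l q. q \<in> Q l \<Longrightarrow> G l q \<in> Z q" "\<And>l q. q \<in> Q l \<Longrightarrow> G l q l = 1"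
      "\<And>l q l'. q \<in> Q l \<Longrightarrow> l' < l \<Longrightarrow> G l q l' = 0" by auto
  define P where "P = (SIGMA l:{..<n}. Q l)"
  have P: "finite P" using Q(2) by (auto simp: P_def)
  \<comment> \<open>Induction on the number \<open>m\<close> of positions, counted from the end, at
    which \<open>v\<close> may still be nonzero.\<close>
  have gen: "\<exists>W. (\<forall>x. W x \<noteq> 0 \<longrightarrow> x \<in> P \<and> u - snd x \<in> S) \<and> v = (\<lambda>l. \<Sum>x\<in>P. G (fst x) (snd x) l * W x)"
    if "m \<le> n" "v \<in> Z u" "\<forall>l<n - m. v l = 0" for m u v
    using that
  proof (induction m arbitrary: v)
    case 0
    then have "v = (\<lambda>_. 0)" using Zc[OF 0(2)] by (auto simp: coch_def)
    then show ?case by (intro exI[of _ "\<lambda>_. 0"]) simp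
  next
    case (Suc m)
    define k where "k = n - Suc m"
    have k: "k < n" "n - m = Suc k" using Suc.prems(1) by (auto simp: k_def)
    have vk: "v l = 0" if "l < k" for l using Suc.prems(3) that by (simp add: k_def)
    show ?case
    proof (cases "v k = 0")
      case True
      then have "\<forall>l<n - m. v l = 0" using vk k by (auto simp: less_Suc_eq)
      then show ?thesis using Suc.IH[of v] Suc.prems by simp
    next
      case False
      \<comment> \<open>This is \<open>v / v k\<close>, written in the form \<open>v - q w\<close>
        under which the family is closed.\<close>
      have "(\<lambda>l. v l - (1 - 1 / v k) * v l) \<in> Z u" by (rule Zd[OF Suc.prems(2,2)])
      then have "u \<in> U k" unfolding U_def using False vk
        by (intro CollectI bexI[of _ "\<lambda>l. v l - (1 - 1 / v k) * v l"]) (auto simp: field_simps)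
      then obtain q where q: "q \<in> Q k" "u - q \<in> S" using Q(3) by blast
      have "G k q \<in> Z u" using Zm[OF G(1)[OF q(1)] q(2)] by simp
      then have v': "(\<lambda>l. v l - v k * G k q l) \<in> Z u" by (rule Zd[OF Suc.prems(2)])
      have v0: "\<forall>l<n - m. v l - v k * G k q l = 0"
        using vk G(2,3)[OF q(1)] k by (auto simp: less_Suc_eq)
      have "m \<le> n" using Suc.prems(1) by simp
      from Suc.IH[OF this v' v0] obtain W where W': "\<forall>x. W x \<noteq> 0 \<longrightarrow> x \<in> P \<and> u - snd x \<in> S"
          and W2: "(\<lambda>l. v l - v k * G k q l) = (\<lambda>l. \<Sum>x\<in>P. G (fst x) (snd x) l * W x)"
        by (elim exE conjE)
      note W = W'[rule_format] W2
      have kq: "(k, q) \<in> P" using k q by (simp add: P_def)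
      define W' where "W' x = W x + (if x = (k, q) then v k else 0)" for x
      have "W' x \<noteq> 0 \<Longrightarrow> x \<in> P \<and> u - snd x \<in> S" for x
        using W(1)[of x] kq q by (auto simp: W'_def split: if_splits)
      moreover have "v l = (\<Sum>x\<in>P. G (fst x) (snd x) l * W' x)" for l
      proof -
        have "(\<Sum>x\<in>P. G (fst x) (snd x) l * W' x)
            = (\<Sum>x\<in>P. G (fst x) (snd x) l * W x) + (\<Sum>x\<in>P. if x = (k, q) then G k q l * v k else 0)"
          unfolding sum.distrib[symmetric] W'_def by (intro sum.cong) (auto simp: algebra_simps)
        also have "\<dots> = (v l - v k * G k q l) + G k q l * v k" using fun_cong[OF W(2), of l] kq P by simp
        finally show ?thesis by simp
      qed
      ultimately show ?thesis by blast
    qed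
  qed
  obtain p where p: "bij_betw p {..<card P} P"
    using ex_bij_betw_nat_finite[OF P] by (auto simp: atLeast0LessThan)
  have "(\<lambda>l. G (fst (p i)) (snd (p i)) l) \<in> Z (snd (p i))" if "i < card P" for i
  proof -
    have "p i \<in> P" using p that by (auto simp: bij_betw_def)
    then show ?thesis using G(1) by (auto simp: P_def)
  qed
  moreover have "\<exists>w\<in>coch (card P) (\<lambda>i. snd (p i)) u. v = (\<lambda>l. \<Sum>i<card P. G (fst (p i)) (snd (p i)) l * w i)"
    if "v \<in> Z u" for u v
  proof -
    have "\<forall>l<n - n. v l = 0" by simp
    from gen[OF order_refl that this] obtain W where W': "\<forall>x. W x \<noteq> 0 \<longrightarrow> x \<in> P \<and> u - snd x \<in> S"
        and W2: "v = (\<lambda>l. \<Sum>x\<in>P. G (fst x) (snd x) l * W x)"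
      by (elim exE conjE)
    note W = W'[rule_format] W2
    define w where "w i = (if i < card P then W (p i) else 0)" for i
    have "w \<in> coch (card P) (\<lambda>i. snd (p i)) u" using W(1) by (auto simp: coch_def w_def)
    moreover have "(\<Sum>x\<in>P. G (fst x) (snd x) l * W x) = (\<Sum>i<card P. G (fst (p i)) (snd (p i)) l * w i)" for l
      unfolding sum.reindex_bij_betw[OF p, symmetric] by (intro sum.cong) (auto simp: w_def)
    ultimately show ?thesis using W(2) by auto
  qed
  ultimately show ?thesis
    by (intro exI[of _ "card P"] exI[of _ "\<lambda>i. snd (p i)"] exI[of _ "\<lambda>l i. G (fst (p i)) (snd (p i)) l"]) blast
qed

lemma graded_family_kernel:
  "graded_family n' s' (\<lambda>u. {w \<in> coch n' s' u. \<forall>l<n. (\<Sum>p<n'. D l p * w p) = 0})"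
  unfolding graded_family_def
proof (intro conjI allI impI)
  fix u v w q
  assume "v \<in> {w \<in> coch n' s' u. \<forall>l<n. (\<Sum>p<n'. D l p * w p) = 0}"
    and "w \<in> {w \<in> coch n' s' u. \<forall>l<n. (\<Sum>p<n'. D l p * w p) = 0}"
  then have v: "v \<in> coch n' s' u" "\<forall>l<n. (\<Sum>p<n'. D l p * v p) = 0"
    and w: "w \<in> coch n' s' u" "\<forall>l<n. (\<Sum>p<n'. D l p * w p) = 0" by auto
  have "(\<lambda>l. v l - q * w l) \<in> coch n' s' u" using v w by (auto simp: coch_def) (metis mult_zero_right)+
  moreover have "(\<Sum>p<n'. D l p * (v p - q * w p)) = (\<Sum>p<n'. D l p * v p) - q * (\<Sum>p<n'. D l p * w p)" for l
    by (simp add: algebra_simps sum_subtractf sum_distrib_left)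
  ultimately show "(\<lambda>l. v l - q * w l) \<in> {w \<in> coch n' s' u. \<forall>l<n. (\<Sum>p<n'. D l p * w p) = 0}"
    using v w by simp
qed (auto intro: coch_mono simp: zero_coch)

text \<open>Iterated syzygies: \<open>Z i\<close> is the submodule to be covered at step
  \<open>i\<close>, the columns of \<open>D i\<close> are generators of it, and the relations among
  them are \<open>Z (Suc i)\<close>. The start is the maximal ideal, the kernel of the
  augmentation.\<close>

lemma resolution_matrices_exist:
  "\<exists>n s D Z. n 0 = 1 \<and> s 0 = (\<lambda>_. 0) \<and> Z 0 = (\<lambda>u. {v \<in> coch 1 (\<lambda>_. 0) u. u = 0 \<longrightarrow> v 0 = 0}) \<and>
     (\<forall>i u. Z i u \<subseteq> coch (n i) (s i) u) \<and>
     (\<forall>i. \<forall>p<n (Suc i). (\<lambda>l. D i l p) \<in> Z i (s (Suc i) p)) \<and>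
     (\<forall>i u v. v \<in> Z i u \<longrightarrow> (\<exists>w\<in>coch (n (Suc i)) (s (Suc i)) u. v = (\<lambda>l. \<Sum>p<n (Suc i). D i l p * w p))) \<and>
     (\<forall>i. graded_family (n i) (s i) (Z i)) \<and>
     (\<forall>i. Z (Suc i) = (\<lambda>u. {w \<in> coch (n (Suc i)) (s (Suc i)) u. \<forall>l<n i. (\<Sum>p<n (Suc i). D i l p * w p) = 0}))"
proof -
  define Z0 :: "'g \<Rightarrow> (nat \<Rightarrow> 'k) set" where "Z0 = (\<lambda>u. {v \<in> coch 1 (\<lambda>_. 0) u. u = 0 \<longrightarrow> v 0 = 0})"
  define valid where "valid i = (\<lambda>(n, s, Z, D :: nat \<Rightarrow> nat \<Rightarrow> 'k). graded_family n s Z \<and>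
    (i = 0 \<longrightarrow> n = 1 \<and> s = (\<lambda>_. 0) \<and> Z = Z0))" for i :: nat
  define step where "step = (\<lambda>(n :: nat, s :: nat \<Rightarrow> 'g, Z, D :: nat \<Rightarrow> nat \<Rightarrow> 'k) (n', s', Z', D').
    (\<forall>p<n'. (\<lambda>l. D' l p) \<in> Z (s' p)) \<and>
    (\<forall>u v. v \<in> Z u \<longrightarrow> (\<exists>w\<in>coch n' s' u. v = (\<lambda>l. \<Sum>p<n'. D' l p * w p))) \<and>
    Z' = (\<lambda>u. {w \<in> coch n' s' u. \<forall>l<n. (\<Sum>p<n'. D' l p * w p) = 0}))"
  have "graded_family 1 (\<lambda>_. 0) Z0"
    unfolding graded_family_def
  proof (intro conjI allI impI)
    fix u v w q assume "v \<in> Z0 u" "w \<in> Z0 u"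
    then show "(\<lambda>l. v l - q * w l) \<in> Z0 u"
      by (auto simp: Z0_def coch_def) (metis mult_zero_right)+
  next
    fix u x v assume v: "v \<in> Z0 u" and x: "x \<in> S"
    \<comment> \<open>Multiplication by a monomial cannot lead into degree 0 from another degree of
      \<open>S\<close>, as \<open>S\<close> is pointed.\<close>
    have "v 0 = 0" if "u + x = 0"
    proof (rule ccontr)
      assume "v 0 \<noteq> 0"
      then have "u \<in> S" "u \<noteq> 0" using v by (auto simp: Z0_def coch_def)
      moreover have "- u \<in> S" using x that by (metis add.commute add_eq_0_iff)
      ultimately show False using pointed by blast
    qed
    then show "v \<in> Z0 (u + x)" using v x coch_mono by (simp add: Z0_def)
  qed (auto simp: Z0_def zero_coch)
  then have base: "\<exists>x. valid 0 x" by (intro exI[of _ "(1, \<lambda>_. 0, Z0, \<lambda>_ _. 0)"]) (simp add: valid_def)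
  have "\<exists>y. valid (Suc i) y \<and> step x y" if "valid i x" for x i
  proof -
    obtain n s Z D where x: "x = (n, s, Z, D)" by (cases x) auto
    then have "graded_family n s Z" using that by (simp add: valid_def)
    from graded_family_generators[OF this] obtain n' s' D' where D':
      "\<forall>p<n'. (\<lambda>l. D' l p) \<in> Z (s' p)"
      "\<forall>u v. v \<in> Z u \<longrightarrow> (\<exists>w\<in>coch n' s' u. v = (\<lambda>l. \<Sum>p<n'. D' l p * w p))" by blast
    show ?thesis
      by (intro exI[of _ "(n', s', \<lambda>u. {w \<in> coch n' s' u. \<forall>l<n. (\<Sum>p<n'. D' l p * w p) = 0}, D')"])
        (use D' graded_family_kernel in \<open>simp add: valid_def step_def x\<close>)
  qed
  from dependent_nat_choice[of valid "\<lambda>_. step", OF base this]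
  obtain f where f: "\<And>i. valid i (f i)" "\<And>i. step (f i) (f (Suc i))" by blast
  define n where "n i = fst (f i)" for i
  define s where "s i = fst (snd (f i))" for i
  define Z where "Z i = fst (snd (snd (f i)))" for i
  \<comment> \<open>A state carries the matrix through which it was reached, so \<open>D i\<close>
    is read off from the state at \<open>Suc i\<close>.\<close>
  define D where "D i = snd (snd (snd (f (Suc i))))" for i
  have fi: "f i = (n i, s i, Z i, snd (snd (snd (f i))))" for i by (simp add: n_def s_def Z_def)
  have "graded_family (n i) (s i) (Z i)" for i using f(1)[of i] by (subst (asm) fi) (simp add: valid_def)
  moreover have "n 0 = 1 \<and> s 0 = (\<lambda>_. 0) \<and> Z 0 = Z0" using f(1)[of 0] by (subst (asm) fi) (simp add: valid_def)
  moreover have "(\<forall>p<n (Suc i). (\<lambda>l. D i l p) \<in> Z i (s (Suc i) p)) \<and>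
     (\<forall>u v. v \<in> Z i u \<longrightarrow> (\<exists>w\<in>coch (n (Suc i)) (s (Suc i)) u. v = (\<lambda>l. \<Sum>p<n (Suc i). D i l p * w p))) \<and>
     Z (Suc i) = (\<lambda>u. {w \<in> coch (n (Suc i)) (s (Suc i)) u. \<forall>l<n i. (\<Sum>p<n (Suc i). D i l p * w p) = 0})" for i
    using f(2)[of i] by (subst (asm) fi, subst (asm) fi[of "Suc i"]) (simp add: step_def D_def)
  ultimately show ?thesis
    unfolding Z0_def by (intro exI[of _ n] exI[of _ s] exI[of _ D] exI[of _ Z]) (auto simp: graded_family_def)
qed

end

section \<open>Existence of resolutions and the matrices of a given one\<close>

context pointed_semigroup_algebra
begin

lemma graded_family_sum:
  fixes m :: nat
  assumes Z: "graded_family n s Z" and g: "\<And>p. p < m \<Longrightarrow> w p \<noteq> 0 \<Longrightarrow> g p \<in> Z u"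
  shows "(\<lambda>l. \<Sum>p<m. g p l * w p) \<in> Z u"
  using g
proof (induction m)
  case 0
  then show ?case using Z by (simp add: graded_family_def)
next
  case (Suc m)
  have IH: "(\<lambda>l. \<Sum>p<m. g p l * w p) \<in> Z u" using Suc by simp
  show ?case
  proof (cases "w m = 0")
    case False
    then have "(\<lambda>l. (\<Sum>p<m. g p l * w p) - (- w m) * g m l) \<in> Z u"
      using Z IH Suc.prems[of m] unfolding graded_family_def by blast
    then show ?thesis by (simp add: mult.commute)
  qed (use IH in simp)
qed

text \<open>Without it, \<open>chosen_resolution\<close> would be an unspecified value about which
  nothing could be proved.\<close>

lemma resolution_exists: "\<exists>F. graded_free_resolution R (monomial_grading S) res_field res_field_grading F"
proof -
  obtain n s D Z where n0: "n 0 = 1" and s0: "s 0 = (\<lambda>_. 0)"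
    and Z0: "Z 0 = (\<lambda>u. {v \<in> coch 1 (\<lambda>_. 0) u. u = 0 \<longrightarrow> v 0 = 0})"
    and "\<forall>i u. Z i u \<subseteq> coch (n i) (s i) u"
    and col: "\<forall>i. \<forall>p<n (Suc i). (\<lambda>l. D i l p) \<in> Z i (s (Suc i) p)"
    and gen: "\<forall>i u v. v \<in> Z i u \<longrightarrow> (\<exists>w\<in>coch (n (Suc i)) (s (Suc i)) u. v = (\<lambda>l. \<Sum>p<n (Suc i). D i l p * w p))"
    and fam: "\<forall>i. graded_family (n i) (s i) (Z i)"
    and ZSuc: "\<forall>i. Z (Suc i) = (\<lambda>u. {w \<in> coch (n (Suc i)) (s (Suc i)) u. \<forall>l<n i. (\<Sum>p<n (Suc i). D i l p * w p) = 0})"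
    using resolution_matrices_exist by (elim exE conjE)
  note col = col[rule_format] and gen = gen[rule_format] and fam = fam[rule_format] and ZSuc = ZSuc[rule_format]
  have Zc: "Z i u \<subseteq> coch (n i) (s i) u" for i u using fam[of i] by (simp add: graded_family_def)
  have entry': "l < n i \<and> s (Suc i) p - s i l \<in> S" if "p < n (Suc i)" "D i l p \<noteq> 0" for i l p
    using col[OF that(1)] Zc that(2) by (auto simp: coch_def)
  have entry: "s (Suc i) p - s i l \<in> S" if "l < n i" "p < n (Suc i)" "D i l p \<noteq> 0" for i l p
    using entry' that by blast
  \<comment> \<open>Columns of \<open>D i\<close> vanish from row \<open>n i\<close> on, which
    reconciles the sums of the construction with the truncated ones of
    \<open>mat_map\<close>.\<close>
  have cut: "(\<lambda>l. \<Sum>p<n (Suc i). D i l p * w p) = (\<lambda>l. if l < n i then \<Sum>p<n (Suc i). D i l p * w p else 0)" for i w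
  proof (rule ext)
    fix l
    have "D i l p = 0" if "\<not> l < n i" "p < n (Suc i)" for p using entry'[OF that(2)] that(1) by blast
    then show "(\<Sum>p<n (Suc i). D i l p * w p) = (if l < n i then \<Sum>p<n (Suc i). D i l p * w p else 0)" by simp
  qed
  define M where "M i = mat_map (n i) (s i) (n (Suc i)) (s (Suc i)) (D i)" for i
  have image: "M i ` carrier (free_module R (n (Suc i))) = {v \<in> carrier (free_module R (n i)). \<forall>u. comp (n i) (s i) u v \<in> Z i u}" for i
    unfolding M_def
  proof (rule image_mat_map)
    fix u w assume w: "w \<in> coch (n (Suc i)) (s (Suc i)) u"
    have "(\<lambda>l. \<Sum>p<n (Suc i). D i l p * w p) \<in> Z i u"
    proof (rule graded_family_sum[OF fam])
      fix p assume p: "p < n (Suc i)" "w p \<noteq> 0"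
      then have "u - s (Suc i) p \<in> S" using w by (auto simp: coch_def)
      then have "(\<lambda>l. D i l p) \<in> Z i (s (Suc i) p + (u - s (Suc i) p))"
        using fam[of i] col[OF p(1)] unfolding graded_family_def by blast
      then show "(\<lambda>l. D i l p) \<in> Z i u" by simp
    qed
    then show "(\<lambda>l. if l < n i then \<Sum>p<n (Suc i). D i l p * w p else 0) \<in> Z i u" unfolding cut .
  next
    fix u v assume "v \<in> Z i u"
    then show "\<exists>w\<in>coch (n (Suc i)) (s (Suc i)) u. v = (\<lambda>l. if l < n i then \<Sum>j<n (Suc i). D i l j * w j else 0)"
      using gen unfolding cut by blast
  qed (rule entry)
  define aug where "aug v = cs (Poly_Mapping.lookup (v 0 :: 'g \<Rightarrow>\<^sub>0 'k) 0)" for v :: "nat \<Rightarrow> 'g \<Rightarrow>\<^sub>0 'k"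
  define F :: "('g \<Rightarrow>\<^sub>0 'k, ('g \<Rightarrow>\<^sub>0 'k) set, 'g) graded_resolution" where
    "F = \<lparr>res_rank = n, res_shift = s, res_diff = M, res_aug = aug\<rparr>"
  have F: "res_rank F = n" "res_shift F = s" "res_diff F = M" "res_aug F = aug" by (simp_all add: F_def)
  have "graded_free_resolution R (monomial_grading S) res_field res_field_grading F"
    unfolding graded_free_resolution_def F
  proof (intro conjI allI)
    show "aug \<in> module_hom R (free_module R (n 0)) res_field"
      by (auto simp: module_hom_def aug_def res_field_simps n0 free_module_simps lookup_add lookup_times_zero)
    show "homogeneous_of_degree 0 (free_grading R (monomial_grading S) (n 0) (s 0)) res_field_grading aug"
      unfolding homogeneous_of_degree_def
    proof (intro allI subsetI)
      fix g X assume "X \<in> aug ` free_grading R (monomial_grading S) (n 0) (s 0) g"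
      then obtain v where v: "v 0 \<in> monomial_span (S \<inter> {g})" "X = aug v"
        by (auto simp: free_grading_def n0 s0 monomial_grading_def)
      then show "X \<in> res_field_grading (g + 0)"
        using monomial_spanD[OF v(1), of 0] by (cases "g = 0") (auto simp: res_field_grading_simps aug_def cs_inject)
    qed
    show "M i \<in> module_hom R (free_module R (n (Suc i))) (free_module R (n i))" for i
      unfolding M_def by (rule mat_map_hom) (rule entry)
    show "homogeneous_of_degree 0 (free_grading R (monomial_grading S) (n (Suc i)) (s (Suc i)))
        (free_grading R (monomial_grading S) (n i) (s i)) (M i)" for i
      unfolding M_def by (rule mat_map_homogeneous) (rule entry)
    have "cs c \<in> aug ` carrier (free_module R (n 0))" for c
    proof
      show "cs c = aug (\<lambda>j. if j = 0 then Poly_Mapping.single 0 c else 0)" by (simp add: aug_def)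
      show "(\<lambda>j. if j = 0 then Poly_Mapping.single 0 c else 0) \<in> carrier (free_module R (n 0))"
        by (simp add: free_module_simps n0 single_zero_span)
    qed
    then show "aug ` carrier (free_module R (n 0)) = carrier res_field"
      by (auto simp: res_field_simps) (auto simp: aug_def)
    have "comp 1 (\<lambda>_. 0) u v \<in> Z 0 u \<longleftrightarrow> (u = 0 \<longrightarrow> Poly_Mapping.lookup (v 0) 0 = 0)"
      if "v \<in> carrier (free_module R 1)" for u v
      using comp_coch[OF that] by (simp add: Z0) (simp add: comp_def)
    then have "(\<forall>u. comp 1 (\<lambda>_. 0) u v \<in> Z 0 u) \<longleftrightarrow> Poly_Mapping.lookup (v 0) 0 = 0"
      if "v \<in> carrier (free_module R 1)" for v
      using that by blast
    then show "M 0 ` carrier (free_module R (n 1)) = {v \<in> carrier (free_module R (n 0)). aug v = \<zero>\<^bsub>res_field\<^esub>}"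
      using image[of 0] by (auto simp: n0 s0 aug_def res_field_simps cs_inject)
    show "M (Suc i) ` carrier (free_module R (n (Suc (Suc i)))) =
        {v \<in> carrier (free_module R (n (Suc i))). M i v = \<zero>\<^bsub>free_module R (n i)\<^esub>}" for i
      unfolding image[of "Suc i"] free_module_simps(2)
      by (rule Collect_cong, rule conj_cong[OF refl]) (simp add: M_def kernel_mat_map ZSuc comp_coch)
  qed
  then show ?thesis by blast
qed

lemma coch_unit: "p < n \<Longrightarrow> (\<lambda>j. if j = p then 1 else 0) \<in> coch n s (s p)"
  by (simp add: coch_def S_zero)

text \<open>Homogeneity turns the differentials into scalar matrices. Exactness of modules becomes
  exactness in each degree by testing it on vectors concentrated in that degree.\<close>

lemma resolution_matrices:
  assumes F: "graded_free_resolution R (monomial_grading S) res_field res_field_grading F"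
  shows "\<exists>D \<epsilon>. augmented_graded_matrices S (res_rank F) (res_shift F) D \<epsilon> \<and>
    (\<forall>i. \<forall>v\<in>carrier (res_module R F (Suc i)). res_diff F i v =
      mat_map (res_rank F i) (res_shift F i) (res_rank F (Suc i)) (res_shift F (Suc i)) (D i) v)"
proof -
  define n where "n = res_rank F"
  define s where "s = res_shift F"
  have aug: "res_aug F \<in> module_hom R (free_module R (n 0)) res_field"
      "homogeneous_of_degree 0 (free_grading R (monomial_grading S) (n 0) (s 0)) res_field_grading (res_aug F)"
      "res_aug F ` carrier (free_module R (n 0)) = carrier res_field"
    and diff: "\<And>i. res_diff F i \<in> module_hom R (free_module R (n (Suc i))) (free_module R (n i))"
      "\<And>i. homogeneous_of_degree 0 (free_grading R (monomial_grading S) (n (Suc i)) (s (Suc i)))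
        (free_grading R (monomial_grading S) (n i) (s i)) (res_diff F i)"
    and ex0: "res_diff F 0 ` carrier (free_module R (n 1)) =
        {v \<in> carrier (free_module R (n 0)). res_aug F v = \<zero>\<^bsub>res_field\<^esub>}"
    and ex: "\<And>i. res_diff F (Suc i) ` carrier (free_module R (n (Suc (Suc i)))) =
        {v \<in> carrier (free_module R (n (Suc i))). res_diff F i v = \<zero>\<^bsub>free_module R (n i)\<^esub>}"
    using F by (auto simp: graded_free_resolution_def n_def s_def)
  obtain D where D: "\<And>i l j. l < n i \<Longrightarrow> j < n (Suc i) \<Longrightarrow> D i l j \<noteq> 0 \<Longrightarrow> s (Suc i) j - s i l \<in> S"
      "\<And>i v. v \<in> carrier (free_module R (n (Suc i))) \<Longrightarrow> res_diff F i v = mat_map (n i) (s i) (n (Suc i)) (s (Suc i)) (D i) v"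
    using hom_mat_map[OF diff] by metis
  define K where "K i = (\<lambda>u :: 'g. {c. \<forall>l<n i. (\<Sum>j<n (Suc i). D i l j * c j) = 0})" for i
  have im: "mat_map (n (Suc i)) (s (Suc i)) (n (Suc (Suc i))) (s (Suc (Suc i))) (D (Suc i)) ` carrier (free_module R (n (Suc (Suc i))))
      = {v \<in> carrier (free_module R (n (Suc i))). \<forall>u. comp (n (Suc i)) (s (Suc i)) u v \<in> K i u}" for i
  proof -
    have "mat_map (n (Suc i)) (s (Suc i)) (n (Suc (Suc i))) (s (Suc (Suc i))) (D (Suc i)) ` carrier (free_module R (n (Suc (Suc i))))
        = res_diff F (Suc i) ` carrier (free_module R (n (Suc (Suc i))))"
      using D(2) by (intro image_cong) auto
    also have "\<dots> = {v \<in> carrier (free_module R (n (Suc i))). \<forall>u. comp (n (Suc i)) (s (Suc i)) u v \<in> K i u}"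
      unfolding ex by (rule Collect_cong, rule conj_cong[OF refl])
        (simp add: D(2) free_module_simps(2) kernel_mat_map K_def)
    finally show ?thesis .
  qed
  have K0: "(\<lambda>_. 0) \<in> K i u" for i u by (simp add: K_def)
  \<comment> \<open>Reads the scalar off a residue class, so that the augmentation becomes a
    functional with value \<open>\<epsilon> j\<close> at the \<open>j\<close>-th basis
    vector.\<close>
  define \<kappa> where "\<kappa> X = (THE c. X = cs c)" for X
  have \<kappa>: "\<kappa> (cs c) = c" for c by (simp add: \<kappa>_def cs_inject)
  have aug_cs: "res_aug F v = cs (\<kappa> (res_aug F v))" if "v \<in> carrier (free_module R (n 0))" for v
  proof -
    have "res_aug F v \<in> range cs" using aug(3) that unfolding res_field_simps by blast
    then obtain c where "res_aug F v = cs c" by blast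
    then show ?thesis by (simp add: \<kappa>)
  qed
  define \<epsilon> where "\<epsilon> j = \<kappa> (res_aug F (unit_vec j))" for j
  have aug_sum: "\<kappa> (res_aug F v) = (\<Sum>j<n 0. Poly_Mapping.lookup (v j) 0 * \<epsilon> j)"
    if v: "v \<in> carrier (free_module R (n 0))" for v
    unfolding \<epsilon>_def
  proof (rule free_expand[where h = "\<lambda>v. \<kappa> (res_aug F v)" and act = "\<lambda>r x. Poly_Mapping.lookup r 0 * x", OF _ _ v])
    fix v w assume v: "v \<in> carrier (free_module R (n 0))" and w: "w \<in> carrier (free_module R (n 0))"
    have "res_aug F (v \<oplus>\<^bsub>free_module R (n 0)\<^esub> w) = cs (\<kappa> (res_aug F v)) \<oplus>\<^bsub>res_field\<^esub> cs (\<kappa> (res_aug F w))"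
      using aug(1) v w aug_cs by (auto simp: module_hom_def)
    then show "\<kappa> (res_aug F (v \<oplus>\<^bsub>free_module R (n 0)\<^esub> w)) = \<kappa> (res_aug F v) + \<kappa> (res_aug F w)"
      by (simp add: res_field_simps \<kappa>)
  next
    fix r :: "'g \<Rightarrow>\<^sub>0 'k" and v assume r: "r \<in> monomial_span S" and v: "v \<in> carrier (free_module R (n 0))"
    have "res_aug F (r \<odot>\<^bsub>free_module R (n 0)\<^esub> v) = r \<odot>\<^bsub>res_field\<^esub> cs (\<kappa> (res_aug F v))"
      using aug(1) r v aug_cs by (auto simp: module_hom_def)
    then show "\<kappa> (res_aug F (r \<odot>\<^bsub>free_module R (n 0)\<^esub> v)) = Poly_Mapping.lookup r 0 * \<kappa> (res_aug F v)"
      using r by (simp add: res_field_simps \<kappa>)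
  qed
  have \<epsilon>_degree: "s 0 j = 0" if j: "j < n 0" "\<epsilon> j \<noteq> 0" for j
  proof (rule ccontr)
    assume "s 0 j \<noteq> 0"
    have "unit_vec j \<in> free_grading R (monomial_grading S) (n 0) (s 0) (s 0 j)"
      using unit_vec_carrier[OF j(1)] S_zero
      by (auto simp: free_grading_def monomial_grading_def unit_vec_def monomial_span_def)
    then have "res_aug F (unit_vec j) \<in> res_field_grading (s 0 j + 0)"
      using aug(2) unfolding homogeneous_of_degree_def by blast
    then have "res_aug F (unit_vec j) = cs 0" using \<open>s 0 j \<noteq> 0\<close> by (simp add: res_field_grading_simps)
    then show False using j(2) by (simp add: \<epsilon>_def \<kappa>)
  qed
  define K' where "K' = (\<lambda>u :: 'g. {c. u = 0 \<longrightarrow> (\<Sum>j<n 0. \<epsilon> j * c j) = 0})"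
  have im0: "mat_map (n 0) (s 0) (n 1) (s 1) (D 0) ` carrier (free_module R (n 1))
      = {v \<in> carrier (free_module R (n 0)). \<forall>u. comp (n 0) (s 0) u v \<in> K' u}"
  proof -
    have "mat_map (n 0) (s 0) (n 1) (s 1) (D 0) ` carrier (free_module R (n 1)) = res_diff F 0 ` carrier (free_module R (n 1))"
      using D(2)[of _ 0] by (intro image_cong) auto
    also have "\<dots> = {v \<in> carrier (free_module R (n 0)). \<forall>u. comp (n 0) (s 0) u v \<in> K' u}"
      unfolding ex0
    proof (rule Collect_cong, rule conj_cong[OF refl])
      fix v assume v: "v \<in> carrier (free_module R (n 0))"
      have "res_aug F v = \<zero>\<^bsub>res_field\<^esub> \<longleftrightarrow> (\<Sum>j<n 0. Poly_Mapping.lookup (v j) 0 * \<epsilon> j) = 0"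
        using aug_cs[OF v] aug_sum[OF v] by (metis cs_inject res_field_simps(2))
      also have "(\<Sum>j<n 0. Poly_Mapping.lookup (v j) 0 * \<epsilon> j) = (\<Sum>j<n 0. \<epsilon> j * comp (n 0) (s 0) 0 v j)"
      proof (rule sum.cong[OF refl])
        fix j assume "j \<in> {..<n 0}"
        then show "Poly_Mapping.lookup (v j) 0 * \<epsilon> j = \<epsilon> j * comp (n 0) (s 0) 0 v j"
          using \<epsilon>_degree[of j] by (cases "\<epsilon> j = 0") (auto simp: comp_def)
      qed
      finally show "res_aug F v = \<zero>\<^bsub>res_field\<^esub> \<longleftrightarrow> (\<forall>u. comp (n 0) (s 0) u v \<in> K' u)"
        by (simp add: K'_def)
    qed
    finally show ?thesis .
  qed
  have K'0: "(\<lambda>_. 0) \<in> K' u" for u by (simp add: K'_def)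
  have gm: "graded_matrices S n s D"
  proof
    show "s (Suc i) j - s i l \<in> S" if "D i l j \<noteq> 0" "l < n i" "j < n (Suc i)" for i l j using D(1) that by blast
    fix i l p assume l: "l < n i" and p: "p < n (Suc (Suc i))"
    \<comment> \<open>Tested on the \<open>p\<close>-th unit vector, exactness puts column
      \<open>p\<close> of \<open>D (Suc i)\<close> into the kernel of \<open>D i\<close>.\<close>
    have "(\<Sum>j<n (Suc (Suc i)). D (Suc i) q j * (if j = p then 1 else 0)) = D (Suc i) q p" for q
      using p by (simp add: if_distrib cong: if_cong)
    from image_mat_mapD'[OF im coch_unit[OF p], unfolded this]
    have "(\<lambda>q. if q < n (Suc i) then D (Suc i) q p else 0) \<in> K i (s (Suc (Suc i)) p)" .
    then show "(\<Sum>q<n (Suc i). D i l q * D (Suc i) q p) = 0" using l by (simp add: K_def)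
  qed
  interpret gm: graded_matrices S n s D by (rule gm)
  have coch: "gm.cochain S u i = coch (n i) (s i) u" for u i by (auto simp: gm.cochain_def gm.supp_def coch_def)
  have "augmented_graded_matrices S n s D \<epsilon>"
  proof
    show "0 \<in> S" by (rule S_zero)
    show "x \<in> S \<Longrightarrow> - x \<in> S \<Longrightarrow> x = 0" for x by (rule pointed)
    show "j < n 0 \<Longrightarrow> \<epsilon> j \<noteq> 0 \<Longrightarrow> s 0 j = 0" for j by (rule \<epsilon>_degree)
    show "\<exists>j<n 0. \<epsilon> j \<noteq> 0"
    proof (rule ccontr)
      assume "\<not> ?thesis"
      then have "\<kappa> (res_aug F v) = 0" if "v \<in> carrier (free_module R (n 0))" for v
        using aug_sum[OF that] by simp
      moreover obtain v where "v \<in> carrier (free_module R (n 0))" "cs 1 = res_aug F v"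
        using aug(3) by (metis imageE rangeI res_field_simps(1))
      ultimately show False using \<kappa>[of 1] by simp
    qed
  next
    fix j assume j: "j < n 1" "s 1 j = 0"
    have "(\<Sum>q<n 1. D 0 l q * (if q = j then 1 else 0)) = D 0 l j" for l
      using j by (simp add: if_distrib cong: if_cong)
    from image_mat_mapD'[OF im0 coch_unit[OF j(1)], unfolded this]
    have "(\<lambda>l. if l < n 0 then D 0 l j else 0) \<in> K' (s 1 j)" .
    then show "(\<Sum>l<n 0. \<epsilon> l * D 0 l j) = 0" using j by (simp add: K'_def)
  next
    fix v u i assume v: "v \<in> gm.cochain S u (Suc i)" and ker: "\<forall>l\<in>gm.supp S u i. (\<Sum>j<n (Suc i). D i l j * v j) = 0"
    \<comment> \<open>Rows outside the support impose no new condition: a nonzero term would put the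
      row inside it.\<close>
    have "(\<Sum>j<n (Suc i). D i l j * v j) = 0" if l: "l < n i" for l
    proof (cases "l \<in> gm.supp S u i")
      case False
      have "D i l j * v j = 0" if j: "j < n (Suc i)" for j
      proof (rule ccontr)
        assume "D i l j * v j \<noteq> 0"
        then have "s (Suc i) j - s i l \<in> S" "u - s (Suc i) j \<in> S" using D(1)[OF l j] v by (auto simp: gm.cochain_def gm.supp_def)
        then have "(s (Suc i) j - s i l) + (u - s (Suc i) j) \<in> S" by (rule S_add)
        then show False using False l by (simp add: gm.supp_def)
      qed
      then show ?thesis by (simp add: sum.neutral)
    qed (use ker in blast)
    then have "v \<in> K i u" by (simp add: K_def)
    then obtain w where "w \<in> coch (n (Suc (Suc i))) (s (Suc (Suc i))) u"
        "v = (\<lambda>l. if l < n (Suc i) then \<Sum>j<n (Suc (Suc i)). D (Suc i) l j * w j else 0)"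
      using image_mat_mapD[OF im K0] v coch by blast
    then show "\<exists>w\<in>gm.cochain S u (Suc (Suc i)). \<forall>j\<in>gm.supp S u (Suc i). v j = (\<Sum>p<n (Suc (Suc i)). D (Suc i) j p * w p)"
      unfolding coch by (intro bexI[of _ w]) (auto simp: gm.supp_def)
  next
    fix v u assume v: "v \<in> gm.cochain S u 0" and ker: "u = 0 \<Longrightarrow> (\<Sum>j<n 0. \<epsilon> j * v j) = 0"
    then have "v \<in> K' u" by (simp add: K'_def)
    then obtain w where "w \<in> coch (n 1) (s 1) u" "v = (\<lambda>l. if l < n 0 then \<Sum>j<n 1. D 0 l j * w j else 0)"
      using image_mat_mapD[OF im0 K'0] v coch by blast
    then show "\<exists>w\<in>gm.cochain S u 1. \<forall>j\<in>gm.supp S u 0. v j = (\<Sum>p<n 1. D 0 j p * w p)"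
      unfolding coch by (intro bexI[of _ w]) (auto simp: gm.supp_def)
  qed
  then show ?thesis using D(2) unfolding n_def s_def by blast
qed

end

section \<open>Ext of the residue field\<close>

lemma monomial_module_simps:
  "carrier (monomial_module H) = monomial_span H" "zero (monomial_module H) = 0"
  "add (monomial_module H) = (+)" "smult (monomial_module H) = (*)"
  by (simp_all add: monomial_module_def)

context graded_matrices
begin

lemma zero_boundary: "(\<lambda>_. 0) \<in> boundary T u i"
proof (cases i)
  case (Suc k)
  have "(\<lambda>_. 0) \<in> cochain T u k" by (simp add: cochain_def)
  moreover have "cod T u k (\<lambda>_. 0) = (\<lambda>_. 0)" by (simp add: cod_def fun_eq_iff)
  ultimately show ?thesis using Suc by (metis boundary_Suc image_eqI)
qed simp

lemma boundary_diff:
  assumes "c \<in> boundary T u i" "e \<in> boundary T u i"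
  shows "(\<lambda>j. c j - q * e j) \<in> boundary T u i"
proof (cases i)
  case (Suc k)
  then obtain b b' where "b \<in> cochain T u k" "c = cod T u k b" "b' \<in> cochain T u k" "e = cod T u k b'"
    using assms by auto
  then have "(\<lambda>j. c j - q * e j) = cod T u k (\<lambda>j. b j - q * b' j)" "(\<lambda>j. b j - q * b' j) \<in> cochain T u k"
    by (simp_all add: cod_diff cochain_diff)
  then show ?thesis using Suc by auto
qed (use assms in simp)

lemma boundary_sum:
  assumes "\<And>p. p \<in> P \<Longrightarrow> g p \<in> boundary T u i"
  shows "(\<lambda>j. \<Sum>p\<in>P. r p * g p j) \<in> boundary T u i"
  using assms
proof (induction P rule: infinite_finite_induct)
  case (insert x F)
  then have "(\<lambda>j. (\<Sum>p\<in>F. r p * g p j) - (- r x) * g x j) \<in> boundary T u i"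
    by (intro boundary_diff) auto
  then show ?case using insert.hyps by (simp add: add.commute)
qed (simp_all add: zero_boundary)

text \<open>Multiplication by the monomial of degree \<open>p\<close> takes cochains of degree
  \<open>- (u + p)\<close> to those of degree \<open>- u\<close>; on coefficient vectors it is the
  inclusion of the smaller support.\<close>

lemma boundary_mono:
  assumes down: "\<And>t x. t \<in> T \<Longrightarrow> x \<in> S \<Longrightarrow> t - x \<in> T" and p: "p \<in> S"
  shows "boundary T (u + p) i \<subseteq> boundary T u i"
proof (cases i)
  case (Suc k)
  have supp_mono: "supp T (u + p) m \<subseteq> supp T u m" for m
  proof
    fix l assume l: "l \<in> supp T (u + p) m"
    then have "u + p - s m l \<in> T" by (simp add: supp_def)
    then have "u + p - s m l - p \<in> T" using p by (rule down)
    then show "l \<in> supp T u m" using l by (simp add: supp_def algebra_simps)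
  qed
  have "cod T (u + p) k b \<in> boundary T u (Suc k)" if b: "b \<in> cochain T (u + p) k" for b
  proof -
    have "(\<Sum>l<n k. b l * D k l j) = 0" if j: "j \<in> supp T u (Suc k)" "j \<notin> supp T (u + p) (Suc k)" for j
    proof (rule sum.neutral, rule ballI, rule ccontr)
      fix l assume l: "l \<in> {..<n k}" and nz: "b l * D k l j \<noteq> 0"
      then have "u + p - s k l \<in> T" using b by (auto simp: cochain_def supp_def)
      moreover have "s (Suc k) j - s k l \<in> S" using entry_degree nz l j by (auto simp: supp_def)
      ultimately have "u + p - s k l - (s (Suc k) j - s k l) \<in> T" by (rule down)
      then show False using j by (simp add: supp_def)
    qed
    then have "cod T (u + p) k b = cod T u k b" using supp_mono[of "Suc k"] by (auto simp: cod_def fun_eq_iff)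
    moreover have "b \<in> cochain T u k" using b supp_mono by (auto simp: cochain_def)
    ultimately show ?thesis by simp
  qed
  then show ?thesis using Suc by auto
qed simp

end

text \<open>A homomorphism of degree \<open>- u\<close> sends the \<open>l\<close>-th basis vector
  to degree \<open>s i l - u\<close>. This lies in \<open>H\<close> iff \<open>u - s i l\<close>
  lies in \<open>- H\<close>, which is why \<open>T\<close> is the negative of
  \<open>H\<close>.\<close>

locale dual_cochains = pointed_semigroup_algebra S R
  for S :: "'g::ab_group_add set" and R :: "('g \<Rightarrow>\<^sub>0 'k::field) ring" +
  fixes H :: "'g set" and F :: "('g \<Rightarrow>\<^sub>0 'k, ('g \<Rightarrow>\<^sub>0 'k) set, 'g) graded_resolution"
    and D :: "nat \<Rightarrow> nat \<Rightarrow> nat \<Rightarrow> 'k"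
  assumes H_add: "x \<in> S \<Longrightarrow> y \<in> H \<Longrightarrow> x + y \<in> H"
    and matrices: "graded_matrices S (res_rank F) (res_shift F) D"
    and diff_carrier: "v \<in> carrier (res_module R F (Suc i)) \<Longrightarrow> res_diff F i v \<in> carrier (res_module R F i)"
    and diff_hom: "res_diff F i \<in> module_hom R (res_module R F (Suc i)) (res_module R F i)"
    and diff_mat: "v \<in> carrier (res_module R F (Suc i)) \<Longrightarrow> res_diff F i v =
      mat_map (res_rank F i) (res_shift F i) (res_rank F (Suc i)) (res_shift F (Suc i)) (D i) v"
begin

abbreviation "C \<equiv> monomial_module H :: ('g \<Rightarrow>\<^sub>0 'k, 'g \<Rightarrow>\<^sub>0 'k) module"
abbreviation "n \<equiv> res_rank F"
abbreviation "s \<equiv> res_shift F"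
abbreviation "T \<equiv> uminus ` H"

sublocale gm: graded_matrices S n s D by (rule matrices)

lemma T_iff: "t \<in> T \<longleftrightarrow> - t \<in> H"
  by (metis image_iff minus_minus)

lemma T_down: "t \<in> T \<Longrightarrow> x \<in> S \<Longrightarrow> t - x \<in> T"
  using H_add[of x "- t"] by (simp add: T_iff)

lemma H_times: "r \<in> monomial_span S \<Longrightarrow> x \<in> monomial_span H \<Longrightarrow> r * x \<in> monomial_span H"
  by (rule monomial_span_times) (use H_add in auto)

lemma cochains_simps:
  "carrier (cochains R F C i) = module_hom R (free_module R (n i)) C \<inter> extensional (carrier (free_module R (n i)))"
  "zero (cochains R F C i) = (\<lambda>x\<in>carrier (free_module R (n i)). 0)"
  "add (cochains R F C i) \<phi> \<psi> = (\<lambda>x\<in>carrier (free_module R (n i)). \<phi> x + \<psi> x)"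
  "smult (cochains R F C i) r \<phi> = (\<lambda>x\<in>carrier (free_module R (n i)). r * \<phi> x)"
  by (simp_all add: cochains_def hom_module_def monomial_module_simps)

lemma free_add_closed: "v \<in> carrier (free_module R m) \<Longrightarrow> w \<in> carrier (free_module R m) \<Longrightarrow> v \<oplus>\<^bsub>free_module R m\<^esub> w \<in> carrier (free_module R m)"
  and free_smult_closed: "r \<in> monomial_span S \<Longrightarrow> v \<in> carrier (free_module R m) \<Longrightarrow> r \<odot>\<^bsub>free_module R m\<^esub> v \<in> carrier (free_module R m)"
  by (auto simp: free_module_simps)

definition hom_of :: "nat \<Rightarrow> (nat \<Rightarrow> 'g \<Rightarrow>\<^sub>0 'k) \<Rightarrow> (nat \<Rightarrow> 'g \<Rightarrow>\<^sub>0 'k) \<Rightarrow> 'g \<Rightarrow>\<^sub>0 'k" where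
  "hom_of i w = (\<lambda>v\<in>carrier (free_module R (n i)). \<Sum>l<n i. v l * w l)"

lemma hom_of_carrier:
  assumes w: "\<And>l. l < n i \<Longrightarrow> w l \<in> monomial_span H"
  shows "hom_of i w \<in> carrier (cochains R F C i)"
proof -
  have "(\<Sum>l<n i. v l * w l) \<in> monomial_span H" if "v \<in> carrier (free_module R (n i))" for v
    using w free_carrier_span[OF that] by (auto intro!: monomial_span_sum H_times)
  moreover have "(\<Sum>l<n i. (v \<oplus>\<^bsub>free_module R (n i)\<^esub> v') l * w l) = (\<Sum>l<n i. v l * w l) + (\<Sum>l<n i. v' l * w l)" for v v'
    by (simp add: free_module_simps sum.distrib algebra_simps)
  moreover have "(\<Sum>l<n i. (r \<odot>\<^bsub>free_module R (n i)\<^esub> v) l * w l) = r * (\<Sum>l<n i. v l * w l)" for r v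
    by (simp add: free_module_simps sum_distrib_left mult.assoc)
  ultimately show ?thesis
    by (simp add: cochains_simps module_hom_def hom_of_def monomial_module_simps free_add_closed free_smult_closed)
qed

lemma hom_of_unit: "l < n i \<Longrightarrow> hom_of i w (unit_vec l) = w l"
  by (simp add: hom_of_def unit_vec_carrier) (simp add: unit_vec_def if_distrib[of "\<lambda>x. x * _"] cong: if_cong)

lemma cochain_apply:
  assumes \<phi>: "\<phi> \<in> carrier (cochains R F C i)" and v: "v \<in> carrier (free_module R (n i))"
  shows "\<phi> v = (\<Sum>l<n i. v l * \<phi> (unit_vec l))"
  using \<phi> by (intro free_expand[where h = \<phi> and act = "(*)", OF _ _ v])
    (simp_all add: cochains_simps module_hom_def monomial_module_simps)

lemma cochain_span:
  "\<phi> \<in> carrier (cochains R F C i) \<Longrightarrow> v \<in> carrier (free_module R (n i)) \<Longrightarrow> \<phi> v \<in> monomial_span H"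
  by (auto simp: cochains_simps module_hom_def monomial_module_simps)

lemma cochain_eqI:
  assumes \<phi>: "\<phi> \<in> carrier (cochains R F C i)" and \<psi>: "\<psi> \<in> carrier (cochains R F C i)"
    and eq: "\<And>l. l < n i \<Longrightarrow> \<phi> (unit_vec l) = \<psi> (unit_vec l)"
  shows "\<phi> = \<psi>"
proof (rule extensionalityI[of _ "carrier (free_module R (n i))"])
  show "\<phi> v = \<psi> v" if "v \<in> carrier (free_module R (n i))" for v
    using cochain_apply[OF \<phi> that] cochain_apply[OF \<psi> that] eq by simp
qed (use \<phi> \<psi> in \<open>auto simp: cochains_simps\<close>)

text \<open>\<open>ccomp i u \<phi>\<close> lists the coefficients of the homogeneous component of \<open>\<phi>\<close> of degree \<open>- u\<close>.\<close>

definition ccomp :: "nat \<Rightarrow> 'g \<Rightarrow> ((nat \<Rightarrow> 'g \<Rightarrow>\<^sub>0 'k) \<Rightarrow> 'g \<Rightarrow>\<^sub>0 'k) \<Rightarrow> nat \<Rightarrow> 'k" where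
  "ccomp i u \<phi> = (\<lambda>l. if l < n i then Poly_Mapping.lookup (\<phi> (unit_vec l)) (s i l - u) else 0)"

lemma ccomp_cochain:
  assumes \<phi>: "\<phi> \<in> carrier (cochains R F C i)" shows "ccomp i u \<phi> \<in> gm.cochain T u i"
proof -
  have "s i l - u \<in> H" if "l < n i" "Poly_Mapping.lookup (\<phi> (unit_vec l)) (s i l - u) \<noteq> 0" for l
    using monomial_spanD[OF cochain_span[OF \<phi> unit_vec_carrier] that(2)] that(1) by simp
  then show ?thesis by (auto simp: gm.cochain_def gm.supp_def ccomp_def T_iff)
qed

lemma ccomp_eqI:
  assumes \<phi>: "\<phi> \<in> carrier (cochains R F C i)" and \<psi>: "\<psi> \<in> carrier (cochains R F C i)"
    and eq: "\<And>u. ccomp i u \<phi> = ccomp i u \<psi>"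
  shows "\<phi> = \<psi>"
proof (rule cochain_eqI[OF \<phi> \<psi>], rule poly_mapping_eqI)
  fix l x assume "l < n i"
  then show "Poly_Mapping.lookup (\<phi> (unit_vec l)) x = Poly_Mapping.lookup (\<psi> (unit_vec l)) x"
    using fun_cong[OF eq[of "s i l - x"], of l] by (simp add: ccomp_def)
qed

lemma ccomp_finite: "finite {u. ccomp i u \<phi> \<noteq> (\<lambda>_. 0)}"
proof (rule finite_subset)
  show "{u. ccomp i u \<phi> \<noteq> (\<lambda>_. 0)} \<subseteq> (\<Union>l<n i. (\<lambda>x. s i l - x) ` Poly_Mapping.keys (\<phi> (unit_vec l)))"
  proof
    fix u assume "u \<in> {u. ccomp i u \<phi> \<noteq> (\<lambda>_. 0)}"
    then obtain l where l: "l < n i" "Poly_Mapping.lookup (\<phi> (unit_vec l)) (s i l - u) \<noteq> 0"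
      by (auto simp: ccomp_def fun_eq_iff split: if_splits)
    then have "u \<in> (\<lambda>x. s i l - x) ` Poly_Mapping.keys (\<phi> (unit_vec l))"
      by (intro image_eqI[of _ _ "s i l - u"]) (auto simp: in_keys_iff)
    then show "u \<in> (\<Union>l<n i. (\<lambda>x. s i l - x) ` Poly_Mapping.keys (\<phi> (unit_vec l)))" using l by blast
  qed
qed auto

lemma ccomp_assemble:
  assumes c: "\<And>u. c u \<in> gm.cochain T u i" and fin: "finite {u. c u \<noteq> (\<lambda>_. 0)}"
  shows "\<exists>\<phi>\<in>carrier (cochains R F C i). \<forall>u. ccomp i u \<phi> = c u"
proof -
  define w where "w l = Abs_poly_mapping (\<lambda>g. if l < n i then c (s i l - g) l else 0)" for l
  have "finite {g. (if l < n i then c (s i l - g) l else 0) \<noteq> 0}" for l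
  proof (rule finite_subset)
    show "{g. (if l < n i then c (s i l - g) l else 0) \<noteq> 0} \<subseteq> (\<lambda>u. s i l - u) ` {u. c u \<noteq> (\<lambda>_. 0)}"
    proof
      fix g assume "g \<in> {g. (if l < n i then c (s i l - g) l else 0) \<noteq> 0}"
      then have "c (s i l - g) \<noteq> (\<lambda>_. 0)" by (auto split: if_splits)
      then show "g \<in> (\<lambda>u. s i l - u) ` {u. c u \<noteq> (\<lambda>_. 0)}" by (intro image_eqI[of _ _ "s i l - g"]) auto
    qed
  qed (use fin in auto)
  then have lk: "Poly_Mapping.lookup (w l) = (\<lambda>g. if l < n i then c (s i l - g) l else 0)" for l
    unfolding w_def by simp
  have "w l \<in> monomial_span H" if "l < n i" for l
  proof (rule monomial_spanI)
    fix x assume "Poly_Mapping.lookup (w l) x \<noteq> 0"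
    then show "x \<in> H" using c[of "s i l - x"] by (auto simp: lk gm.cochain_def gm.supp_def T_iff split: if_splits)
  qed
  then have "hom_of i w \<in> carrier (cochains R F C i)" by (rule hom_of_carrier)
  moreover have "ccomp i u (hom_of i w) = c u" for u
    by (rule ext) (use c[of u] in \<open>auto simp: ccomp_def hom_of_unit lk gm.cochain_def gm.supp_def\<close>)
  ultimately show ?thesis by blast
qed

lemma codiff_carrier:
  assumes \<phi>: "\<phi> \<in> carrier (cochains R F C i)" shows "codiff R F i \<phi> \<in> carrier (cochains R F C (Suc i))"
proof -
  have \<phi>_add: "\<phi> (v \<oplus>\<^bsub>free_module R (n i)\<^esub> w) = \<phi> v + \<phi> w"
    if "v \<in> carrier (free_module R (n i))" "w \<in> carrier (free_module R (n i))" for v w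
    using \<phi> that by (simp add: cochains_simps module_hom_def monomial_module_simps)
  have \<phi>_smult: "\<phi> (r \<odot>\<^bsub>free_module R (n i)\<^esub> v) = r * \<phi> v"
    if "r \<in> monomial_span S" "v \<in> carrier (free_module R (n i))" for r v
    using \<phi> that by (simp add: cochains_simps module_hom_def monomial_module_simps)
  have "codiff R F i \<phi> \<in> module_hom R (free_module R (n (Suc i))) C"
    unfolding module_hom_def monomial_module_simps
  proof (intro CollectI conjI ballI funcsetI)
    fix v assume v: "v \<in> carrier (free_module R (n (Suc i)))"
    then show "codiff R F i \<phi> v \<in> monomial_span H"
      using cochain_span[OF \<phi> diff_carrier[OF v]] by (simp add: codiff_def)
    fix w assume w: "w \<in> carrier (free_module R (n (Suc i)))"
    have "res_diff F i (v \<oplus>\<^bsub>free_module R (n (Suc i))\<^esub> w) = res_diff F i v \<oplus>\<^bsub>free_module R (n i)\<^esub> res_diff F i w"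
      using diff_hom[of i] v w by (simp add: module_hom_def)
    then show "codiff R F i \<phi> (v \<oplus>\<^bsub>free_module R (n (Suc i))\<^esub> w) = codiff R F i \<phi> v + codiff R F i \<phi> w"
      using v w \<phi>_add[OF diff_carrier[OF v] diff_carrier[OF w]] free_add_closed[OF v w] by (simp add: codiff_def)
  next
    fix r v assume r: "r \<in> carrier R" and v: "v \<in> carrier (free_module R (n (Suc i)))"
    have "res_diff F i (r \<odot>\<^bsub>free_module R (n (Suc i))\<^esub> v) = r \<odot>\<^bsub>free_module R (n i)\<^esub> res_diff F i v"
      using diff_hom[of i] r v by (simp add: module_hom_def)
    then show "codiff R F i \<phi> (r \<odot>\<^bsub>free_module R (n (Suc i))\<^esub> v) = r * codiff R F i \<phi> v"
      using r v \<phi>_smult[OF _ diff_carrier[OF v]] free_smult_closed[OF _ v] by (simp add: codiff_def)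
  qed
  then show ?thesis by (simp add: cochains_simps codiff_def)
qed

text \<open>Precomposition with the differential multiplies the coefficient vector of each component
  by the transposed matrix; this identifies \<open>Hom(F, C)\<close> with the scalar
  complexes.\<close>

lemma ccomp_codiff:
  assumes \<phi>: "\<phi> \<in> carrier (cochains R F C i)"
  shows "ccomp (Suc i) u (codiff R F i \<phi>) = gm.cod T u i (ccomp i u \<phi>)"
proof (rule ext)
  fix j
  show "ccomp (Suc i) u (codiff R F i \<phi>) j = gm.cod T u i (ccomp i u \<phi>) j"
  proof (cases "j \<in> gm.supp T u (Suc i)")
    case False
    then show ?thesis using ccomp_cochain[OF codiff_carrier[OF \<phi>], of u]
      by (auto simp: gm.cod_def gm.cochain_def)
  next
    case True
    then have j: "j < n (Suc i)" by (simp add: gm.supp_def)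
    have u: "unit_vec j \<in> carrier (free_module R (n (Suc i)))" by (rule unit_vec_carrier[OF j])
    have "mat_map (n i) (s i) (n (Suc i)) (s (Suc i)) (D i) (unit_vec j) l = Poly_Mapping.single (s (Suc i) j - s i l) (D i l j)"
      if "l < n i" for l
    proof -
      have "(\<Sum>p<n (Suc i). Poly_Mapping.single (s (Suc i) p - s i l) (D i l p) * unit_vec j p)
          = (\<Sum>p<n (Suc i). if p = j then Poly_Mapping.single (s (Suc i) j - s i l) (D i l j) else 0)"
        by (intro sum.cong) (auto simp: unit_vec_def)
      then show ?thesis using that j by (simp add: mat_map_def)
    qed
    then have "codiff R F i \<phi> (unit_vec j) = (\<Sum>l<n i. Poly_Mapping.single (s (Suc i) j - s i l) (D i l j) * \<phi> (unit_vec l))"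
      using cochain_apply[OF \<phi> diff_carrier[OF u]] u by (simp add: codiff_def diff_mat)
    then have "ccomp (Suc i) u (codiff R F i \<phi>) j = (\<Sum>l<n i. D i l j * Poly_Mapping.lookup (\<phi> (unit_vec l)) (s i l - u))"
      using j by (simp add: ccomp_def lookup_sum lookup_single_times)
    also have "\<dots> = (\<Sum>l<n i. ccomp i u \<phi> l * D i l j)"
      by (intro sum.cong) (auto simp: ccomp_def)
    finally show ?thesis using True by (simp add: gm.cod_def)
  qed
qed

lemma ccomp_zero: "ccomp i u (\<lambda>x\<in>carrier (free_module R (n i)). 0) = (\<lambda>_. 0)"
  by (auto simp: ccomp_def unit_vec_carrier fun_eq_iff)

lemma zero_cochain: "(\<lambda>x\<in>carrier (free_module R (n i)). 0) \<in> carrier (cochains R F C i)"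
  by (auto simp: cochains_simps module_hom_def monomial_module_simps free_add_closed free_smult_closed)

lemma cocycles_iff:
  "\<phi> \<in> cocycles R F C i \<longleftrightarrow> \<phi> \<in> carrier (cochains R F C i) \<and> (\<forall>u. ccomp i u \<phi> \<in> gm.cocycle T u i)"
proof -
  have "codiff R F i \<phi> = (\<lambda>x\<in>carrier (free_module R (n (Suc i))). 0) \<longleftrightarrow> (\<forall>u. gm.cod T u i (ccomp i u \<phi>) = (\<lambda>_. 0))"
    if \<phi>: "\<phi> \<in> carrier (cochains R F C i)"
  proof
    assume "codiff R F i \<phi> = (\<lambda>x\<in>carrier (free_module R (n (Suc i))). 0)"
    then show "\<forall>u. gm.cod T u i (ccomp i u \<phi>) = (\<lambda>_. 0)"
      unfolding ccomp_codiff[OF \<phi>, symmetric] by (simp only: ccomp_zero) simp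
  next
    assume *: "\<forall>u. gm.cod T u i (ccomp i u \<phi>) = (\<lambda>_. 0)"
    show "codiff R F i \<phi> = (\<lambda>x\<in>carrier (free_module R (n (Suc i))). 0)"
      by (rule ccomp_eqI[OF codiff_carrier[OF \<phi>] zero_cochain])
        (simp only: ccomp_codiff[OF \<phi>] ccomp_zero *[rule_format])
  qed
  moreover have "(\<forall>u. ccomp i u \<phi> \<in> gm.cocycle T u i) \<longleftrightarrow> (\<forall>u. gm.cod T u i (ccomp i u \<phi>) = (\<lambda>_. 0))"
    if "\<phi> \<in> carrier (cochains R F C i)"
    unfolding gm.cocycle_def mem_Collect_eq using ccomp_cochain[OF that] by blast
  ultimately show ?thesis unfolding cocycles_def cochains_simps(2) mem_Collect_eq by blast
qed

lemma coboundaries_iff: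
  "\<phi> \<in> coboundaries R F C i \<longleftrightarrow> \<phi> \<in> carrier (cochains R F C i) \<and> (\<forall>u. ccomp i u \<phi> \<in> gm.boundary T u i)"
proof (cases i)
  case 0
  have "\<phi> = (\<lambda>x\<in>carrier (free_module R (n 0)). 0) \<longleftrightarrow> \<phi> \<in> carrier (cochains R F C 0) \<and> (\<forall>u. ccomp 0 u \<phi> = (\<lambda>_. 0))"
    using ccomp_eqI[OF _ zero_cochain, of \<phi> 0] zero_cochain[of 0] ccomp_zero[of 0] by metis
  then show ?thesis using 0 by (simp add: coboundaries_def cochains_simps(2))
next
  case (Suc k)
  have "\<phi> \<in> codiff R F k ` carrier (cochains R F C k)"
    if \<phi>: "\<phi> \<in> carrier (cochains R F C (Suc k))" and b: "\<And>u. ccomp (Suc k) u \<phi> \<in> gm.boundary T u (Suc k)"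
  proof -
    \<comment> \<open>Vanishing components again get the preimage 0, so that the preimages can be
      assembled into one cochain.\<close>
    have "\<exists>c. c \<in> gm.cochain T u k \<and> ccomp (Suc k) u \<phi> = gm.cod T u k c \<and> (ccomp (Suc k) u \<phi> = (\<lambda>_. 0) \<longrightarrow> c = (\<lambda>_. 0))" for u
    proof (cases "ccomp (Suc k) u \<phi> = (\<lambda>_. 0)")
      case True
      then show ?thesis by (intro exI[of _ "\<lambda>_. 0"]) (auto simp: gm.cochain_def gm.cod_def)
    next
      case False
      then show ?thesis using b[of u] by auto
    qed
    then obtain c where c: "\<And>u. c u \<in> gm.cochain T u k" "\<And>u. ccomp (Suc k) u \<phi> = gm.cod T u k (c u)"
        "\<And>u. ccomp (Suc k) u \<phi> = (\<lambda>_. 0) \<Longrightarrow> c u = (\<lambda>_. 0)" by metis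
    have "finite {u. c u \<noteq> (\<lambda>_. 0)}" by (rule finite_subset[OF _ ccomp_finite[of "Suc k" \<phi>]]) (use c(3) in blast)
    then obtain \<psi> where \<psi>: "\<psi> \<in> carrier (cochains R F C k)" "\<And>u. ccomp k u \<psi> = c u"
      using ccomp_assemble[OF c(1)] by blast
    have "\<phi> = codiff R F k \<psi>"
      by (rule ccomp_eqI[OF \<phi> codiff_carrier[OF \<psi>(1)]]) (simp add: ccomp_codiff[OF \<psi>(1)] \<psi>(2) c(2))
    then show ?thesis using \<psi>(1) by blast
  qed
  moreover have "codiff R F k \<psi> \<in> carrier (cochains R F C (Suc k)) \<and> ccomp (Suc k) u (codiff R F k \<psi>) \<in> gm.boundary T u (Suc k)"
    if "\<psi> \<in> carrier (cochains R F C k)" for \<psi> u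
    using codiff_carrier[OF that] ccomp_codiff[OF that] ccomp_cochain[OF that] by simp
  ultimately show ?thesis unfolding Suc coboundaries_def by (auto simp del: gm.boundary_Suc)
qed

end

context graded_matrices
begin

lemma cocycle_diff: "c \<in> cocycle T u i \<Longrightarrow> e \<in> cocycle T u i \<Longrightarrow> (\<lambda>j. c j - q * e j) \<in> cocycle T u i"
  by (simp add: cocycle_def cochain_diff cod_diff)

lemma zero_cocycle: "(\<lambda>_. 0) \<in> cocycle T u i"
  by (simp add: cocycle_def cochain_def cod_def fun_eq_iff)

lemma boundary_cocycle:
  assumes down: "\<And>t x. t \<in> T \<Longrightarrow> x \<in> S \<Longrightarrow> t - x \<in> T"
  shows "boundary T u i \<subseteq> cocycle T u i"
proof (cases i)
  case 0
  then show ?thesis by (simp add: zero_cocycle)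
next
  case (Suc k)
  have "cod T u (Suc k) (cod T u k b) = (\<lambda>_. 0)" if "b \<in> cochain T u k" for b
    using that down by (intro cod_cod) auto
  then show ?thesis using Suc cod_cochain by (auto simp: cocycle_def)
qed

end

section \<open>Ext as a graded module\<close>

context dual_cochains
begin

lemma cochain_combination:
  assumes r: "r \<in> monomial_span S" "r' \<in> monomial_span S"
    and \<phi>: "\<phi> \<in> carrier (cochains R F C i)" and \<psi>: "\<psi> \<in> carrier (cochains R F C i)"
  shows "(\<lambda>x\<in>carrier (free_module R (n i)). r * \<phi> x + r' * \<psi> x) \<in> carrier (cochains R F C i)"
proof -
  define \<eta> where "\<eta> = hom_of i (\<lambda>l. r * \<phi> (unit_vec l) + r' * \<psi> (unit_vec l))"
  have "\<eta> \<in> carrier (cochains R F C i)"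
    unfolding \<eta>_def using r cochain_span[OF \<phi> unit_vec_carrier] cochain_span[OF \<psi> unit_vec_carrier]
    by (intro hom_of_carrier monomial_span_add H_times)
  moreover have "\<eta> = (\<lambda>x\<in>carrier (free_module R (n i)). r * \<phi> x + r' * \<psi> x)"
    unfolding \<eta>_def hom_of_def
  proof (rule restrict_ext)
    fix v assume v: "v \<in> carrier (free_module R (n i))"
    show "(\<Sum>l<n i. v l * (r * \<phi> (unit_vec l) + r' * \<psi> (unit_vec l))) = r * \<phi> v + r' * \<psi> v"
      by (simp add: cochain_apply[OF \<phi> v] cochain_apply[OF \<psi> v] sum_distrib_left sum.distrib algebra_simps)
  qed
  ultimately show ?thesis by simp
qed

text \<open>Unlike the description by components, this one makes closure under the module operations
  immediate.\<close>

lemma cocycles_iff_apply: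
  "\<phi> \<in> cocycles R F C i \<longleftrightarrow> \<phi> \<in> carrier (cochains R F C i) \<and>
     (\<forall>v\<in>carrier (free_module R (n (Suc i))). \<phi> (res_diff F i v) = 0)"
proof -
  have "codiff R F i \<phi> = (\<lambda>x\<in>carrier (free_module R (n (Suc i))). 0) \<longleftrightarrow>
      (\<forall>v\<in>carrier (free_module R (n (Suc i))). \<phi> (res_diff F i v) = 0)"
  proof (intro iffI ballI)
    fix v assume "codiff R F i \<phi> = (\<lambda>x\<in>carrier (free_module R (n (Suc i))). 0)" "v \<in> carrier (free_module R (n (Suc i)))"
    then have "codiff R F i \<phi> v = 0" "v \<in> carrier (free_module R (n (Suc i)))" by simp_all
    then show "\<phi> (res_diff F i v) = 0" by (simp add: codiff_def)
  qed (auto simp: codiff_def intro: restrict_ext)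
  then show ?thesis by (simp add: cocycles_def cochains_simps(2))
qed

lemma cocycle_combination:
  assumes r: "r \<in> monomial_span S" "r' \<in> monomial_span S"
    and \<phi>: "\<phi> \<in> cocycles R F C i" and \<psi>: "\<psi> \<in> cocycles R F C i"
  shows "(\<lambda>x\<in>carrier (free_module R (n i)). r * \<phi> x + r' * \<psi> x) \<in> cocycles R F C i"
  using cochain_combination[OF r, of \<phi> i \<psi>] \<phi> \<psi> diff_carrier by (simp add: cocycles_iff_apply)

lemma cocycle_module_simps:
  "carrier (cocycle_module R F C i) = cocycles R F C i"
  "add (cocycle_module R F C i) \<phi> \<psi> = (\<lambda>x\<in>carrier (free_module R (n i)). \<phi> x + \<psi> x)"
  "smult (cocycle_module R F C i) r \<phi> = (\<lambda>x\<in>carrier (free_module R (n i)). r * \<phi> x)"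
  by (simp_all add: cocycle_module_def cochains_simps[of i, simplified] cochains_def hom_module_def monomial_module_simps)

lemma cocycle_extensional: "\<phi> \<in> cocycles R F C i \<Longrightarrow> (\<lambda>x\<in>carrier (free_module R (n i)). \<phi> x) = \<phi>"
  by (simp add: cocycles_iff_apply cochains_simps extensional_restrict)

lemma cocycle_closed:
  assumes \<phi>: "\<phi> \<in> cocycles R F C i"
  shows "\<psi> \<in> cocycles R F C i \<Longrightarrow> (\<lambda>x\<in>carrier (free_module R (n i)). \<phi> x + \<psi> x) \<in> cocycles R F C i"
    and "r \<in> monomial_span S \<Longrightarrow> (\<lambda>x\<in>carrier (free_module R (n i)). r * \<phi> x) \<in> cocycles R F C i"
    and "\<psi> \<in> cocycles R F C i \<Longrightarrow> \<exists>\<eta>\<in>cocycles R F C i. \<psi> = (\<lambda>x\<in>carrier (free_module R (n i)). \<eta> x + \<phi> x)"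
proof -
  show "(\<lambda>x\<in>carrier (free_module R (n i)). \<phi> x + \<psi> x) \<in> cocycles R F C i" if "\<psi> \<in> cocycles R F C i"
    using cocycle_combination[OF B_1 B_1 \<phi> that] by simp
  show "(\<lambda>x\<in>carrier (free_module R (n i)). r * \<phi> x) \<in> cocycles R F C i" if "r \<in> monomial_span S"
    using cocycle_combination[OF that B_0 \<phi> \<phi>] by simp
  assume \<psi>: "\<psi> \<in> cocycles R F C i"
  have "(\<lambda>x\<in>carrier (free_module R (n i)). 1 * \<psi> x + (- 1) * \<phi> x) \<in> cocycles R F C i"
    by (rule cocycle_combination[OF _ _ \<psi> \<phi>]) auto
  moreover have "\<psi> = (\<lambda>x\<in>carrier (free_module R (n i)).
      (\<lambda>x\<in>carrier (free_module R (n i)). 1 * \<psi> x + (- 1) * \<phi> x) x + \<phi> x)"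
    by (subst cocycle_extensional[OF \<psi>, symmetric], rule restrict_ext) simp
  ultimately show "\<exists>\<eta>\<in>cocycles R F C i. \<psi> = (\<lambda>x\<in>carrier (free_module R (n i)). \<eta> x + \<phi> x)" by blast
qed

lemma zero_cocycles: "(\<lambda>x\<in>carrier (free_module R (n i)). 0) \<in> cocycles R F C i"
  by (simp add: cocycles_iff zero_cochain ccomp_zero gm.zero_cocycle)

lemma coboundaries_cocycles: "coboundaries R F C i \<subseteq> cocycles R F C i"
proof
  fix \<phi> assume "\<phi> \<in> coboundaries R F C i"
  then show "\<phi> \<in> cocycles R F C i"
    unfolding coboundaries_iff cocycles_iff using subsetD[OF gm.boundary_cocycle[OF T_down]] by blast
qed

lemma ccomp_add: "ccomp i u (\<lambda>x\<in>carrier (free_module R (n i)). \<phi> x + \<psi> x) = (\<lambda>l. ccomp i u \<phi> l + ccomp i u \<psi> l)"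
  by (rule ext) (simp add: ccomp_def unit_vec_carrier lookup_add)

text \<open>A monomial of degree \<open>p\<close> carries the component at \<open>u + p\<close> to
  the one at \<open>u\<close>.\<close>

lemma ccomp_smult:
  "ccomp i u (\<lambda>x\<in>carrier (free_module R (n i)). r * \<phi> x)
     = (\<lambda>l. \<Sum>p\<in>Poly_Mapping.keys r. Poly_Mapping.lookup r p * ccomp i (u + p) \<phi> l)"
  by (rule ext) (simp add: ccomp_def unit_vec_carrier lookup_times diff_diff_eq)

lemma homogeneous_iff:
  assumes \<phi>: "\<phi> \<in> carrier (cochains R F C i)"
  shows "homogeneous_of_degree z (free_grading R (monomial_grading S) (n i) (s i)) (monomial_grading H) \<phi>
    \<longleftrightarrow> (\<forall>u. u \<noteq> - z \<longrightarrow> ccomp i u \<phi> = (\<lambda>_. 0))"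
proof
  assume hom: "homogeneous_of_degree z (free_grading R (monomial_grading S) (n i) (s i)) (monomial_grading H) \<phi>"
  show "\<forall>u. u \<noteq> - z \<longrightarrow> ccomp i u \<phi> = (\<lambda>_. 0)"
  proof (intro allI impI ext)
    fix u l assume u: "u \<noteq> - z"
    show "ccomp i u \<phi> l = 0"
    proof (cases "l < n i")
      case True
      have "unit_vec l \<in> free_grading R (monomial_grading S) (n i) (s i) (s i l)"
        using unit_vec_carrier[OF True] S_zero
        by (auto simp: free_grading_def monomial_grading_def unit_vec_def monomial_span_def)
      then have \<phi>_unit: "\<phi> (unit_vec l) \<in> monomial_span (H \<inter> {s i l + z})"
        using hom unfolding homogeneous_of_degree_def monomial_grading_def by blast
      have "s i l - u \<noteq> s i l + z"
      proof
        assume "s i l - u = s i l + z"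
        then have "s i l - (s i l - u) = s i l - (s i l + z)" by simp
        then show False using u by simp
      qed
      then have "Poly_Mapping.lookup (\<phi> (unit_vec l)) (s i l - u) = 0" using monomial_spanD[OF \<phi>_unit, of "s i l - u"] by auto
      then show ?thesis by (simp add: ccomp_def)
    qed (simp add: ccomp_def)
  qed
next
  assume *: "\<forall>u. u \<noteq> - z \<longrightarrow> ccomp i u \<phi> = (\<lambda>_. 0)"
  have unit: "\<phi> (unit_vec l) \<in> monomial_span (H \<inter> {s i l + z})" if l: "l < n i" for l
  proof (rule monomial_spanI)
    fix x assume nz: "Poly_Mapping.lookup (\<phi> (unit_vec l)) x \<noteq> 0"
    have "x \<in> H" by (rule monomial_spanD[OF cochain_span[OF \<phi> unit_vec_carrier[OF l]] nz])
    moreover have "ccomp i (s i l - x) \<phi> l \<noteq> 0" using nz l by (simp add: ccomp_def)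
    then have "s i l - x = - z" using * by metis
    then have "s i l - (s i l - x) = s i l - (- z)" by simp
    then have "x = s i l + z" by simp
    ultimately show "x \<in> H \<inter> {s i l + z}" by simp
  qed
  show "homogeneous_of_degree z (free_grading R (monomial_grading S) (n i) (s i)) (monomial_grading H) \<phi>"
    unfolding homogeneous_of_degree_def
  proof (intro allI subsetI)
    fix g y assume "y \<in> \<phi> ` free_grading R (monomial_grading S) (n i) (s i) g"
    then obtain v where v: "v \<in> free_grading R (monomial_grading S) (n i) (s i) g" "y = \<phi> v" by blast
    have "v l * \<phi> (unit_vec l) \<in> monomial_span (H \<inter> {g + z})" if l: "l < n i" for l
    proof (rule monomial_span_times[OF _ unit[OF l]])
      show "v l \<in> monomial_span (S \<inter> {g - s i l})" using v l by (simp add: free_grading_def monomial_grading_def)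
      show "x + y \<in> H \<inter> {g + z}" if "x \<in> S \<inter> {g - s i l}" "y \<in> H \<inter> {s i l + z}" for x y
        using that H_add[of x y] by auto
    qed
    then show "y \<in> monomial_grading H (g + z)"
      unfolding v(2) cochain_apply[OF \<phi> free_gradingD(1)[OF v(1)]] monomial_grading_def
      by (intro monomial_span_sum) auto
  qed
qed

lemma coboundaries_eq_cocycles:
  assumes "\<And>u. gm.exact_at T u i"
  shows "coboundaries R F C i = cocycles R F C i"
proof (rule equalityI[OF coboundaries_cocycles subsetI])
  fix \<phi> assume "\<phi> \<in> cocycles R F C i"
  then show "\<phi> \<in> coboundaries R F C i"
    unfolding coboundaries_iff cocycles_iff using subsetD[OF assms[unfolded gm.exact_at_def]] by blast
qed

text \<open>When all cocycles are coboundaries, the quotient is that of the zero functional, which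
  has a single level.\<close>

lemma Ext_trivial:
  assumes exact: "\<And>u. gm.exact_at T u i"
  shows "carrier (quot_module (cocycle_module R F C i) (coboundaries R F C i))
    = {\<zero>\<^bsub>quot_module (cocycle_module R F C i) (coboundaries R F C i)\<^esub>}"
proof -
  interpret lv: level_sets "cocycle_module R F C i" "\<lambda>_. 0 :: 'k" "monomial_span S" "\<lambda>_. 0"
  proof
    show "carrier (cocycle_module R F C i) \<noteq> {}" unfolding cocycle_module_simps using zero_cocycles by blast
  qed (unfold cocycle_module_simps, erule (1) cocycle_closed, erule (1) cocycle_closed,
      erule (1) cocycle_closed(2)[rotated], simp_all)
  have "lv.level 0 = coboundaries R F C i"
    by (simp add: lv.level_def cocycle_module_simps coboundaries_eq_cocycles[OF exact])
  moreover have "(\<lambda>_. 0 :: 'k) ` carrier (cocycle_module R F C i) = {0}" using lv.nonempty by auto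
  ultimately show ?thesis using lv.quot_carrier lv.quot_zero by simp
qed

definition generator :: "nat \<Rightarrow> nat \<Rightarrow> 'k" where
  "generator k = (SOME h. h \<in> gm.cocycle T 0 k \<and> h \<notin> gm.boundary T 0 k \<and>
     (\<forall>c\<in>gm.cocycle T 0 k. \<exists>q. (\<lambda>j. c j - q * h j) \<in> gm.boundary T 0 k))"

text \<open>The coordinate of the class of \<open>\<phi>\<close> in a one-dimensional cohomology
  space. Looking at the component at 0 suffices for concentrated cohomology, since all other
  components of a cocycle are boundaries.\<close>

definition class_coeff :: "nat \<Rightarrow> ((nat \<Rightarrow> 'g \<Rightarrow>\<^sub>0 'k) \<Rightarrow> 'g \<Rightarrow>\<^sub>0 'k) \<Rightarrow> 'k" where
  "class_coeff k \<phi> = (THE q. (\<lambda>j. ccomp k 0 \<phi> j - q * generator k j) \<in> gm.boundary T 0 k)"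

context
  fixes k assumes conc: "gm.concentrated T k"
begin

lemma generator:
  "generator k \<in> gm.cocycle T 0 k" "generator k \<notin> gm.boundary T 0 k"
  "c \<in> gm.cocycle T 0 k \<Longrightarrow> \<exists>q. (\<lambda>j. c j - q * generator k j) \<in> gm.boundary T 0 k"
proof -
  have "gm.one_dim T 0 k" using conc by (simp only: gm.concentrated_def)
  then have "\<exists>h. h \<in> gm.cocycle T 0 k \<and> h \<notin> gm.boundary T 0 k \<and>
     (\<forall>c\<in>gm.cocycle T 0 k. \<exists>q. (\<lambda>j. c j - q * h j) \<in> gm.boundary T 0 k)"
    unfolding gm.one_dim_def Bex_def .
  from someI_ex[OF this, folded generator_def]
  have *: "generator k \<in> gm.cocycle T 0 k \<and> generator k \<notin> gm.boundary T 0 k \<and>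
     (\<forall>c\<in>gm.cocycle T 0 k. \<exists>q. (\<lambda>j. c j - q * generator k j) \<in> gm.boundary T 0 k)" .
  show "generator k \<in> gm.cocycle T 0 k" using * by (rule conjunct1)
  show "generator k \<notin> gm.boundary T 0 k" using * by (rule conjunct2[THEN conjunct1])
  show "c \<in> gm.cocycle T 0 k \<Longrightarrow> \<exists>q. (\<lambda>j. c j - q * generator k j) \<in> gm.boundary T 0 k"
    by (rule bspec[OF *[THEN conjunct2, THEN conjunct2]])
qed

lemma generator_multiple:
  assumes "(\<lambda>j. q * generator k j) \<in> gm.boundary T 0 k" shows "q = 0"
proof (rule ccontr)
  assume q: "q \<noteq> 0"
  have "(\<lambda>j. 0 - (- 1 / q) * (q * generator k j)) \<in> gm.boundary T 0 k"
    by (rule gm.boundary_diff[OF gm.zero_boundary assms])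
  then show False using q generator(2) by simp
qed

lemma class_coeff_iff:
  assumes \<phi>: "\<phi> \<in> cocycles R F C k"
  shows "class_coeff k \<phi> = q \<longleftrightarrow> (\<lambda>j. ccomp k 0 \<phi> j - q * generator k j) \<in> gm.boundary T 0 k"
proof -
  have unique: "q = q'" if "(\<lambda>j. ccomp k 0 \<phi> j - q * generator k j) \<in> gm.boundary T 0 k"
    "(\<lambda>j. ccomp k 0 \<phi> j - q' * generator k j) \<in> gm.boundary T 0 k" for q q'
  proof -
    have "(\<lambda>j. (ccomp k 0 \<phi> j - q * generator k j) - 1 * (ccomp k 0 \<phi> j - q' * generator k j)) \<in> gm.boundary T 0 k"
      using that by (rule gm.boundary_diff)
    then have "(\<lambda>j. (q' - q) * generator k j) \<in> gm.boundary T 0 k" by (simp add: algebra_simps)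
    then show ?thesis using generator_multiple by fastforce
  qed
  have "ccomp k 0 \<phi> \<in> gm.cocycle T 0 k" using \<phi> by (simp add: cocycles_iff)
  then obtain q' where q': "(\<lambda>j. ccomp k 0 \<phi> j - q' * generator k j) \<in> gm.boundary T 0 k"
    using generator(3) by blast
  then have "class_coeff k \<phi> = q'" unfolding class_coeff_def using unique by (intro the_equality) auto
  then show ?thesis using q' unique[of q q'] by auto
qed

lemma exact_nonzero: "u \<noteq> 0 \<Longrightarrow> gm.cocycle T u k \<subseteq> gm.boundary T u k"
  using conc by (simp add: gm.concentrated_def gm.exact_at_def)

lemma coboundaries_class_coeff: "coboundaries R F C k = {\<phi> \<in> cocycles R F C k. class_coeff k \<phi> = 0}"
proof -
  have "\<phi> \<in> coboundaries R F C k \<longleftrightarrow> class_coeff k \<phi> = 0" if \<phi>: "\<phi> \<in> cocycles R F C k" for \<phi>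
  proof -
    have "class_coeff k \<phi> = 0 \<longleftrightarrow> ccomp k 0 \<phi> \<in> gm.boundary T 0 k" using class_coeff_iff[OF \<phi>, of 0] by simp
    moreover have "ccomp k u \<phi> \<in> gm.boundary T u k" if "u \<noteq> 0" for u
      using exact_nonzero[OF that] \<phi> by (auto simp: cocycles_iff)
    then have "(\<forall>u. ccomp k u \<phi> \<in> gm.boundary T u k) \<longleftrightarrow> ccomp k 0 \<phi> \<in> gm.boundary T 0 k" by metis
    ultimately show ?thesis using \<phi> by (simp add: coboundaries_iff cocycles_iff)
  qed
  then show ?thesis using coboundaries_cocycles by blast
qed

lemma class_coeff_add:
  assumes \<phi>: "\<phi> \<in> cocycles R F C k" and \<psi>: "\<psi> \<in> cocycles R F C k"
  shows "class_coeff k (\<lambda>x\<in>carrier (free_module R (n k)). \<phi> x + \<psi> x) = class_coeff k \<phi> + class_coeff k \<psi>"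
proof -
  have "(\<lambda>j. ccomp k 0 \<phi> j - class_coeff k \<phi> * generator k j) \<in> gm.boundary T 0 k"
    "(\<lambda>j. ccomp k 0 \<psi> j - class_coeff k \<psi> * generator k j) \<in> gm.boundary T 0 k"
    using class_coeff_iff[OF \<phi>, of "class_coeff k \<phi>"] class_coeff_iff[OF \<psi>, of "class_coeff k \<psi>"] by simp_all
  then have "(\<lambda>j. (ccomp k 0 \<phi> j - class_coeff k \<phi> * generator k j)
      - (- 1) * (ccomp k 0 \<psi> j - class_coeff k \<psi> * generator k j)) \<in> gm.boundary T 0 k"
    by (rule gm.boundary_diff)
  then show ?thesis
    unfolding class_coeff_iff[OF cocycle_closed(1)[OF \<phi> \<psi>]] ccomp_add by (simp add: algebra_simps)
qed

text \<open>Multiplication by a monomial \<open>x\<^sup>p\<close> with \<open>p \<noteq> 0\<close> moves a component in which the complex is exact into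
  degree \<open>0\<close>, so it annihilates the classes.\<close>

lemma class_coeff_smult:
  assumes r: "r \<in> monomial_span S" and \<phi>: "\<phi> \<in> cocycles R F C k"
  shows "class_coeff k (\<lambda>x\<in>carrier (free_module R (n k)). r * \<phi> x) = Poly_Mapping.lookup r 0 * class_coeff k \<phi>"
  unfolding class_coeff_iff[OF cocycle_closed(2)[OF \<phi> r]]
proof -
  define e where "e p j = ccomp k (0 + p) \<phi> j - (if p = 0 then class_coeff k \<phi> * generator k j else 0)" for p j
  have "e p \<in> gm.boundary T 0 k" if p: "p \<in> Poly_Mapping.keys r" for p
  proof (cases "p = 0")
    case True
    then show ?thesis using class_coeff_iff[OF \<phi>, of "class_coeff k \<phi>"] by (simp add: e_def[abs_def])
  next
    case False
    have "p \<in> S" using p r by (auto simp: monomial_span_def)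
    moreover have "ccomp k (0 + p) \<phi> \<in> gm.boundary T (0 + p) k"
      using exact_nonzero[of "0 + p"] False \<phi> by (auto simp: cocycles_iff)
    ultimately have "ccomp k (0 + p) \<phi> \<in> gm.boundary T 0 k" using gm.boundary_mono[OF T_down] by blast
    then show ?thesis using False by (simp add: e_def[abs_def])
  qed
  then have "(\<lambda>j. \<Sum>p\<in>Poly_Mapping.keys r. Poly_Mapping.lookup r p * e p j) \<in> gm.boundary T 0 k"
    by (rule gm.boundary_sum)
  moreover have "(\<Sum>p\<in>Poly_Mapping.keys r. Poly_Mapping.lookup r p * e p j)
      = ccomp k 0 (\<lambda>x\<in>carrier (free_module R (n k)). r * \<phi> x) j - Poly_Mapping.lookup r 0 * class_coeff k \<phi> * generator k j" for j
  proof -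
    have "(\<Sum>p\<in>Poly_Mapping.keys r. Poly_Mapping.lookup r p * e p j)
        = (\<Sum>p\<in>Poly_Mapping.keys r. Poly_Mapping.lookup r p * ccomp k (0 + p) \<phi> j)
          - (\<Sum>p\<in>Poly_Mapping.keys r. if p = 0 then Poly_Mapping.lookup r 0 * class_coeff k \<phi> * generator k j else 0)"
      unfolding sum_subtractf[symmetric] by (intro sum.cong) (auto simp: e_def algebra_simps)
    then show ?thesis by (simp add: ccomp_smult in_keys_iff)
  qed
  ultimately show "(\<lambda>j. ccomp k 0 (\<lambda>x\<in>carrier (free_module R (n k)). r * \<phi> x) j
      - Poly_Mapping.lookup r 0 * class_coeff k \<phi> * generator k j) \<in> gm.boundary T 0 k" by simp
qed

text \<open>A cocycle of degree \<open>g \<noteq> 0\<close> has no component at 0. In degree 0 every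
  value occurs, by placing a multiple of \<open>generator k\<close> into that single
  component.\<close>

lemma class_coeff_grading:
  "class_coeff k ` cocycle_grading R (monomial_grading S) F C (monomial_grading H) k g = (if g = 0 then UNIV else {0})"
proof (cases "g = 0")
  case True
  have "q \<in> class_coeff k ` cocycle_grading R (monomial_grading S) F C (monomial_grading H) k 0" for q
  proof -
    have qg: "(\<lambda>j. 0 - (- q) * generator k j) \<in> gm.cocycle T 0 k"
      by (rule gm.cocycle_diff[OF gm.zero_cocycle generator(1)])
    define c where "c u = (if u = 0 then (\<lambda>j. q * generator k j) else (\<lambda>_. 0))" for u :: 'g
    have c: "c u \<in> gm.cocycle T u k" for u using qg gm.zero_cocycle by (simp add: c_def)
    then have "c u \<in> gm.cochain T u k" for u by (simp add: gm.cocycle_def)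
    moreover have "finite {u. c u \<noteq> (\<lambda>_. 0)}" by (rule finite_subset[of _ "{0}"]) (auto simp: c_def)
    ultimately obtain \<phi> where \<phi>: "\<phi> \<in> carrier (cochains R F C k)" "\<And>u. ccomp k u \<phi> = c u"
      using ccomp_assemble[of c k] by blast
    then have cocycle: "\<phi> \<in> cocycles R F C k" using c by (simp add: cocycles_iff)
    have "class_coeff k \<phi> = q" unfolding class_coeff_iff[OF cocycle] by (simp add: \<phi>(2) c_def gm.zero_boundary)
    moreover have "\<phi> \<in> cocycle_grading R (monomial_grading S) F C (monomial_grading H) k 0"
      using cocycle by (simp add: cocycle_grading_def homogeneous_iff[OF \<phi>(1)] \<phi>(2) c_def)
    ultimately show ?thesis by blast
  qed
  then show ?thesis using True by auto
next
  case False
  have "class_coeff k \<phi> = 0" if "\<phi> \<in> cocycle_grading R (monomial_grading S) F C (monomial_grading H) k g" for \<phi>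
  proof -
    have \<phi>: "\<phi> \<in> cocycles R F C k" "\<phi> \<in> carrier (cochains R F C k)"
      using that by (auto simp: cocycle_grading_def cocycles_iff)
    then have "ccomp k 0 \<phi> = (\<lambda>_. 0)" using that False homogeneous_iff[OF \<phi>(2)] by (simp add: cocycle_grading_def)
    then show ?thesis unfolding class_coeff_iff[OF \<phi>(1)] by (simp add: gm.zero_boundary)
  qed
  moreover have "(\<lambda>x\<in>carrier (free_module R (n k)). 0) \<in> cocycle_grading R (monomial_grading S) F C (monomial_grading H) k g"
    by (simp add: cocycle_grading_def zero_cocycles homogeneous_iff[OF zero_cochain] ccomp_zero)
  ultimately have "class_coeff k ` cocycle_grading R (monomial_grading S) F C (monomial_grading H) k g = {0}" by force
  then show ?thesis using False by simp
qed

text \<open>Both sides are families of level sets over the scalars, of \<open>class_coeff\<close>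
  and of the constant coefficient, with the same action of the ring; matching equal values is the
  isomorphism, and its shift is 0.\<close>

lemma Ext_residue_field:
  "graded_iso_upto_shift R
     (quot_module (cocycle_module R F C k) (coboundaries R F C k))
     (quot_grading (cocycle_module R F C k) (coboundaries R F C k)
        (cocycle_grading R (monomial_grading S) F C (monomial_grading H) k))
     res_field res_field_grading"
proof -
  interpret lv: level_sets "cocycle_module R F C k" "class_coeff k" "monomial_span S" "\<lambda>r. Poly_Mapping.lookup r 0"
  proof
    show "carrier (cocycle_module R F C k) \<noteq> {}" unfolding cocycle_module_simps using zero_cocycles by blast
  qed (unfold cocycle_module_simps, erule (1) cocycle_closed, erule (1) cocycle_closed,
      erule (1) cocycle_closed(2)[rotated], erule (1) class_coeff_add, erule (1) class_coeff_smult)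
  have N: "coboundaries R F C k = lv.level 0"
    by (simp add: lv.level_def cocycle_module_simps coboundaries_class_coeff)
  let ?E = "quot_module (cocycle_module R F C k) (lv.level 0)"
  have sub: "cocycle_grading R (monomial_grading S) F C (monomial_grading H) k g \<subseteq> carrier (cocycle_module R F C k)" for g
    by (auto simp: cocycle_grading_def cocycle_module_simps)
  have "\<exists>\<phi>. \<phi> \<in> carrier (cocycle_module R F C k) \<and> class_coeff k \<phi> = q" for q
  proof -
    have "q \<in> class_coeff k ` cocycle_grading R (monomial_grading S) F C (monomial_grading H) k 0"
      by (simp add: class_coeff_grading)
    then show ?thesis using sub by blast
  qed
  then obtain rep where rep: "\<And>q. rep q \<in> carrier (cocycle_module R F C k)" "\<And>q. class_coeff k (rep q) = q"
    by metis
  have inj: "lv.level q = lv.level q' \<longleftrightarrow> q = q'" for q q' using lv.level_inject[OF rep(1), of q q'] rep(2) by simp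
  have "class_coeff k ` carrier (cocycle_module R F C k) = UNIV" using rep by (metis UNIV_eq_I image_eqI)
  then have carrier: "carrier ?E = range lv.level" using lv.quot_carrier by simp
  have add: "lv.level q \<oplus>\<^bsub>?E\<^esub> lv.level q' = lv.level (q + q')" for q q'
    using lv.quot_add[OF rep(1) rep(1), of q q'] by (simp add: rep(2))
  have smult: "r \<odot>\<^bsub>?E\<^esub> lv.level q = lv.level (Poly_Mapping.lookup r 0 * q)" if "r \<in> monomial_span S" for r q
    using lv.quot_smult[OF that rep(1), of q] by (simp add: rep(2))
  define \<psi> where "\<psi> X = cs (THE q. X = lv.level q)" for X
  have \<psi>: "\<psi> (lv.level q) = cs q" for q by (simp add: \<psi>_def inj)
  have "\<psi> \<in> module_hom R ?E res_field"
    by (auto simp: module_hom_def carrier add smult \<psi> res_field_simps)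
  moreover have "bij_betw \<psi> (carrier ?E) (carrier res_field)"
    unfolding bij_betw_def carrier res_field_simps by (auto simp: inj_on_def \<psi> cs_inject image_image)
  moreover have "\<psi> ` quot_grading (cocycle_module R F C k) (lv.level 0)
      (cocycle_grading R (monomial_grading S) F C (monomial_grading H) k) g = res_field_grading (g + 0)" for g
    unfolding lv.quot_grading_level[where gM = "cocycle_grading R (monomial_grading S) F C (monomial_grading H) k", OF sub] class_coeff_grading
    by (simp add: res_field_grading_simps \<psi> image_image)
  ultimately show ?thesis unfolding graded_iso_upto_shift_def N by blast
qed

end
end

section \<open>The canonical module\<close>

context semigroup_algebra
begin

context
  fixes H :: "'g set"
  assumes H_add: "\<And>x y. x \<in> S \<Longrightarrow> y \<in> H \<Longrightarrow> x + y \<in> H"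
begin

lemma monomial_module_module: "Module.module R (monomial_module H :: ('g \<Rightarrow>\<^sub>0 'k, 'g \<Rightarrow>\<^sub>0 'k) module)"
proof (rule moduleI)
  show "cring R" by (rule cring_R)
  show "abelian_group (monomial_module H :: ('g \<Rightarrow>\<^sub>0 'k, 'g \<Rightarrow>\<^sub>0 'k) module)"
  proof (rule abelian_groupI)
    fix x :: "'g \<Rightarrow>\<^sub>0 'k" assume "x \<in> carrier (monomial_module H :: ('g \<Rightarrow>\<^sub>0 'k, 'g \<Rightarrow>\<^sub>0 'k) module)"
    then show "\<exists>y\<in>carrier (monomial_module H). y \<oplus>\<^bsub>monomial_module H\<^esub> x = \<zero>\<^bsub>monomial_module H\<^esub>"
      by (intro bexI[of _ "- x"]) (auto simp: monomial_module_simps monomial_span_uminus)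
  qed (auto simp: monomial_module_simps monomial_span_add add_ac)
  show "r \<odot>\<^bsub>monomial_module H\<^esub> x \<in> carrier (monomial_module H)"
    if "r \<in> carrier R" "x \<in> carrier (monomial_module H :: ('g \<Rightarrow>\<^sub>0 'k, 'g \<Rightarrow>\<^sub>0 'k) module)" for r x
    using monomial_span_times[of r S x H H] that H_add by (simp add: monomial_module_simps)
qed (simp_all add: monomial_module_simps algebra_simps)

lemma monomial_module_finsum:
  assumes "finite A" "c \<in> A \<rightarrow> monomial_span H"
  shows "finsum (monomial_module H :: ('g \<Rightarrow>\<^sub>0 'k, 'g \<Rightarrow>\<^sub>0 'k) module) c A = sum c A"
proof -
  interpret Module.module R "monomial_module H :: ('g \<Rightarrow>\<^sub>0 'k, 'g \<Rightarrow>\<^sub>0 'k) module"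
    by (rule monomial_module_module)
  show ?thesis using assms
  proof (induction A rule: finite_induct)
    case (insert x A)
    then show ?case by (subst M.finsum_insert) (auto simp: monomial_module_simps Pi_iff)
  qed (simp add: monomial_module_simps)
qed

lemma monomial_module_graded:
  "graded_module R (monomial_grading S) (monomial_module H :: ('g \<Rightarrow>\<^sub>0 'k, 'g \<Rightarrow>\<^sub>0 'k) module) (monomial_grading H)"
  unfolding graded_module_def
proof (intro conjI allI ballI)
  interpret Module.module R "monomial_module H :: ('g \<Rightarrow>\<^sub>0 'k, 'g \<Rightarrow>\<^sub>0 'k) module"
    by (rule monomial_module_module)
  show "Module.module R (monomial_module H :: ('g \<Rightarrow>\<^sub>0 'k, 'g \<Rightarrow>\<^sub>0 'k) module)"
    by (rule monomial_module_module)
  have sub: "monomial_span (H \<inter> {g}) \<subseteq> (monomial_span H :: ('g \<Rightarrow>\<^sub>0 'k) set)" for g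
    by (rule monomial_span_mono) simp
  show "subgroup (monomial_grading H g) (add_monoid (monomial_module H :: ('g \<Rightarrow>\<^sub>0 'k, 'g \<Rightarrow>\<^sub>0 'k) module))" for g
  proof
    fix x :: "'g \<Rightarrow>\<^sub>0 'k" assume x: "x \<in> monomial_grading H g"
    then have "x \<in> carrier (monomial_module H :: ('g \<Rightarrow>\<^sub>0 'k, 'g \<Rightarrow>\<^sub>0 'k) module)"
      using sub by (auto simp: monomial_grading_def monomial_module_simps)
    then have "\<ominus>\<^bsub>monomial_module H\<^esub> x = - x"
      by (intro M.minus_equality) (auto simp: monomial_module_simps monomial_span_uminus)
    then show "inv\<^bsub>add_monoid (monomial_module H :: ('g \<Rightarrow>\<^sub>0 'k, 'g \<Rightarrow>\<^sub>0 'k) module)\<^esub> x \<in> monomial_grading H g"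
      using x by (simp add: a_inv_def monomial_grading_def monomial_span_uminus)
  qed (use sub in \<open>auto simp: monomial_grading_def monomial_module_simps monomial_span_add\<close>)
  show "\<exists>!c. (\<forall>g. c g \<in> monomial_grading H g) \<and> finite {g. c g \<noteq> \<zero>\<^bsub>monomial_module H\<^esub>} \<and>
      x = finsum (monomial_module H) c {g. c g \<noteq> \<zero>\<^bsub>monomial_module H\<^esub>}"
    if x: "x \<in> carrier (monomial_module H :: ('g \<Rightarrow>\<^sub>0 'k, 'g \<Rightarrow>\<^sub>0 'k) module)" for x
  proof -
    have xH: "x \<in> monomial_span H" using x by (simp add: monomial_module_simps)
    \<comment> \<open>Uniqueness of the decomposition: the coefficient of the sum at
      \<open>g\<close> comes from the summand \<open>c g\<close> alone.\<close>
    have lookup_finsum: "c g = Poly_Mapping.single g (Poly_Mapping.lookup y g)"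
      if c: "\<forall>g. c g \<in> monomial_grading H g" and fin: "finite {g. c g \<noteq> 0}"
        and y: "y = finsum (monomial_module H) c {g. c g \<noteq> 0}" for c and y :: "'g \<Rightarrow>\<^sub>0 'k" and g
    proof -
      have cg: "c h = Poly_Mapping.single h (Poly_Mapping.lookup (c h) h)" for h
      proof (rule monomial_span_singleton)
        show "c h \<in> monomial_span (H \<inter> {h})" using c by (simp add: monomial_grading_def)
      qed
      have "c \<in> {g. c g \<noteq> 0} \<rightarrow> monomial_span H" using c sub by (auto simp: monomial_grading_def)
      then have "y = sum c {g. c g \<noteq> 0}" using y monomial_module_finsum[OF fin] by simp
      then have "Poly_Mapping.lookup y g = (\<Sum>h\<in>{g. c g \<noteq> 0}. Poly_Mapping.lookup (c h) g)" by (simp add: lookup_sum)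
      also have "\<dots> = (\<Sum>h\<in>{g. c g \<noteq> 0}. if h = g then Poly_Mapping.lookup (c g) g else 0)"
      proof (rule sum.cong[OF refl])
        fix h
        show "Poly_Mapping.lookup (c h) g = (if h = g then Poly_Mapping.lookup (c g) g else 0)"
        proof (cases "h = g")
          case False
          then have "Poly_Mapping.lookup (Poly_Mapping.single h (Poly_Mapping.lookup (c h) h)) g = 0"
            by (simp add: lookup_single_not_eq)
          then show ?thesis using cg[of h] False by simp
        qed simp
      qed
      also have "\<dots> = Poly_Mapping.lookup (c g) g" using fin by simp
      finally show ?thesis using cg[of g] by simp
    qed
    define c where "c g = Poly_Mapping.single g (Poly_Mapping.lookup x g)" for g
    have c: "\<forall>g. c g \<in> monomial_grading H g"
      using xH monomial_spanD by (auto simp: c_def monomial_grading_def intro!: monomial_span_single)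
    have keys: "{g. c g \<noteq> 0} = Poly_Mapping.keys x"
      by (auto simp: c_def in_keys_iff) (metis lookup_single_eq lookup_zero)
    have "c \<in> Poly_Mapping.keys x \<rightarrow> monomial_span H" using c sub by (auto simp: monomial_grading_def)
    then have "x = finsum (monomial_module H) c {g. c g \<noteq> 0}"
      unfolding keys by (simp add: monomial_module_finsum) (simp add: c_def poly_mapping_sum_single[symmetric])
    then have "(\<forall>g. c g \<in> monomial_grading H g) \<and> finite {g. c g \<noteq> 0} \<and>
        x = finsum (monomial_module H) c {g. c g \<noteq> 0}"
      using c keys by simp
    moreover have "c' = c" if "(\<forall>g. c' g \<in> monomial_grading H g) \<and> finite {g. c' g \<noteq> 0} \<and>
        x = finsum (monomial_module H) c' {g. c' g \<noteq> 0}" for c'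
      unfolding c_def by (rule ext, rule lookup_finsum) (use that in blast)+
    ultimately show ?thesis unfolding monomial_module_simps by (rule ex1I)
  qed
  show "r \<odot>\<^bsub>monomial_module H\<^esub> x \<in> monomial_grading H (g + h)"
    if "r \<in> monomial_grading S g" "x \<in> monomial_grading H h" for g h and r x :: "'g \<Rightarrow>\<^sub>0 'k"
    using that H_add monomial_span_times[of r "S \<inter> {g}" x "H \<inter> {h}" "H \<inter> {g + h}"]
    by (auto simp: monomial_grading_def monomial_module_simps)
qed

lemma monomial_module_finitely_generated:
  assumes Q: "finite Q" and H: "H = {q + x | q x. q \<in> Q \<and> x \<in> S}"
  shows "finitely_generated_module R (monomial_module H :: ('g \<Rightarrow>\<^sub>0 'k, 'g \<Rightarrow>\<^sub>0 'k) module)"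
proof -
  let ?C = "monomial_module H :: ('g \<Rightarrow>\<^sub>0 'k, 'g \<Rightarrow>\<^sub>0 'k) module"
  interpret Module.module R ?C by (rule monomial_module_module)
  define A where "A = (\<lambda>q. Poly_Mapping.single q (1 :: 'k)) ` Q"
  have "q \<in> H" if "q \<in> Q" for q
  proof -
    have "q = q + 0" by simp
    then show ?thesis unfolding H using that S_zero by blast
  qed
  then have A: "A \<subseteq> carrier ?C" by (auto simp: A_def monomial_module_simps intro: monomial_span_single)
  have "carrier ?C \<subseteq> N" if N: "submodule N R ?C" "A \<subseteq> N" for N
  proof
    fix f assume "f \<in> carrier ?C"
    then have f: "Poly_Mapping.keys f \<subseteq> H" by (simp add: monomial_module_simps monomial_span_def)
    interpret N: submodule N R ?C by (rule N(1))
    have single_N: "Poly_Mapping.single h c \<in> N" if h: "h \<in> H" for h and c :: 'k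
    proof -
      obtain q x where q: "h = q + x" "q \<in> Q" "x \<in> S" using h H by blast
      then have "Poly_Mapping.single q (1 :: 'k) \<in> N" using N(2) by (auto simp: A_def)
      moreover have "Poly_Mapping.single x c \<in> carrier R" using q by (simp add: monomial_span_single)
      ultimately have "Poly_Mapping.single x c \<odot>\<^bsub>?C\<^esub> Poly_Mapping.single q 1 \<in> N"
        by (intro submodule.smult_closed[OF N(1)])
      then show ?thesis using q by (simp add: monomial_module_simps mult_single add.commute)
    qed
    have sum_N: "sum g X \<in> N" if "finite X" "\<And>h. h \<in> X \<Longrightarrow> g h \<in> N" for X and g :: "'g \<Rightarrow> 'g \<Rightarrow>\<^sub>0 'k"
      using that
    proof (induction X rule: finite_induct)
      case empty
      then show ?case using N.one_closed by (simp add: monomial_module_simps)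
    next
      case (insert x X)
      then show ?case using N.m_closed[of "g x" "sum g X"] by (simp add: monomial_module_simps)
    qed
    have "(\<Sum>h\<in>Poly_Mapping.keys f. Poly_Mapping.single h (Poly_Mapping.lookup f h)) \<in> N"
      using f by (intro sum_N single_N finite_keys) auto
    then show "f \<in> N" using poly_mapping_sum_single[of f] by simp
  qed
  then have "carrier ?C \<subseteq> (\<lambda>N. submodule N R ?C) hull A" unfolding hull_def by blast
  moreover have "submodule (carrier ?C) R ?C"
    by (rule submoduleI) (auto simp: smult_closed)
  then have "(\<lambda>N. submodule N R ?C) hull A \<subseteq> carrier ?C" by (rule hull_minimal[OF A])
  moreover have "finite A" using Q by (simp add: A_def)
  ultimately show ?thesis using A unfolding finitely_generated_module_def by blast
qed

end
end

theorem theorem1p1: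
  fixes S :: "(int ^ 'd) set" and A :: "(int ^ 'd) set" and a :: "'d \<Rightarrow> int ^ 'd"
    and R :: "((int ^ 'd) \<Rightarrow>\<^sub>0 'k::field) ring"
  assumes "simplicial_affine_semigroup S A a"
    and "R = semigroup_ring S"
    and "Cohen_Macaulay R"
  shows "canonical_module R (monomial_grading S) (monomial_span (S - {0})) CARD('d)
           (monomial_module (omega S a)) (monomial_grading (omega S a))"
proof -
  interpret sas: simplicial_affine_semigroup S A a by fact
  have cring: "cring R" and noetherian: "noetherian_ring R" using assms(3) by (simp_all add: Cohen_Macaulay_def)
  have sa: "semigroup_algebra S R"
    by (rule semigroup_algebra.intro[OF assms(2) sas.S_zero sas.S_add cring])
  have psa: "pointed_semigroup_algebra S R"
    by (intro pointed_semigroup_algebra.intro sa pointed_semigroup_algebra_axioms.intro noetherian) (rule sas.pointed)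
  interpret pointed_semigroup_algebra S R by (rule psa)
  note octant = sas.Cohen_Macaulay_octant[OF assms(2,3)]
  define H where "H = omega S a"
  have H_octant: "H = uminus ` sas.octant UNIV" unfolding H_def by (rule sas.omega_octant[OF octant])
  have H_add: "x + y \<in> H" if x: "x \<in> S" and y: "y \<in> H" for x y
  proof -
    obtain f z where "y = - f + z" "f \<in> QF S a" "z \<in> S" using y by (auto simp: H_def omega_def)
    moreover from this have "x + y = - f + (x + z)" by simp
    ultimately show ?thesis unfolding H_def omega_def using sas.S_add[OF x] by blast
  qed
  define F where "F = chosen_resolution R (monomial_grading S) res_field res_field_grading"
  have F: "graded_free_resolution R (monomial_grading S) res_field res_field_grading F"
    unfolding F_def chosen_resolution_def by (rule someI_ex[OF resolution_exists])
  then obtain D \<epsilon> where D: "augmented_graded_matrices S (res_rank F) (res_shift F) D \<epsilon>"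
      "\<And>i v. v \<in> carrier (res_module R F (Suc i)) \<Longrightarrow> res_diff F i v =
        mat_map (res_rank F i) (res_shift F i) (res_rank F (Suc i)) (res_shift F (Suc i)) (D i) v"
    using resolution_matrices by metis
  have diff: "res_diff F i \<in> module_hom R (res_module R F (Suc i)) (res_module R F i)" for i
    using F by (simp add: graded_free_resolution_def)
  interpret ag: augmented_graded_matrices S "res_rank F" "res_shift F" D \<epsilon> by (rule D(1))
  interpret gc: graded_matrices_cone S "res_rank F" "res_shift F" D a by unfold_locales
  interpret dc: dual_cochains S R H F D
  proof
    show "res_diff F i v \<in> carrier (res_module R F i)" if "v \<in> carrier (res_module R F (Suc i))" for v i
      using diff[of i] that by (auto simp: module_hom_def)
  qed (use H_add D(2) diff ag.graded_matrices_axioms in blast)+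
  have "uminus ` H = sas.octant UNIV" by (simp add: H_octant image_image)
  \<comment> \<open>With \<open>X = UNIV\<close> the cohomological degree has risen from 0 to the
    number of rays, which is the degree required of a canonical module.\<close>
  then have conc: "ag.concentrated (uminus ` H) CARD('d)"
    using gc.concentrated_octant[OF octant ag.concentrated_0 sas.a_nonzero, of UNIV] by simp
  \<comment> \<open>The negatives of the quasi-Frobenius elements generate the module, and the
    finite Apery set bounds their number.\<close>
  have "finite (QF S a)"
  proof -
    have "QF S a \<subseteq> (\<lambda>m. m - (\<Sum>i\<in>UNIV. a i)) ` Apery S (range a)"
      by (auto simp: QF_def maximal_elements_def)
    then show ?thesis using sas.finite_Apery[OF octant] finite_subset by blast
  qed
  moreover have "H = {q + x | q x. q \<in> uminus ` QF S a \<and> x \<in> S}"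
    unfolding H_def omega_def by blast
  ultimately have "finitely_generated_module R (monomial_module H :: ((int ^ 'd) \<Rightarrow>\<^sub>0 'k, _) module)"
    by (intro monomial_module_finitely_generated[OF H_add, of "uminus ` QF S a"]) auto
  moreover have "graded_module R (monomial_grading S) (monomial_module H :: ((int ^ 'd) \<Rightarrow>\<^sub>0 'k, _) module) (monomial_grading H)"
    by (rule monomial_module_graded[OF H_add])
  moreover have "carrier (Ext_module R (monomial_grading S) i res_field res_field_grading dc.C)
      = {\<zero>\<^bsub>Ext_module R (monomial_grading S) i res_field res_field_grading dc.C\<^esub>}" if "i \<noteq> CARD('d)" for i
    unfolding Ext_module_def Let_def F_def[symmetric]
    by (rule dc.Ext_trivial) (use conc that in \<open>simp add: ag.concentrated_def\<close>)
  moreover have "graded_iso_upto_shift R (Ext_module R (monomial_grading S) CARD('d) res_field res_field_grading dc.C)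
      (Ext_grading R (monomial_grading S) CARD('d) res_field res_field_grading dc.C (monomial_grading H)) res_field res_field_grading"
    unfolding Ext_module_def Ext_grading_def Let_def F_def[symmetric] by (rule dc.Ext_residue_field[OF conc])
  ultimately show ?thesis unfolding canonical_module_def Let_def H_def by blast
qed

end
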